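(* (1) For any code loop $L$ of rank $n$ there is a homomorphism $\varphi:\mathcal F_n\to L$ such that $\varphi(\mathcal F_n)=L$ and $\ker\varphi$ has codimension $1$ in $\mathcal Z(\mathcal F_n)$. (2) For every $\mathbf F_2$-subspace $T\subset\mathcal Z(\mathcal F_n)$ of codimension $1$, the quotient $L(T)=\mathcal F_n/T$ is a code loop. (3) The loop $L(T)$ is a group if and only if $T\supseteq U_n$, where $U_n=(\mathcal F_n,\mathcal F_n,\mathcal F_n)=\mathcal F_n\cap U$ and $U=(\mathcal F,\mathcal F,\mathcal F)$.
   Context: Code loops. For $u,v,w\in\mathbf F_2^m$ let $|v|$ be the number of coordinates equal to $1$, and $|u\cap v|$, $|u\cap v\cap w|$ the number of coordinates where all listed vectors equal $1$. A double even code is a subspace $E\subseteq\mathbf F_2^m$ with $|v|\equiv0\pmod 4$ and $|u\cap v|\equiv 0\pmod 2$ for all $u,v\in E$. There is a function $\phi:E\times E\to\{1,-1\}$ with $\phi(v,v)=(-1)^{|v|/4}$, $\phi(v,w)=(-1)^{|v\cap w|/2}\phi(w,v)$, $\phi(0,v)=\phi(v,0)=1$, $\phi(v+w,u)=\phi(v,w+u)\phi(v,w)\phi(w,u)(-1)^{|v\cap w\cap u|}$. The code loop $L(E)$ is the set $\{1,-1\}\times E$ with product $(\epsilon,v)(\delta,w)=(\epsilon\delta\,\phi(v,w),v+w)$; it is a Moufang loop, of rank $\dim_{\mathbf F_2}E$. A code loop is a loop isomorphic to some $L(E)$. For a Moufang loop, $(x,y,z)=((xy)z)(x(yz))^{-1}$;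 $(L,L,L)$ denotes the subloop generated by the associators; $\mathcal Z(L)$ is the center (elements commuting with all elements and associating with all pairs of elements). Construction of $\mathcal F$. Let $V$ be the $\mathbf F_2$-vector space of all finite subsets of $\mathbb N=\{1,2,\dots\}$, with addition the symmetric difference $\Delta$ (the basis vector with index $i$ is identified with $\{i\}$, also written $i$). Let $\bar V$, $W$, $U$ be elementary abelian $2$-groups, written multiplicatively, with bases respectively $\{\bar i : i\in\mathbb N\}$; the symbols $i\wedge j$ for unordered pairs $i\ne j$; and the symbols $i\wedge j\wedge k$ for unordered triples of distinct $i,j,k$. The symbols are symmetric in their indices and trivial if two indices coincide. As a set $\mathcal F=V\times(\bar V\times W\times U)$, with elements written $\sigma z$. For $\sigma,\mu\in V$, $$\sigma\cdot\mu=(\sigma\Delta\mu)\prod_{i\in\sigma\cap\mu}\bar i\ \prod_{i\in\sigma,\,j\in\mu,\,i>j} i\wedge j\ \prod_{i\in\sigma,\ j,k\in\mu,\ j<k} i\wedge j\wedge k ,$$ and $(\sigma z)\cdot(\mu z')=(\sigma\cdot\mu)\,z z'$. This is a Moufang loop; $\mathcal F_n$ is its subloop generated by $1,\dots,n\in V$. The center $\mathcal Z(\mathcal F_n)$ is regarded as an $\mathbf F_2$-vector space.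
   Formalization: In (1), n ≥ 2 is assumed and L is assumed not to be an elementary abelian 2-group: (Z/2)^{n+1} is a code loop of rank n but needs n+1 generators, and for n = 1 the center of F_1 is Z/4, not an F_2-space, so (1) fails in these cases. *)

theory Defs
  imports
    "HOL-Algebra.Coset"
    "HOL-Library.Z2"
    "HOL-Library.Poly_Mapping"
    "HOL-Library.Product_Plus"
    "Jordan_Normal_Form.VS_Connect"
begin

section \<open>Loops\<close>

text \<open>Loops are \<open>HOL-Algebra\<close> monoid records; associativity is not assumed. The library notions
  \<open>hom\<close>, \<open>kernel\<close>, \<open>is_iso\<close>, \<open>m_inv\<close> and \<open>Mod\<close> are defined for arbitrary such records and are
  used unchanged.\<close>

locale loop =
  fixes L (structure)
  assumes m_closed: "x \<in> carrier L \<Longrightarrow> y \<in> carrier L \<Longrightarrow> x \<otimes> y \<in> carrier L"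
    and one_closed: "\<one> \<in> carrier L"
    and l_one: "x \<in> carrier L \<Longrightarrow> \<one> \<otimes> x = x"
    and r_one: "x \<in> carrier L \<Longrightarrow> x \<otimes> \<one> = x"
    and l_div: "a \<in> carrier L \<Longrightarrow> b \<in> carrier L \<Longrightarrow> \<exists>!x. x \<in> carrier L \<and> a \<otimes> x = b"
    and r_div: "a \<in> carrier L \<Longrightarrow> b \<in> carrier L \<Longrightarrow> \<exists>!y. y \<in> carrier L \<and> y \<otimes> a = b"

definition subloop :: "'a set \<Rightarrow> ('a, 'b) monoid_scheme \<Rightarrow> bool" where
  "subloop H L \<longleftrightarrow> H \<subseteq> carrier L \<and> loop (L\<lparr>carrier := H\<rparr>)"

definition subloop_generated :: "('a, 'b) monoid_scheme \<Rightarrow> 'a set \<Rightarrow> 'a set" where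
  "subloop_generated L S = \<Inter> {H. subloop H L \<and> S \<subseteq> H}"

definition associator :: "('a, 'b) monoid_scheme \<Rightarrow> 'a \<Rightarrow> 'a \<Rightarrow> 'a \<Rightarrow> 'a" where
  "associator L x y z =
     ((x \<otimes>\<^bsub>L\<^esub> y) \<otimes>\<^bsub>L\<^esub> z) \<otimes>\<^bsub>L\<^esub> inv\<^bsub>L\<^esub> (x \<otimes>\<^bsub>L\<^esub> (y \<otimes>\<^bsub>L\<^esub> z))"

definition associator_subloop :: "('a, 'b) monoid_scheme \<Rightarrow> 'a set" where
  "associator_subloop L = subloop_generated L
     {associator L x y z | x y z. x \<in> carrier L \<and> y \<in> carrier L \<and> z \<in> carrier L}"

definition loop_center :: "('a, 'b) monoid_scheme \<Rightarrow> 'a set" where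
  "loop_center L = {z \<in> carrier L.
     (\<forall>x \<in> carrier L. z \<otimes>\<^bsub>L\<^esub> x = x \<otimes>\<^bsub>L\<^esub> z) \<and>
     (\<forall>x \<in> carrier L. \<forall>y \<in> carrier L.
        (z \<otimes>\<^bsub>L\<^esub> x) \<otimes>\<^bsub>L\<^esub> y = z \<otimes>\<^bsub>L\<^esub> (x \<otimes>\<^bsub>L\<^esub> y) \<and>
        (x \<otimes>\<^bsub>L\<^esub> z) \<otimes>\<^bsub>L\<^esub> y = x \<otimes>\<^bsub>L\<^esub> (z \<otimes>\<^bsub>L\<^esub> y) \<and>
        (x \<otimes>\<^bsub>L\<^esub> y) \<otimes>\<^bsub>L\<^esub> z = x \<otimes>\<^bsub>L\<^esub> (y \<otimes>\<^bsub>L\<^esub> z))}"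

text \<open>The center, written additively, with the only possible scalar multiplication by the field
  with two elements. It is a vector space exactly if the center has exponent at most 2; otherwise
  no set satisfies \<open>center_codim1\<close> below, because \<open>VectorSpace.subspace\<close> requires the ambient
  structure to be a vector space.\<close>

definition center_space :: "('a, 'b) monoid_scheme \<Rightarrow> (bit, 'a) module" where
  "center_space L = \<lparr>
     carrier = loop_center L,
     mult = undefined,
     one = undefined,
     zero = \<one>\<^bsub>L\<^esub>,
     add = (\<lambda>x y. x \<otimes>\<^bsub>L\<^esub> y),
     smult = (\<lambda>c x. if c = 0 then \<one>\<^bsub>L\<^esub> else x) \<rparr>"

definition center_codim1 :: "('a, 'b) monoid_scheme \<Rightarrow> 'a set \<Rightarrow> bool" where
  "center_codim1 L T \<longleftrightarrow>
     VectorSpace.subspace class_ring T (center_space L) \<and>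
     vectorspace.fin_dim class_ring (center_space L) \<and>
     vectorspace.dim class_ring (center_space L) =
       vectorspace.dim class_ring (center_space L\<lparr>carrier := T\<rparr>) + 1"

definition elementary_abelian_2 :: "('a, 'b) monoid_scheme \<Rightarrow> bool" where
  "elementary_abelian_2 L \<longleftrightarrow>
     comm_group L \<and> (\<forall>x \<in> carrier L. x \<otimes>\<^bsub>L\<^esub> x = \<one>\<^bsub>L\<^esub>)"


section \<open>Code loops\<close>

definition supp :: "bit vec \<Rightarrow> nat set" where
  "supp v = {i. i < dim_vec v \<and> v $ i = 1}"

definition double_even_code :: "nat \<Rightarrow> bit vec set \<Rightarrow> bool" where
  "double_even_code m E \<longleftrightarrow>
     VectorSpace.subspace class_ring E (module_vec TYPE(bit) m) \<and>
     (\<forall>v \<in> E. 4 dvd card (supp v)) \<and>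
     (\<forall>u \<in> E. \<forall>v \<in> E. 2 dvd card (supp u \<inter> supp v))"

definition code_dim :: "nat \<Rightarrow> bit vec set \<Rightarrow> nat" where
  "code_dim m E = vectorspace.dim class_ring (module_vec TYPE(bit) m\<lparr>carrier := E\<rparr>)"

definition code_factor_set ::
    "nat \<Rightarrow> bit vec set \<Rightarrow> (bit vec \<Rightarrow> bit vec \<Rightarrow> int) \<Rightarrow> bool" where
  "code_factor_set m E \<phi> \<longleftrightarrow>
     (\<forall>v \<in> E. \<forall>w \<in> E. \<phi> v w \<in> {1, -1}) \<and>
     (\<forall>v \<in> E. \<phi> v v = (-1) ^ (card (supp v) div 4)) \<and>
     (\<forall>v \<in> E. \<forall>w \<in> E. \<phi> v w = (-1) ^ (card (supp v \<inter> supp w) div 2) * \<phi> w v) \<and>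
     (\<forall>v \<in> E. \<phi> (0\<^sub>v m) v = 1 \<and> \<phi> v (0\<^sub>v m) = 1) \<and>
     (\<forall>v \<in> E. \<forall>w \<in> E. \<forall>u \<in> E.
        \<phi> (v + w) u =
          \<phi> v (w + u) * \<phi> v w * \<phi> w u * (-1) ^ card (supp v \<inter> supp w \<inter> supp u))"

definition code_loop_of ::
    "nat \<Rightarrow> bit vec set \<Rightarrow> (bit vec \<Rightarrow> bit vec \<Rightarrow> int) \<Rightarrow> (int \<times> bit vec) monoid" where
  "code_loop_of m E \<phi> = \<lparr>
     carrier = {1, -1} \<times> E,
     mult = (\<lambda>(e, v) (d, w). (e * d * \<phi> v w, v + w)),
     one = (1, 0\<^sub>v m) \<rparr>"

text \<open>The condition \<open>loop L\<close> is not redundant: \<open>is_iso\<close> does not constrain the \<open>one\<close> field.\<close>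

definition code_loop_of_rank :: "nat \<Rightarrow> ('a, 'b) monoid_scheme \<Rightarrow> bool" where
  "code_loop_of_rank n L \<longleftrightarrow> loop L \<and>
     (\<exists>m E \<phi>. double_even_code m E \<and> code_dim m E = n \<and> code_factor_set m E \<phi> \<and>
        L \<cong> code_loop_of m E \<phi>)"

definition code_loop :: "('a, 'b) monoid_scheme \<Rightarrow> bool" where
  "code_loop L \<longleftrightarrow> (\<exists>n. code_loop_of_rank n L)"


section \<open>The loop \<open>\<F>\<close>\<close>

text \<open>The elementary abelian 2-group with basis \<open>B\<close> is the group of finitely supported functions
  from \<open>B\<close> to the field \<open>bit\<close>, so its operation is \<open>+\<close>. An unordered pair or triple of distinct
  indices is represented by the set of its entries. The triple of groups collects the parts in
  \<open>V\<close>-bar, \<open>W\<close> and \<open>U\<close>; indices start at 1.\<close>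

type_synonym central = "(nat \<Rightarrow>\<^sub>0 bit) \<times> (nat set \<Rightarrow>\<^sub>0 bit) \<times> (nat set \<Rightarrow>\<^sub>0 bit)"

definition wedge2 :: "nat \<Rightarrow> nat \<Rightarrow> (nat set \<Rightarrow>\<^sub>0 bit)" where
  "wedge2 i j = (if i \<noteq> j then Poly_Mapping.single {i, j} 1 else 0)"

definition wedge3 :: "nat \<Rightarrow> nat \<Rightarrow> nat \<Rightarrow> (nat set \<Rightarrow>\<^sub>0 bit)" where
  "wedge3 i j k =
     (if i \<noteq> j \<and> i \<noteq> k \<and> j \<noteq> k then Poly_Mapping.single {i, j, k} 1 else 0)"

definition Vbar_carrier :: "(nat \<Rightarrow>\<^sub>0 bit) set" where
  "Vbar_carrier = {a. Poly_Mapping.keys a \<subseteq> {1..}}"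

definition W_carrier :: "(nat set \<Rightarrow>\<^sub>0 bit) set" where
  "W_carrier = {w. Poly_Mapping.keys w \<subseteq> {p. p \<subseteq> {1..} \<and> card p = 2}}"

definition U_carrier :: "(nat set \<Rightarrow>\<^sub>0 bit) set" where
  "U_carrier = {u. Poly_Mapping.keys u \<subseteq> {t. t \<subseteq> {1..} \<and> card t = 3}}"

definition F_cocycle :: "nat set \<Rightarrow> nat set \<Rightarrow> central" where
  "F_cocycle \<sigma> \<mu> =
     ((\<Sum>i \<in> \<sigma> \<inter> \<mu>. Poly_Mapping.single i 1),
      (\<Sum>(i, j) \<in> {(i, j). i \<in> \<sigma> \<and> j \<in> \<mu> \<and> i > j}. wedge2 i j),
      (\<Sum>(i, j, k) \<in> {(i, j, k). i \<in> \<sigma> \<and> j \<in> \<mu> \<and> k \<in> \<mu> \<and> j < k}. wedge3 i j k))"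

definition F_loop :: "(nat set \<times> central) monoid" where
  "F_loop = \<lparr>
     carrier = {\<sigma>. finite \<sigma> \<and> \<sigma> \<subseteq> {1..}} \<times> (Vbar_carrier \<times> W_carrier \<times> U_carrier),
     mult = (\<lambda>(\<sigma>, z) (\<mu>, z'). (sym_diff \<sigma> \<mu>, F_cocycle \<sigma> \<mu> + z + z')),
     one = ({}, 0) \<rparr>"

definition Fn_loop :: "nat \<Rightarrow> (nat set \<times> central) monoid" where
  "Fn_loop n =
     F_loop\<lparr>carrier := subloop_generated F_loop {({i}, 0) | i. i \<in> {1..n}}\<rparr>"

definition U_in_F :: "(nat set \<times> central) set" where
  "U_in_F = {({}, (0, 0, u)) | u. u \<in> U_carrier}"

end

theory Submission
  imports Defs
begin

text \<open>A linear functional \<open>\<lambda>\<close> on the center of \<open>\<F>\<^sub>n\<close> turns the cocycle of \<open>\<F>\<close> into a factor set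
  \<open>f\<close> on the subsets of \<open>{1..n}\<close> with values in the field with two elements. Its square map
  \<open>f \<sigma> \<sigma>\<close>, commutator \<open>f \<sigma> \<mu> + f \<mu> \<sigma>\<close> and associator form a cubic form with its two
  polarizations, and so do \<open>|v| / 4\<close>, \<open>|v \<inter> w| / 2\<close> and \<open>|v \<inter> w \<inter> u|\<close> modulo 2 on a double even
  code with basis \<open>v\<^sub>1, \<dots>, v\<^sub>n\<close>. Hence the two agree as soon as \<open>\<lambda>\<close> takes the values
  \<open>|v\<^sub>i| / 4\<close>, \<open>|v\<^sub>i \<inter> v\<^sub>j| / 2\<close> and \<open>|v\<^sub>i \<inter> v\<^sub>j \<inter> v\<^sub>k|\<close> on the basis of the center.
  Two factor sets with the same square map, commutator and associator differ by a symmetric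
  cocycle vanishing on the diagonal, that is, by a coboundary; this gives the homomorphism onto a
  given code loop. Conversely, vectors with arbitrary prescribed values of these invariants exist,
  so every subspace of codimension 1, being the kernel of some \<open>\<lambda>\<close>, gives a code loop.\<close>

text \<open>The comparison works through levels. For the loop and for the code alike, the failure of
  the square map to be additive is the commutator, the failure of the commutator to be additive is
  the associator, and the associator is additive in each argument. So the associators are compared
  first; then the difference of the commutators is additive, and after that the difference of the
  square maps. An additive function has to be checked on single indices only.

  Reading |v| / 4, |v \<inter> w| / 2 and |v \<inter> w \<inter> u| modulo 2 means knowing weights
  modulo 8, double intersections modulo 4 and triple intersections modulo 2; these are the moduli
  met when a code is constructed.

  The elementary abelian case is a genuine exception in the first claim: a code loop of rank n has
  2^(n+1) elements, whereas n elements of an elementary abelian 2-group generate at most 2^n. In the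
  proof it appears as the zero functional, whose kernel is the whole center and not a subspace of
  codimension 1.\<close>

section \<open>Vector spaces over the field with two elements\<close>

text \<open>The library rewrites addition and multiplication of bits to bit operations, which blocks
  all ring simplification rules.\<close>

declare add_bit_eq_xor [simp del] mult_bit_eq_and [simp del]

lemma bit_add_self [simp]: "b + b = (0 :: bit)"
  by (cases b) (auto simp: add_bit_eq_xor)

lemma bit_vs_add_self:
  fixes V :: "(bit, 'b) module"
  assumes "vectorspace class_ring V" and x: "x \<in> carrier V"
  shows "x \<oplus>\<^bsub>V\<^esub> x = \<zero>\<^bsub>V\<^esub>"
proof -
  interpret vectorspace "class_ring :: bit ring" V by fact
  have "x \<oplus>\<^bsub>V\<^esub> x = (1 \<odot>\<^bsub>V\<^esub> x) \<oplus>\<^bsub>V\<^esub> (1 \<odot>\<^bsub>V\<^esub> x)"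
    using smult_one[OF x] by simp
  also have "\<dots> = (1 + 1) \<odot>\<^bsub>V\<^esub> x"
    using smult_l_distr[of 1 1 x] x by simp
  also have "\<dots> = \<zero>\<^bsub>V\<^esub>"
    using lmult_0[OF x] by simp
  finally show ?thesis .
qed

lemma bit_vs_finite_fin_dim:
  fixes V :: "(bit, 'b) module"
  assumes "vectorspace class_ring V" and finV: "finite (carrier V)"
  shows "vectorspace.fin_dim class_ring V"
proof -
  interpret vectorspace "class_ring :: bit ring" V by fact
  have "span (carrier V) = carrier V"
    using in_own_span[of "carrier V"] span_is_subset2[of "carrier V"] by blast
  then show ?thesis unfolding fin_dim_def using finV by (intro exI[of _ "carrier V"] conjI) simp_all
qed

text \<open>Coefficients from the two-element field are indicator functions, so coordinate vectors
  are subsets of \<open>{1..d}\<close> and addition is symmetric difference. This makes an arbitrary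
  code comparable with the set part of \<F>.\<close>

lemma bit_vs_coordinates:
  fixes V :: "(bit, 'b) module"
  assumes vs: "vectorspace class_ring V" and finV: "finite (carrier V)"
  defines "d \<equiv> vectorspace.dim class_ring V"
  obtains g where "bij_betw g (Pow {1..d}) (carrier V)" "g {} = \<zero>\<^bsub>V\<^esub>"
    "\<And>\<sigma> \<mu>. \<sigma> \<subseteq> {1..d} \<Longrightarrow> \<mu> \<subseteq> {1..d} \<Longrightarrow> g (sym_diff \<sigma> \<mu>) = g \<sigma> \<oplus>\<^bsub>V\<^esub> g \<mu>"
proof -
  interpret vectorspace "class_ring :: bit ring" V by fact
  obtain B where finB: "finite B" and B: "basis B"
    using finite_basis_exists bit_vs_finite_fin_dim[OF vs finV] by blast
  have BV: "B \<subseteq> carrier V" using B unfolding basis_def by blast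
  have dB: "d = card B" unfolding d_def by (rule dim_basis[OF finB B])
  obtain b where b: "bij_betw b {1..d} B"
    using ex_bij_betw_nat_finite_1[OF finB] dB by auto
  define ind :: "'b set \<Rightarrow> 'b \<Rightarrow> bit" where "ind X = (\<lambda>x. if x \<in> X then 1 else 0)" for X
  define h where "h X = lincomb (ind X) B" for X
  have h_carrier: "h X \<in> carrier V" for X
    unfolding h_def by (rule lincomb_closed[OF BV]) simp
  have crit: "\<exists>!a. a \<in> B \<rightarrow>\<^sub>E (UNIV :: bit set) \<and> lincomb a B = v" if "v \<in> carrier V" for v
    using basis_criterion[OF finB BV] B that by simp
  \<comment> \<open>\<open>basis_criterion\<close> gives uniqueness only among coefficient functions
    that are extensional on \<open>B\<close>; restricting to \<open>B\<close> changes no linear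
    combination over \<open>B\<close>.\<close>
  have restr: "lincomb (restrict a B) B = lincomb a B" for a
    unfolding lincomb_def by (rule finsum_cong') (use BV in auto)
  have inj: "inj_on h (Pow B)"
  proof (rule inj_onI)
    fix X Y assume X: "X \<in> Pow B" and Y: "Y \<in> Pow B" and eq: "h X = h Y"
    have "restrict (ind X) B = restrict (ind Y) B"
      using crit[OF h_carrier[of Y]] eq unfolding h_def
      by (metis (no_types, lifting) restr UNIV_I restrict_PiE_iff)
    then have "ind X x = ind Y x" if "x \<in> B" for x using that by (metis restrict_apply')
    then show "X = Y" using X Y unfolding ind_def
      by (metis Pow_iff one_neq_zero subsetD subsetI subset_antisym)
  qed
  have surj: "h ` Pow B = carrier V"
  proof
    show "carrier V \<subseteq> h ` Pow B"
    proof
      fix v assume "v \<in> carrier V"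
      then obtain a where a: "lincomb a B = v" using crit by blast
      have "h {x \<in> B. a x = 1} = lincomb a B"
        unfolding h_def lincomb_def ind_def
        by (rule finsum_cong') (use BV in \<open>auto simp: bit_not_one_iff\<close>)
      then show "v \<in> h ` Pow B" using a by auto
    qed
  qed (use h_carrier in auto)
  have h_add: "h (sym_diff X Y) = h X \<oplus>\<^bsub>V\<^esub> h Y" for X Y
  proof -
    have "ind (sym_diff X Y) = (\<lambda>v. ind X v \<oplus>\<^bsub>class_ring\<^esub> ind Y v)"
      by (auto simp: ind_def fun_eq_iff)
    then show ?thesis unfolding h_def
      using lincomb_sum[OF finB BV, of "ind X" "ind Y"] by simp
  qed
  have img: "bij_betw ((`) b) (Pow {1..d}) (Pow B)"
    using bij_betw_Pow[OF b] .
  show thesis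
  proof (rule that[of "\<lambda>\<sigma>. h (b ` \<sigma>)"])
    have "bij_betw h (Pow B) (carrier V)" using inj surj by (simp add: bij_betw_def)
    from bij_betw_trans[OF img this]
    show "bij_betw (\<lambda>\<sigma>. h (b ` \<sigma>)) (Pow {1..d}) (carrier V)" by (simp add: comp_def)
    have "h {} = h {} \<oplus>\<^bsub>V\<^esub> h {}" using h_add[of "{}" "{}"] by simp
    then show "h (b ` {}) = \<zero>\<^bsub>V\<^esub>" using bit_vs_add_self[OF vs h_carrier[of "{}"]] by simp
    fix \<sigma> \<mu> assume "\<sigma> \<subseteq> {1..d}" "\<mu> \<subseteq> {1..d}"
    then have "b ` sym_diff \<sigma> \<mu> = sym_diff (b ` \<sigma>) (b ` \<mu>)"
      using bij_betw_imp_inj_on[OF b] by (auto simp: inj_on_def)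
    then show "h (b ` sym_diff \<sigma> \<mu>) = h (b ` \<sigma>) \<oplus>\<^bsub>V\<^esub> h (b ` \<mu>)" by (simp add: h_add)
  qed
qed

text \<open>Through this count codimension 1 becomes index 2, a condition on cardinalities.\<close>

lemma bit_vs_card:
  fixes V :: "(bit, 'b) module"
  assumes "vectorspace class_ring V" and "finite (carrier V)"
  shows "card (carrier V) = 2 ^ vectorspace.dim class_ring V"
  using bit_vs_coordinates[OF assms] bij_betw_same_card[of _ "Pow {1..vectorspace.dim class_ring V}"]
  by (metis card_Pow card_atLeastAtMost diff_Suc_1 finite_atLeastAtMost)

text \<open>The isomorphism from the additive group of \<open>bit\<close> onto the signs. Identities
  between factor sets are proved additively and carried over by it.\<close>

definition bit_sign :: "bit \<Rightarrow> int" where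
  "bit_sign b = (if b = 0 then 1 else -1)"

lemma bit_sign_add: "bit_sign (a + b) = bit_sign a * bit_sign b"
  by (cases a; cases b) (auto simp: bit_sign_def)

lemma bit_sign_simps [simp]: "bit_sign 0 = 1" "bit_sign 1 = -1" "bit_sign b * bit_sign b = 1"
  "bit_sign b = 1 \<longleftrightarrow> b = 0" "bit_sign a = bit_sign b \<longleftrightarrow> a = b"
  by (auto simp: bit_sign_def)

lemma bit_sign_of_nat: "bit_sign (of_nat k) = (-1) ^ k"
  by (induction k) (simp_all add: bit_sign_add)

lemma bit_sign_cases: "bit_sign b \<in> {1, -1}"
  by (simp add: bit_sign_def)

section \<open>The cocycle of \<open>\<F>\<close>\<close>

text \<open>The intersection is counted twice and cancels. In exponent 2 summation over a set is
  therefore additive in the set, the source of all linearity statements about the cocycle.\<close>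

lemma sum_sym_diff:
  fixes g :: "'a \<Rightarrow> 'b::comm_monoid_add"
  assumes "finite A" "finite B" and g2: "\<And>x. g x + g x = 0"
  shows "sum g (sym_diff A B) = sum g A + sum g B"
proof -
  have A: "sum g A = sum g (A - B) + sum g (A \<inter> B)"
    using assms(1) sum.Int_Diff[of A g B] by (simp add: add.commute)
  have B: "sum g B = sum g (B - A) + sum g (A \<inter> B)"
    using assms(2) sum.Int_Diff[of B g A] by (simp add: add.commute Int_commute)
  have "sum g (A \<inter> B) + sum g (A \<inter> B) = 0"
    by (simp add: sum.distrib[symmetric] g2)
  moreover have "sum g (sym_diff A B) = sum g (A - B) + sum g (B - A)"
    by (rule sum.union_disjoint) (use assms in auto)
  ultimately show ?thesis unfolding A B by (simp add: algebra_simps)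
qed

lemma poly_mapping_bit_add_self [simp]: "f + f = (0 :: 'a \<Rightarrow>\<^sub>0 bit)"
  by (rule poly_mapping_eqI) (simp add: lookup_add)

lemma central_add_self [simp]: "z + z = (0 :: central)"
  by (cases z) (simp add: zero_prod_def)

lemma central_add_self_left [simp]: "z + (z + w) = (w :: central)"
  by (simp add: add.assoc[symmetric])

text \<open>Off the diagonal the terms cancel in pairs \<open>(x, y)\<close> and
  \<open>(y, x)\<close>.\<close>

lemma sum_alternating:
  fixes g :: "'a \<Rightarrow> 'a \<Rightarrow> 'b::comm_monoid_add"
  assumes "finite A" and "\<And>x. g x x = 0" and sym: "\<And>x y. g x y = g y x"
    and two: "\<And>z::'b. z + z = 0"
  shows "(\<Sum>x\<in>A. \<Sum>y\<in>A. g x y) = 0"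
  using assms(1)
proof induction
  case (insert a A)
  have "(\<Sum>x\<in>A. g x a) = (\<Sum>y\<in>A. g a y)" by (rule sum.cong[OF refl sym])
  then have "(\<Sum>x\<in>insert a A. \<Sum>y\<in>insert a A. g x y)
    = ((\<Sum>y\<in>A. g a y) + (\<Sum>y\<in>A. g a y)) + (\<Sum>x\<in>A. \<Sum>y\<in>A. g x y)"
    by (simp only: sum.insert[OF insert.hyps] sum.distrib assms(2) add_0_left add_0_right add.assoc)
  then show ?case by (simp only: two insert.IH add_0_left)
qed simp

definition trip :: "nat set \<Rightarrow> nat set \<Rightarrow> nat set \<Rightarrow> (nat set \<Rightarrow>\<^sub>0 bit)" where
  "trip \<sigma> \<mu> \<rho> = (\<Sum>i\<in>\<sigma>. \<Sum>j\<in>\<mu>. \<Sum>k\<in>\<rho>. wedge3 i j k)"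

lemma wedge2_commute: "wedge2 i j = wedge2 j i"
  by (simp add: wedge2_def insert_commute)

lemma wedge3_commute: "wedge3 i j k = wedge3 j i k" "wedge3 i j k = wedge3 i k j"
  by (auto simp: wedge3_def insert_commute)

lemma wedge3_same [simp]: "wedge3 i i k = 0" "wedge3 i j j = 0" "wedge3 i j i = 0"
  by (simp_all add: wedge3_def)

text \<open>Iterated sums separate membership in \<sigma> and \<mu> from the order conditions on the
  indices, so that \<open>sum_sym_diff\<close> applies to one argument at a time.\<close>

lemma F_cocycle_eq:
  assumes "finite \<sigma>" "finite \<mu>"
  shows "F_cocycle \<sigma> \<mu> =
    ((\<Sum>i\<in>\<sigma> \<inter> \<mu>. Poly_Mapping.single i 1),
     (\<Sum>i\<in>\<sigma>. \<Sum>j\<in>\<mu>. if j < i then wedge2 i j else 0),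
     (\<Sum>i\<in>\<sigma>. \<Sum>j\<in>\<mu>. \<Sum>k\<in>\<mu>. if j < k then wedge3 i j k else 0))"
proof -
  have "{(i, j). i \<in> \<sigma> \<and> j \<in> \<mu> \<and> i > j} = {x \<in> \<sigma> \<times> \<mu>. snd x < fst x}" by auto
  then have 2: "(\<Sum>(i, j) \<in> {(i, j). i \<in> \<sigma> \<and> j \<in> \<mu> \<and> i > j}. wedge2 i j)
      = (\<Sum>i\<in>\<sigma>. \<Sum>j\<in>\<mu>. if j < i then wedge2 i j else 0)"
    using assms by (simp add: sum.inter_filter sum.cartesian_product split_def)
  have "{(i, j, k). i \<in> \<sigma> \<and> j \<in> \<mu> \<and> k \<in> \<mu> \<and> j < k}
      = {x \<in> \<sigma> \<times> \<mu> \<times> \<mu>. fst (snd x) < snd (snd x)}" by auto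
  then have 3: "(\<Sum>(i, j, k) \<in> {(i, j, k). i \<in> \<sigma> \<and> j \<in> \<mu> \<and> k \<in> \<mu> \<and> j < k}. wedge3 i j k)
      = (\<Sum>i\<in>\<sigma>. \<Sum>j\<in>\<mu>. \<Sum>k\<in>\<mu>. if j < k then wedge3 i j k else 0)"
    using assms by (simp add: sum.inter_filter sum.cartesian_product split_def)
  show ?thesis unfolding F_cocycle_def 2 3 ..
qed

lemma F_cocycle_empty [simp]: "F_cocycle {} \<mu> = 0" "F_cocycle \<sigma> {} = 0"
  by (auto simp: F_cocycle_def zero_prod_def intro!: sum.neutral)

text \<open>\<open>Q\<close> is a quadratic form with polarization \<open>w\<close>: a mixed pair
  from \<mu> and \<rho> contributes once, in whichever of its two orders is increasing.\<close>

lemma quadratic_sym_diff: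
  fixes w :: "nat \<Rightarrow> nat \<Rightarrow> 'a \<Rightarrow>\<^sub>0 bit"
  assumes "finite \<mu>" "finite \<rho>" and w0: "\<And>j. w j j = 0" and sym: "\<And>j k. w j k = w k j"
  defines "Q \<equiv> \<lambda>A. \<Sum>j\<in>A. \<Sum>k\<in>A. if j < k then w j k else 0"
  shows "Q (sym_diff \<mu> \<rho>) = Q \<mu> + Q \<rho> + (\<Sum>j\<in>\<mu>. \<Sum>k\<in>\<rho>. w j k)"
proof -
  define g where "g j k = (if j < k then w j k else 0)" for j k :: nat
  have Q: "Q A = (\<Sum>j\<in>A. \<Sum>k\<in>A. g j k)" for A by (simp add: Q_def g_def)
  have "g j k + g k j = w j k" for j k
    using w0 sym[of j k] by (cases j k rule: linorder_cases) (auto simp: g_def)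
  then have cross: "(\<Sum>j\<in>\<mu>. \<Sum>k\<in>\<rho>. g j k) + (\<Sum>j\<in>\<rho>. \<Sum>k\<in>\<mu>. g j k) = (\<Sum>j\<in>\<mu>. \<Sum>k\<in>\<rho>. w j k)"
    by (subst sum.swap[of _ \<mu> \<rho>]) (simp add: sum.distrib[symmetric])
  have "Q (sym_diff \<mu> \<rho>) = Q \<mu> + Q \<rho> + ((\<Sum>j\<in>\<mu>. \<Sum>k\<in>\<rho>. g j k) + (\<Sum>j\<in>\<rho>. \<Sum>k\<in>\<mu>. g j k))"
    unfolding Q by (simp add: sum_sym_diff assms(1,2) sum.distrib add_ac)
  then show ?thesis by (simp add: cross)
qed

text \<open>The first two components of the cocycle are bilinear and hence associative. The third is
  linear in its first argument but quadratic in its second, and the polarization of the quadratic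
  part leaves the term \<open>trip\<close>.\<close>

lemma F_cocycle_associator:
  assumes "finite \<sigma>" "finite \<mu>" "finite \<rho>"
  shows "F_cocycle (sym_diff \<sigma> \<mu>) \<rho> + F_cocycle \<sigma> \<mu>
    = F_cocycle \<sigma> (sym_diff \<mu> \<rho>) + F_cocycle \<mu> \<rho> + (0, 0, trip \<sigma> \<mu> \<rho>)"
proof -
  have D: "sym_diff \<sigma> \<mu> \<inter> \<rho> = sym_diff (\<sigma> \<inter> \<rho>) (\<mu> \<inter> \<rho>)"
    "\<sigma> \<inter> sym_diff \<mu> \<rho> = sym_diff (\<sigma> \<inter> \<mu>) (\<sigma> \<inter> \<rho>)" by auto
  have fin: "finite (sym_diff \<sigma> \<mu>)" "finite (sym_diff \<mu> \<rho>)" using assms by auto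
  have Q: "(\<Sum>j\<in>sym_diff \<mu> \<rho>. \<Sum>k\<in>sym_diff \<mu> \<rho>. if j < k then wedge3 i j k else 0)
    = (\<Sum>j\<in>\<mu>. \<Sum>k\<in>\<mu>. if j < k then wedge3 i j k else 0)
      + (\<Sum>j\<in>\<rho>. \<Sum>k\<in>\<rho>. if j < k then wedge3 i j k else 0)
      + (\<Sum>j\<in>\<mu>. \<Sum>k\<in>\<rho>. wedge3 i j k)" for i
    by (rule quadratic_sym_diff[OF assms(2,3)]) (rule wedge3_same, rule wedge3_commute)
  have c1: "(\<Sum>i\<in>sym_diff \<sigma> \<mu> \<inter> \<rho>. Poly_Mapping.single i 1) + (\<Sum>i\<in>\<sigma> \<inter> \<mu>. Poly_Mapping.single i 1)
    = (\<Sum>i\<in>\<sigma> \<inter> sym_diff \<mu> \<rho>. Poly_Mapping.single i 1)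
      + (\<Sum>i\<in>\<mu> \<inter> \<rho>. Poly_Mapping.single i (1 :: bit))"
    unfolding D by (simp add: sum_sym_diff assms add_ac)
  have c2: "(\<Sum>i\<in>sym_diff \<sigma> \<mu>. \<Sum>j\<in>\<rho>. if j < i then wedge2 i j else 0)
      + (\<Sum>i\<in>\<sigma>. \<Sum>j\<in>\<mu>. if j < i then wedge2 i j else 0)
    = (\<Sum>i\<in>\<sigma>. \<Sum>j\<in>sym_diff \<mu> \<rho>. if j < i then wedge2 i j else 0)
      + (\<Sum>i\<in>\<mu>. \<Sum>j\<in>\<rho>. if j < i then wedge2 i j else 0)"
    by (simp add: sum_sym_diff assms sum.distrib add_ac)
  have c3: "(\<Sum>i\<in>sym_diff \<sigma> \<mu>. \<Sum>j\<in>\<rho>. \<Sum>k\<in>\<rho>. if j < k then wedge3 i j k else 0)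
      + (\<Sum>i\<in>\<sigma>. \<Sum>j\<in>\<mu>. \<Sum>k\<in>\<mu>. if j < k then wedge3 i j k else 0)
    = (\<Sum>i\<in>\<sigma>. \<Sum>j\<in>sym_diff \<mu> \<rho>. \<Sum>k\<in>sym_diff \<mu> \<rho>. if j < k then wedge3 i j k else 0)
      + (\<Sum>i\<in>\<mu>. \<Sum>j\<in>\<rho>. \<Sum>k\<in>\<rho>. if j < k then wedge3 i j k else 0) + trip \<sigma> \<mu> \<rho>"
    (is "?a + ?b = ?c + ?d + ?e")
  proof -
    have "?a = (\<Sum>i\<in>\<sigma>. \<Sum>j\<in>\<rho>. \<Sum>k\<in>\<rho>. if j < k then wedge3 i j k else 0) + ?d"
      (is "_ = ?f + _")
      by (rule sum_sym_diff) (use assms in simp_all)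
    moreover have "?c = ?b + ?f + ?e"
      unfolding Q trip_def by (simp only: sum.distrib)
    then have "?c + ?d + ?e = ?f + ?d + ?b + (?e + ?e)" by (simp only: add_ac)
    ultimately show ?thesis by (simp only: poly_mapping_bit_add_self add_0_right)
  qed
  show ?thesis
    unfolding F_cocycle_eq[OF assms(1,2)] F_cocycle_eq[OF assms(2,3)]
      F_cocycle_eq[OF fin(1) assms(3)] F_cocycle_eq[OF assms(1) fin(2)]
    by (simp only: add_Pair c1 c2 c3 add_0_right)
qed

lemma trip_sym_diff:
  assumes "finite \<sigma>" "finite \<mu>" "finite \<rho>" "finite \<tau>"
  shows "trip (sym_diff \<tau> \<sigma>) \<mu> \<rho> = trip \<tau> \<mu> \<rho> + trip \<sigma> \<mu> \<rho>"
  using assms by (simp add: trip_def sum_sym_diff)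

lemma trip_commute:
  "trip \<sigma> \<mu> \<rho> = trip \<mu> \<sigma> \<rho>" "trip \<sigma> \<mu> \<rho> = trip \<sigma> \<rho> \<mu>"
proof -
  show "trip \<sigma> \<mu> \<rho> = trip \<mu> \<sigma> \<rho>"
    unfolding trip_def by (subst sum.swap) (simp add: wedge3_commute(1))
  have "(\<Sum>j\<in>\<mu>. \<Sum>k\<in>\<rho>. wedge3 i j k) = (\<Sum>j\<in>\<rho>. \<Sum>k\<in>\<mu>. wedge3 i j k)" for i
    by (subst sum.swap) (simp add: wedge3_commute(2))
  then show "trip \<sigma> \<mu> \<rho> = trip \<sigma> \<rho> \<mu>" by (simp add: trip_def)
qed

lemma trip_same [simp]:
  assumes "finite \<sigma>" shows "trip \<mu> \<sigma> \<sigma> = 0"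
  unfolding trip_def
  by (rule sum.neutral, rule ballI, rule sum_alternating[OF assms])
    (simp, rule wedge3_commute(2), simp)

lemma trip_empty [simp]: "trip {} \<mu> \<rho> = 0" "trip \<sigma> {} \<rho> = 0" "trip \<sigma> \<mu> {} = 0"
  by (simp_all add: trip_def)

lemma trip_single [simp]: "trip {i} {j} {k} = wedge3 i j k"
  by (simp add: trip_def)

section \<open>The loops with indices in a given set\<close>

definition central_on :: "nat set \<Rightarrow> central set" where
  "central_on I = {(a, w, u). Poly_Mapping.keys a \<subseteq> I
     \<and> Poly_Mapping.keys w \<subseteq> {p. p \<subseteq> I \<and> card p = 2}
     \<and> Poly_Mapping.keys u \<subseteq> {t. t \<subseteq> I \<and> card t = 3}}"

text \<open>Both \<F> and its finitely generated subloops have this form, by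
  \<open>F_loop_eq\<close> and \<open>Fn_loop_eq\<close>, so their structure is worked out once for
  an arbitrary index set.\<close>

definition F_on :: "nat set \<Rightarrow> (nat set \<times> central) monoid" where
  "F_on I = F_loop\<lparr>carrier := {\<sigma>. finite \<sigma> \<and> \<sigma> \<subseteq> I} \<times> central_on I\<rparr>"

lemma F_loop_eq: "F_loop = F_on {1..}"
  by (auto simp: F_on_def F_loop_def central_on_def Vbar_carrier_def W_carrier_def U_carrier_def)

lemma carrier_F_on: "carrier (F_on I) = {\<sigma>. finite \<sigma> \<and> \<sigma> \<subseteq> I} \<times> central_on I"
  by (simp add: F_on_def)

lemma mem_F_on [simp]: "(\<sigma>, z) \<in> carrier (F_on I) \<longleftrightarrow> finite \<sigma> \<and> \<sigma> \<subseteq> I \<and> z \<in> central_on I"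
  by (simp add: carrier_F_on)

lemma mult_F_on [simp]:
  "(\<sigma>, z) \<otimes>\<^bsub>F_on I\<^esub> (\<mu>, z') = (sym_diff \<sigma> \<mu>, F_cocycle \<sigma> \<mu> + z + z')"
  by (simp add: F_on_def F_loop_def)

lemma one_F_on [simp]: "\<one>\<^bsub>F_on I\<^esub> = ({}, 0)"
  by (simp add: F_on_def F_loop_def)

lemma F_on_carrier_update: "(F_on J)\<lparr>carrier := carrier (F_on I)\<rparr> = F_on I"
  by (simp add: F_on_def)

lemma central_on_iff: "(a, w, u) \<in> central_on I \<longleftrightarrow>
    (\<forall>i. Poly_Mapping.lookup a i \<noteq> 0 \<longrightarrow> i \<in> I) \<and>
    (\<forall>p. Poly_Mapping.lookup w p \<noteq> 0 \<longrightarrow> p \<subseteq> I \<and> card p = 2) \<and>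
    (\<forall>t. Poly_Mapping.lookup u t \<noteq> 0 \<longrightarrow> t \<subseteq> I \<and> card t = 3)"
  unfolding central_on_def mem_Collect_eq prod.case subset_iff in_keys_iff by (rule refl)

lemma central_on_zero [simp]: "0 \<in> central_on I"
  by (simp add: central_on_iff zero_prod_def)

lemma central_on_add [simp]:
  assumes "a \<in> central_on I" "b \<in> central_on I"
  shows "a + b \<in> central_on I"
proof -
  obtain a1 a2 a3 where a: "a = (a1, a2, a3)" by (cases a)
  obtain b1 b2 b3 where b: "b = (b1, b2, b3)" by (cases b)
  have nz: "x + y \<noteq> 0 \<Longrightarrow> x \<noteq> 0 \<or> y \<noteq> 0" for x y :: bit by auto
  show ?thesis using assms unfolding a b add_Pair central_on_iff lookup_add using nz by meson
qed

lemma central_on_mono: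
  assumes "I \<subseteq> J"
  shows "central_on I \<subseteq> central_on J"
proof
  fix z assume "z \<in> central_on I"
  then show "z \<in> central_on J" using assms
    by (cases z) (simp only: central_on_iff, blast)
qed

lemma single_in_central_on:
  assumes "i \<in> I" "j \<in> I" "k \<in> I"
  shows "(Poly_Mapping.single i 1, 0, 0) \<in> central_on I"
    "(0, wedge2 i j, 0) \<in> central_on I" "(0, 0, wedge3 i j k) \<in> central_on I"
  using assms by (auto simp: central_on_def wedge2_def wedge3_def)

lemma central_on_sum:
  assumes "\<And>x. x \<in> A \<Longrightarrow> f x \<in> central_on I"
  shows "sum f A \<in> central_on I"
  using assms by (induction A rule: infinite_finite_induct) auto

lemma trip_in_central_on:
  assumes "\<sigma> \<subseteq> I" "\<mu> \<subseteq> I" "\<rho> \<subseteq> I"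
  shows "(0, 0, trip \<sigma> \<mu> \<rho>) \<in> central_on I"
proof -
  have "(0, 0, trip \<sigma> \<mu> \<rho>) = (\<Sum>i\<in>\<sigma>. \<Sum>j\<in>\<mu>. \<Sum>k\<in>\<rho>. ((0, 0, wedge3 i j k) :: central))"
    by (simp add: trip_def sum_prod)
  then show ?thesis using assms by (auto intro!: central_on_sum single_in_central_on)
qed

lemma F_cocycle_in_central_on:
  assumes "\<sigma> \<subseteq> I" "\<mu> \<subseteq> I"
  shows "F_cocycle \<sigma> \<mu> \<in> central_on I"
proof -
  have "F_cocycle \<sigma> \<mu> = (\<Sum>i\<in>\<sigma> \<inter> \<mu>. (Poly_Mapping.single i 1, 0, 0))
    + (\<Sum>(i, j) \<in> {(i, j). i \<in> \<sigma> \<and> j \<in> \<mu> \<and> i > j}. (0, wedge2 i j, 0))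
    + (\<Sum>(i, j, k) \<in> {(i, j, k). i \<in> \<sigma> \<and> j \<in> \<mu> \<and> k \<in> \<mu> \<and> j < k}. (0, 0, wedge3 i j k))"
    by (simp add: F_cocycle_def sum_prod split_def)
  also have "\<dots> \<in> central_on I"
    using assms by (auto intro!: central_on_add central_on_sum single_in_central_on)
  finally show ?thesis .
qed

lemma poly_mapping_bit_eq_sum:
  "f = (\<Sum>k\<in>Poly_Mapping.keys f. Poly_Mapping.single k (1 :: bit))"
  by (rule poly_mapping_eqI) (auto simp: lookup_sum lookup_single when_def in_keys_iff)

text \<open>An element is the sum of the basis elements over its three supports. The indices come in
  increasing order because the product of two generators in that order has trivial cocycle.\<close>

lemma central_on_induct [consumes 1, case_names zero add V W U]:
  assumes z: "z \<in> central_on I" and P0: "P 0"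
    and Padd: "\<And>a b. a \<in> central_on I \<Longrightarrow> b \<in> central_on I \<Longrightarrow> P a \<Longrightarrow> P b \<Longrightarrow> P (a + b)"
    and PV: "\<And>i. i \<in> I \<Longrightarrow> P (Poly_Mapping.single i 1, 0, 0)"
    and PW: "\<And>i j. i \<in> I \<Longrightarrow> j \<in> I \<Longrightarrow> i < j \<Longrightarrow> P (0, wedge2 i j, 0)"
    and PU: "\<And>i j k. i \<in> I \<Longrightarrow> j \<in> I \<Longrightarrow> k \<in> I \<Longrightarrow> i < j \<Longrightarrow> j < k \<Longrightarrow> P (0, 0, wedge3 i j k)"
  shows "P z"
proof -
  have sum: "P (sum f A) \<and> sum f A \<in> central_on I"
    if "\<And>x. x \<in> A \<Longrightarrow> P (f x)" "\<And>x. x \<in> A \<Longrightarrow> f x \<in> central_on I" for A and f :: "'x \<Rightarrow> central"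
    using that by (induction A rule: infinite_finite_induct) (auto simp: P0 Padd)
  obtain a w u where zeq: "z = (a, w, u)" by (cases z)
  have keys: "Poly_Mapping.keys a \<subseteq> I"
    "\<And>p. p \<in> Poly_Mapping.keys w \<Longrightarrow> p \<subseteq> I \<and> card p = 2"
    "\<And>t. t \<in> Poly_Mapping.keys u \<Longrightarrow> t \<subseteq> I \<and> card t = 3"
    using z by (auto simp: central_on_def zeq)
  let ?V = "\<lambda>i. (Poly_Mapping.single i 1, 0, 0) :: central"
  let ?W = "\<lambda>p. (0, Poly_Mapping.single p 1, 0) :: central"
  let ?U = "\<lambda>t. (0, 0, Poly_Mapping.single t 1) :: central"
  have V: "P (?V i) \<and> ?V i \<in> central_on I" if "i \<in> Poly_Mapping.keys a" for i
    using that keys(1) PV by (auto simp: central_on_def)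
  have W: "P (?W p) \<and> ?W p \<in> central_on I" if p: "p \<in> Poly_Mapping.keys w" for p
  proof -
    obtain i j where "p = {i, j}" "i \<noteq> j" using keys(2)[OF p] by (auto simp: card_2_iff)
    then obtain i j where ij: "p = {i, j}" "i < j"
      by (metis insert_commute linorder_neqE_nat)
    then have "?W p = (0, wedge2 i j, 0)" by (simp add: wedge2_def)
    then show ?thesis using PW[of i j] ij keys(2)[OF p] single_in_central_on(2)[of i I j] by auto
  qed
  have U: "P (?U t) \<and> ?U t \<in> central_on I" if t: "t \<in> Poly_Mapping.keys u" for t
  proof -
    have ft: "finite t" "card t = 3" using keys(3)[OF t] by (auto intro: card_ge_0_finite)
    define xs where "xs = sorted_list_of_set t"
    then have "length xs = 3" using ft by simp
    then obtain i j k where "xs = [i, j, k]"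
      by (auto simp: numeral_3_eq_3 length_Suc_conv)
    then have ijk: "t = {i, j, k}" "i < j" "j < k"
      using ft set_sorted_list_of_set[of t] strict_sorted_list_of_set[of t] xs_def by auto
    then have "?U t = (0, 0, wedge3 i j k)" by (simp add: wedge3_def)
    then show ?thesis
      using PU[of i j k] ijk keys(3)[OF t] single_in_central_on(3)[of i I j k] by auto
  qed
  have "z = sum ?V (Poly_Mapping.keys a) + sum ?W (Poly_Mapping.keys w) + sum ?U (Poly_Mapping.keys u)"
    unfolding zeq by (simp add: sum_prod poly_mapping_bit_eq_sum[symmetric])
  then show ?thesis using sum[of "Poly_Mapping.keys a" ?V] sum[of "Poly_Mapping.keys w" ?W]
      sum[of "Poly_Mapping.keys u" ?U] V W U Padd by (simp add: central_on_add)
qed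

lemma finite_poly_mapping_bit:
  assumes "finite A"
  shows "finite {f :: 'a \<Rightarrow>\<^sub>0 bit. Poly_Mapping.keys f \<subseteq> A}"
proof (rule finite_imageD)
  show "finite (Poly_Mapping.keys ` {f :: 'a \<Rightarrow>\<^sub>0 bit. Poly_Mapping.keys f \<subseteq> A})"
    by (rule finite_subset[of _ "Pow A"]) (use assms in auto)
  show "inj_on Poly_Mapping.keys {f :: 'a \<Rightarrow>\<^sub>0 bit. Poly_Mapping.keys f \<subseteq> A}"
    by (rule inj_onI) (metis poly_mapping_bit_eq_sum)
qed

lemma finite_central_on:
  assumes "finite I"
  shows "finite (central_on I)"
proof (rule finite_subset)
  show "central_on I \<subseteq> {f. Poly_Mapping.keys f \<subseteq> I} \<times> {f. Poly_Mapping.keys f \<subseteq> Pow I}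
      \<times> {f. Poly_Mapping.keys f \<subseteq> Pow I}"
    by (auto simp: central_on_def)
  show "finite ({f :: nat \<Rightarrow>\<^sub>0 bit. Poly_Mapping.keys f \<subseteq> I} \<times> {f :: nat set \<Rightarrow>\<^sub>0 bit. Poly_Mapping.keys f \<subseteq> Pow I}
      \<times> {f :: nat set \<Rightarrow>\<^sub>0 bit. Poly_Mapping.keys f \<subseteq> Pow I})"
    using assms by (intro finite_cartesian_product finite_poly_mapping_bit) auto
qed

section \<open>Loop axioms and the subloops generated by single indices\<close>

lemma loop_F_on: "loop (F_on I)"
proof
  fix a b assume "a \<in> carrier (F_on I)" "b \<in> carrier (F_on I)"
  then obtain \<sigma> z \<mu> w where ab: "a = (\<sigma>, z)" "b = (\<mu>, w)"
    and mem: "finite \<sigma>" "\<sigma> \<subseteq> I" "z \<in> central_on I" "finite \<mu>" "\<mu> \<subseteq> I" "w \<in> central_on I"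
    by (cases a; cases b) auto
  let ?\<tau> = "sym_diff \<sigma> \<mu>"
  have \<tau>: "finite ?\<tau>" "?\<tau> \<subseteq> I" using mem by auto
  show "a \<otimes>\<^bsub>F_on I\<^esub> b \<in> carrier (F_on I)"
    using mem \<tau> by (simp add: ab F_cocycle_in_central_on)
  \<comment> \<open>Both components live in groups of exponent 2, so an equation is solved by moving
    the known terms across unchanged. The set component is determined first and fixes the cocycle in
    the second equation.\<close>
  have d: "sym_diff \<sigma> \<nu> = \<mu> \<longleftrightarrow> \<nu> = ?\<tau>" "sym_diff \<nu> \<sigma> = \<mu> \<longleftrightarrow> \<nu> = ?\<tau>" for \<nu> by auto
  have solve: "c + z + v = w \<longleftrightarrow> v = c + z + w" "c + v + z = w \<longleftrightarrow> v = c + z + w" for c v :: central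
    by (auto simp: algebra_simps)
  show "\<exists>!x. x \<in> carrier (F_on I) \<and> a \<otimes>\<^bsub>F_on I\<^esub> x = b"
    by (rule ex1I[of _ "(?\<tau>, F_cocycle \<sigma> ?\<tau> + z + w)"])
      (use mem \<tau> in \<open>auto simp: ab d solve F_cocycle_in_central_on\<close>)
  show "\<exists>!y. y \<in> carrier (F_on I) \<and> y \<otimes>\<^bsub>F_on I\<^esub> a = b"
    by (rule ex1I[of _ "(?\<tau>, F_cocycle ?\<tau> \<sigma> + z + w)"])
      (use mem \<tau> in \<open>auto simp: ab d solve F_cocycle_in_central_on\<close>)
qed auto

text \<open>For the two division rules: a quotient exists in \<open>H\<close> by the loop axioms of
  \<open>H\<close> itself, and uniqueness of division in the ambient loop identifies it with
  \<open>x\<close>.\<close>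

lemma (in loop) subloopD:
  assumes H: "subloop H L"
  shows "\<one> \<in> H" "x \<in> H \<Longrightarrow> y \<in> H \<Longrightarrow> x \<otimes> y \<in> H"
    "a \<in> H \<Longrightarrow> b \<in> H \<Longrightarrow> x \<in> carrier L \<Longrightarrow> a \<otimes> x = b \<Longrightarrow> x \<in> H"
    "a \<in> H \<Longrightarrow> b \<in> H \<Longrightarrow> x \<in> carrier L \<Longrightarrow> x \<otimes> a = b \<Longrightarrow> x \<in> H"
proof -
  have HL: "H \<subseteq> carrier L" and "loop (L\<lparr>carrier := H\<rparr>)" using H by (auto simp: subloop_def)
  then interpret H: loop "L\<lparr>carrier := H\<rparr>" by simp
  show "\<one> \<in> H" using H.one_closed by simp
  show "x \<in> H \<Longrightarrow> y \<in> H \<Longrightarrow> x \<otimes> y \<in> H" using H.m_closed[of x y] by simp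
  show "x \<in> H" if "a \<in> H" "b \<in> H" "x \<in> carrier L" "a \<otimes> x = b"
    using H.l_div[of a b] l_div[of a b] HL that by auto
  show "x \<in> H" if "a \<in> H" "b \<in> H" "x \<in> carrier L" "x \<otimes> a = b"
    using H.r_div[of a b] r_div[of a b] HL that by auto
qed

lemma subloop_F_on:
  assumes "I \<subseteq> J"
  shows "subloop (carrier (F_on I)) (F_on J)"
  unfolding subloop_def F_on_carrier_update using assms loop_F_on central_on_mono[OF assms]
  by (auto simp: carrier_F_on)

lemma subloop_generated_F_on:
  assumes IJ: "I \<subseteq> J"
  shows "subloop_generated (F_on J) {({i}, 0) | i. i \<in> I} = carrier (F_on I)"
proof
  have "subloop (carrier (F_on I)) (F_on J)" by (rule subloop_F_on[OF IJ])
  moreover have "{({i}, 0) | i. i \<in> I} \<subseteq> carrier (F_on I)" by auto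
  ultimately show "subloop_generated (F_on J) {({i}, 0) | i. i \<in> I} \<subseteq> carrier (F_on I)"
    unfolding subloop_generated_def by blast
  interpret J: loop "F_on J" by (rule loop_F_on)
  have gen_mem: "(\<sigma>, z) \<in> H" if H: "subloop H (F_on J)" and gen: "\<And>i. i \<in> I \<Longrightarrow> ({i}, 0) \<in> H"
    and \<sigma>: "finite \<sigma>" "\<sigma> \<subseteq> I" and z: "z \<in> central_on I" for H \<sigma> z
  proof -
    have HJ: "H \<subseteq> carrier (F_on J)" using H by (simp add: subloop_def)
    note mult = J.subloopD(2)[OF H, of "(a, b)" "(c, d)" for a b c d, simplified]
    \<comment> \<open>Each central generator is the quotient of two products of the generators that agree
      up to it: a square, the two orders of a product, the two bracketings of a product.\<close>
    have quot: "({}, v) \<in> H" if "(\<tau>, c) \<in> H" "(\<tau>, c + v) \<in> H" "v \<in> central_on J" for \<tau> c v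
      using J.subloopD(3)[OF H that(1,2), of "({}, v)"] that(3) by simp
    have cocycles: "F_cocycle {i} {i} = (Poly_Mapping.single i 1, 0, 0)"
      "i < j \<Longrightarrow> F_cocycle {i} {j} = 0" "i < j \<Longrightarrow> F_cocycle {j} {i} = (0, wedge2 i j, 0)"
      "i < j \<Longrightarrow> j < k \<Longrightarrow> F_cocycle {i, j} {k} = 0"
      "i < j \<Longrightarrow> j < k \<Longrightarrow> F_cocycle {i} {j, k} = (0, 0, wedge3 i j k)" for i j k
      by (auto simp: F_cocycle_eq zero_prod_def wedge2_commute)
    have central: "({}, v) \<in> H" if "v \<in> central_on I" for v
      using that
    proof (induction rule: central_on_induct)
      case zero
      then show ?case using J.subloopD(1)[OF H] by simp
    next
      case (add a b)
      then show ?case using mult[of "{}" a "{}" b] by simp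
    next
      case (V i)
      then show ?case using mult[OF gen gen, of i i] by (simp add: cocycles)
    next
      case (W i j)
      have 1: "({i, j}, 0) \<in> H"
        using mult[OF gen gen, of i j] W by (simp add: cocycles insert_Diff_if insert_commute)
      have 2: "({i, j}, (0, wedge2 i j, 0)) \<in> H"
        using mult[OF gen gen, of j i] W by (simp add: cocycles insert_Diff_if insert_commute)
      show ?case
        using quot[OF 1, of "(0, wedge2 i j, 0)"] 2 single_in_central_on(2)[of i J j] W IJ by auto
    next
      case (U i j k)
      have 1: "({i, j}, 0) \<in> H"
        using mult[OF gen gen, of i j] U by (simp add: cocycles insert_Diff_if insert_commute)
      have 2: "({j, k}, 0) \<in> H"
        using mult[OF gen gen, of j k] U by (simp add: cocycles insert_Diff_if insert_commute)
      have 3: "({i, j, k}, 0) \<in> H"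
        using mult[OF 1 gen, of k] U by (simp add: cocycles insert_Diff_if insert_commute)
      have 4: "({i, j, k}, (0, 0, wedge3 i j k)) \<in> H"
        using mult[OF gen 2, of i] U by (simp add: cocycles insert_Diff_if insert_commute)
      show ?case
        using quot[OF 3, of "(0, 0, wedge3 i j k)"] 4 single_in_central_on(3)[of i J j k] U IJ by auto
    qed
    have "(\<sigma>, 0) \<in> H" using \<sigma>
    proof (induction \<sigma> rule: finite_induct)
      case empty
      then show ?case using central[of 0] by simp
    next
      case (insert i \<sigma>)
      \<comment> \<open>Multiplying by \<open>{i}\<close> adds one index to the set but leaves a
        cocycle value behind; a second multiplication by that same central element removes it, by
        exponent 2.\<close>
      have "F_cocycle \<sigma> {i} \<in> central_on I"
        using insert.prems by (intro F_cocycle_in_central_on) auto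
      moreover have "sym_diff \<sigma> {i} = insert i \<sigma>" using insert.hyps by auto
      ultimately show ?case
        using mult[OF mult[OF insert.IH gen] central, of i "F_cocycle \<sigma> {i}"] insert.prems by simp
    qed
    then show ?thesis using mult[OF _ central[OF z], of \<sigma> 0] by simp
  qed
  have "x \<in> H" if H: "subloop H (F_on J)" "{({i}, 0) | i. i \<in> I} \<subseteq> H" and x: "x \<in> carrier (F_on I)"
    for H x
  proof -
    have "({i}, 0) \<in> H" if "i \<in> I" for i using H(2) that by blast
    from gen_mem[OF H(1) this, of "fst x" "snd x"] show ?thesis using x by (simp add: carrier_F_on mem_Times_iff)
  qed
  then show "carrier (F_on I) \<subseteq> subloop_generated (F_on J) {({i}, 0) | i. i \<in> I}"
    unfolding subloop_generated_def by blast
qed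

lemma Fn_loop_eq: "Fn_loop n = F_on {1..n}"
  unfolding Fn_loop_def F_loop_eq
  by (subst subloop_generated_F_on) (auto simp: F_on_carrier_update)

section \<open>Inverses, associators and the center\<close>

lemma inv_F_on:
  assumes "(\<sigma>, z) \<in> carrier (F_on I)"
  shows "inv\<^bsub>F_on I\<^esub> (\<sigma>, z) = (\<sigma>, F_cocycle \<sigma> \<sigma> + z)"
  unfolding m_inv_def
proof (rule the_equality)
  show "(\<sigma>, F_cocycle \<sigma> \<sigma> + z) \<in> carrier (F_on I) \<and>
    (\<sigma>, z) \<otimes>\<^bsub>F_on I\<^esub> (\<sigma>, F_cocycle \<sigma> \<sigma> + z) = \<one>\<^bsub>F_on I\<^esub> \<and>
    (\<sigma>, F_cocycle \<sigma> \<sigma> + z) \<otimes>\<^bsub>F_on I\<^esub> (\<sigma>, z) = \<one>\<^bsub>F_on I\<^esub>"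
    using assms by (auto simp: F_cocycle_in_central_on algebra_simps)
next
  interpret loop "F_on I" by (rule loop_F_on)
  fix y assume y: "y \<in> carrier (F_on I) \<and> (\<sigma>, z) \<otimes>\<^bsub>F_on I\<^esub> y = \<one>\<^bsub>F_on I\<^esub> \<and>
    y \<otimes>\<^bsub>F_on I\<^esub> (\<sigma>, z) = \<one>\<^bsub>F_on I\<^esub>"
  have "(\<sigma>, F_cocycle \<sigma> \<sigma> + z) \<in> carrier (F_on I) \<and>
    (\<sigma>, z) \<otimes>\<^bsub>F_on I\<^esub> (\<sigma>, F_cocycle \<sigma> \<sigma> + z) = \<one>\<^bsub>F_on I\<^esub>"
    using assms by (auto simp: F_cocycle_in_central_on algebra_simps)
  with y show "y = (\<sigma>, F_cocycle \<sigma> \<sigma> + z)" using l_div[OF assms one_closed] by blast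
qed

text \<open>The associator is a central factor here rather than a quotient, the form in which a
  homomorphism can be applied to both bracketings.\<close>

lemma mult_assoc_F_on:
  assumes "x \<in> carrier (F_on I)" "y \<in> carrier (F_on I)" "z \<in> carrier (F_on I)"
  shows "(x \<otimes>\<^bsub>F_on I\<^esub> y) \<otimes>\<^bsub>F_on I\<^esub> z
    = ({}, (0, 0, trip (fst x) (fst y) (fst z))) \<otimes>\<^bsub>F_on I\<^esub> (x \<otimes>\<^bsub>F_on I\<^esub> (y \<otimes>\<^bsub>F_on I\<^esub> z))"
proof -
  obtain \<sigma> a \<mu> b \<rho> c where xyz: "x = (\<sigma>, a)" "y = (\<mu>, b)" "z = (\<rho>, c)"
    by (cases x; cases y; cases z)
  have fin: "finite \<sigma>" "finite \<mu>" "finite \<rho>" using assms by (auto simp: xyz)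
  have "F_cocycle (sym_diff \<sigma> \<mu>) \<rho> + (F_cocycle \<sigma> \<mu> + a + b) + c
    = (F_cocycle (sym_diff \<sigma> \<mu>) \<rho> + F_cocycle \<sigma> \<mu>) + (a + b + c)" by (simp only: add_ac)
  also have "\<dots> = 0 + (0, 0, trip \<sigma> \<mu> \<rho>)
      + (F_cocycle \<sigma> (sym_diff \<mu> \<rho>) + a + (F_cocycle \<mu> \<rho> + b + c))"
    unfolding F_cocycle_associator[OF fin] add_0_left by (simp only: add_ac)
  finally have "F_cocycle (sym_diff \<sigma> \<mu>) \<rho> + (F_cocycle \<sigma> \<mu> + a + b) + c
    = 0 + (0, 0, trip \<sigma> \<mu> \<rho>)
      + (F_cocycle \<sigma> (sym_diff \<mu> \<rho>) + a + (F_cocycle \<mu> \<rho> + b + c))" .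
  moreover have "sym_diff (sym_diff \<sigma> \<mu>) \<rho> = sym_diff {} (sym_diff \<sigma> (sym_diff \<mu> \<rho>))" by auto
  ultimately show ?thesis by (simp only: xyz mult_F_on F_cocycle_empty fst_conv)
qed

lemma associator_F_on:
  assumes "x \<in> carrier (F_on I)" "y \<in> carrier (F_on I)" "z \<in> carrier (F_on I)"
  shows "associator (F_on I) x y z = ({}, (0, 0, trip (fst x) (fst y) (fst z)))"
proof -
  interpret loop "F_on I" by (rule loop_F_on)
  obtain \<tau> d where r: "x \<otimes>\<^bsub>F_on I\<^esub> (y \<otimes>\<^bsub>F_on I\<^esub> z) = (\<tau>, d)"
    by (cases "x \<otimes>\<^bsub>F_on I\<^esub> (y \<otimes>\<^bsub>F_on I\<^esub> z)")
  then have "(\<tau>, d) \<in> carrier (F_on I)" using m_closed assms by metis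
  note inv = inv_F_on[OF this]
  show ?thesis unfolding associator_def mult_assoc_F_on[OF assms] r inv
    by (simp add: algebra_simps)
qed

text \<open>All associators lie in the U-part, by \<open>associator_F_on\<close>; conversely the
  associators of three distinct generators are its basis elements
  \<open>wedge3 i j k\<close>.\<close>

lemma associator_subloop_F_on:
  "associator_subloop (F_on I) = carrier (F_on I) \<inter> {({}, (0, 0, u)) | u. True}"
    (is "_ = ?A")
proof
  have "subloop ?A (F_on I)"
    unfolding subloop_def
  proof (intro conjI Int_lower1, unfold_locales)
    fix a b assume "a \<in> carrier (F_on I\<lparr>carrier := ?A\<rparr>)" "b \<in> carrier (F_on I\<lparr>carrier := ?A\<rparr>)"
    then obtain u v where ab: "a = ({}, (0, 0, u))" "b = ({}, (0, 0, v))"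
      and mem: "(0, 0, u) \<in> central_on I" "(0, 0, v) \<in> central_on I" by auto
    have mem': "(0, 0, u + v) \<in> central_on I" using central_on_add[OF mem] by simp
    have uv: "u + x = v \<longleftrightarrow> x = u + v" "x + u = v \<longleftrightarrow> x = u + v" for x
      by (auto simp: algebra_simps)
    show "a \<otimes>\<^bsub>F_on I\<lparr>carrier := ?A\<rparr>\<^esub> b \<in> carrier (F_on I\<lparr>carrier := ?A\<rparr>)"
      using mem' by (simp add: ab)
    show "\<exists>!x. x \<in> carrier (F_on I\<lparr>carrier := ?A\<rparr>) \<and> a \<otimes>\<^bsub>F_on I\<lparr>carrier := ?A\<rparr>\<^esub> x = b"
      by (rule ex1I[of _ "({}, (0, 0, u + v))"]) (use mem' in \<open>auto simp: ab uv\<close>)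
    show "\<exists>!x. x \<in> carrier (F_on I\<lparr>carrier := ?A\<rparr>) \<and> x \<otimes>\<^bsub>F_on I\<lparr>carrier := ?A\<rparr>\<^esub> a = b"
      by (rule ex1I[of _ "({}, (0, 0, u + v))"]) (use mem' in \<open>auto simp: ab uv\<close>)
  qed (auto simp: zero_prod_def central_on_iff)
  moreover have "associator (F_on I) x y z \<in> ?A"
    if "x \<in> carrier (F_on I)" "y \<in> carrier (F_on I)" "z \<in> carrier (F_on I)" for x y z
    using that trip_in_central_on[of "fst x" I "fst y" "fst z"]
    by (auto simp: associator_F_on carrier_F_on mem_Times_iff)
  ultimately show "associator_subloop (F_on I) \<subseteq> ?A"
    unfolding associator_subloop_def subloop_generated_def by blast
next
  interpret loop "F_on I" by (rule loop_F_on)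
  have "x \<in> H" if x: "x \<in> ?A" and H: "subloop H (F_on I)"
    and ass: "{associator (F_on I) x y z | x y z. x \<in> carrier (F_on I) \<and> y \<in> carrier (F_on I)
      \<and> z \<in> carrier (F_on I)} \<subseteq> H" for x H
  proof -
    \<comment> \<open>The induction runs over the whole of \<open>central_on I\<close>, projected to
      the last component; the basis elements of the other two components then contribute only the
      identity.\<close>
    have "({}, (0, 0, snd (snd v))) \<in> H" if "v \<in> central_on I" for v
      using that
    proof (induction rule: central_on_induct)
      case (add a b)
      then show ?case using subloopD(2)[OF H add.IH] by simp
    next
      case (U i j k)
      have "({i}, 0) \<in> carrier (F_on I)" "({j}, 0) \<in> carrier (F_on I)" "({k}, 0) \<in> carrier (F_on I)"
        using U by simp_all
      then have "associator (F_on I) ({i}, 0) ({j}, 0) ({k}, 0) \<in> H" using ass by blast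
      then show ?case using U by (simp add: associator_F_on)
    qed (use subloopD(1)[OF H] in \<open>simp_all add: zero_prod_def\<close>)
    from this[of "snd x"] show ?thesis using x by auto
  qed
  then show "?A \<subseteq> associator_subloop (F_on I)"
    unfolding associator_subloop_def subloop_generated_def by blast
qed

text \<open>If \<sigma> contains \<open>s\<close>, it does not commute with the generator of any
  index \<open>t\<close> different from \<open>s\<close>: of the two products exactly one has a
  nonzero coefficient at \<open>{s, t}\<close>, depending on which index is larger. This takes a
  second index.\<close>

lemma loop_center_F_on:
  assumes "i \<in> I" "j \<in> I" "i \<noteq> j"
  shows "loop_center (F_on I) = {{}} \<times> central_on I"
proof
  show "{{}} \<times> central_on I \<subseteq> loop_center (F_on I)"
    by (auto simp: loop_center_def add_ac)
  show "loop_center (F_on I) \<subseteq> {{}} \<times> central_on I"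
  proof clarify
    fix \<sigma> a w u assume c: "(\<sigma>, a, w, u) \<in> loop_center (F_on I)"
    then have \<sigma>: "finite \<sigma>" "\<sigma> \<subseteq> I" "(a, w, u) \<in> central_on I" by (auto simp: loop_center_def)
    have "\<sigma> = {}"
    proof (rule ccontr)
      assume "\<sigma> \<noteq> {}"
      then obtain s where s: "s \<in> \<sigma>" by auto
      obtain t where t: "t \<in> I" "t \<noteq> s" using assms by metis
      have "({t}, 0) \<in> carrier (F_on I)" using t by simp
      then have "({t}, 0) \<otimes>\<^bsub>F_on I\<^esub> (\<sigma>, a, w, u) = (\<sigma>, a, w, u) \<otimes>\<^bsub>F_on I\<^esub> ({t}, 0)"
        using c unfolding loop_center_def mem_Collect_eq by (metis (no_types))
      then have "F_cocycle {t} \<sigma> = F_cocycle \<sigma> {t}" by simp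
      then have eq: "(\<Sum>j\<in>\<sigma>. if j < t then wedge2 t j else 0)
          = (\<Sum>i\<in>\<sigma>. if t < i then wedge2 i t else 0)"
        using \<sigma> by (simp add: F_cocycle_eq)
      have l: "Poly_Mapping.lookup (wedge2 j t) {s, t} = (if j = s then 1 else 0)" for j
        using t by (auto simp: wedge2_def lookup_single when_def doubleton_eq_iff)
      have "(\<Sum>j\<in>\<sigma>. if j < t \<and> j = s then 1 else 0 :: bit)
          = (\<Sum>j\<in>\<sigma>. if t < j \<and> j = s then 1 else 0)"
      proof -
        have "Poly_Mapping.lookup (\<Sum>j\<in>\<sigma>. if j < t then wedge2 t j else 0) {s, t}
          = (\<Sum>j\<in>\<sigma>. if j < t \<and> j = s then 1 else 0)"
          by (auto simp: lookup_sum wedge2_commute[of t] l intro!: sum.cong)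
        moreover have "Poly_Mapping.lookup (\<Sum>i\<in>\<sigma>. if t < i then wedge2 i t else 0) {s, t}
          = (\<Sum>j\<in>\<sigma>. if t < j \<and> j = s then 1 else 0)"
          by (auto simp: lookup_sum l intro!: sum.cong)
        ultimately show ?thesis using eq by simp
      qed
      moreover have "(\<Sum>j\<in>\<sigma>. if P j \<and> j = s then 1 else 0 :: bit) = (if P s then 1 else 0)" for P
      proof -
        have "(\<Sum>j\<in>\<sigma>. if P j \<and> j = s then 1 else 0 :: bit) = (\<Sum>j\<in>\<sigma>. if j = s then (if P s then 1 else 0) else 0)"
          by (rule sum.cong) auto
        then show ?thesis using s \<sigma> by simp
      qed
      ultimately show False using t by (simp split: if_splits)
    qed
    then show "\<sigma> \<in> {{}} \<and> (a, w, u) \<in> central_on I" using \<sigma> by simp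
  qed
qed

section \<open>Central functionals and double even codes\<close>

lemma bit_of_nat_simps: "even n \<Longrightarrow> of_nat n = (0 :: bit)" "odd n \<Longrightarrow> of_nat n = (1 :: bit)"
  by (auto elim!: evenE oddE)

lemma bit_add_eq_0_iff: "a + b = 0 \<longleftrightarrow> a = (b :: bit)"
  by (cases a; cases b) auto

lemma card_sym_diff:
  assumes "finite A" "finite B"
  shows "card (sym_diff A B) + 2 * card (A \<inter> B) = card A + card B"
proof -
  have "card (sym_diff A B) = card (A - B) + card (B - A)"
    by (rule card_Un_disjoint) (use assms in auto)
  moreover have "card A = card (A - B) + card (A \<inter> B)"
    using assms by (metis add.commute card_Int_Diff)
  moreover have "card B = card (B - A) + card (A \<inter> B)"
    using assms by (metis add.commute card_Int_Diff Int_commute)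
  ultimately show ?thesis by linarith
qed

lemma bit_card_sym_diff:
  assumes "finite A" "finite B"
  shows "of_nat (card (sym_diff A B)) = of_nat (card A) + (of_nat (card B) :: bit)"
proof -
  have "of_nat (card (sym_diff A B) + 2 * card (A \<inter> B)) = (of_nat (card A + card B) :: bit)"
    by (simp only: card_sym_diff[OF assms])
  then show ?thesis by (simp only: of_nat_add of_nat_mult) simp
qed

text \<open>Half of the identity \<open>card_sym_diff\<close>: modulo 2, the halved cardinality has
  the parity of the intersection as its polarization.\<close>

lemma bit_half_card_sym_diff:
  assumes "finite A" "finite B" and "even (card A)" "even (card B)"
  shows "of_nat (card (sym_diff A B) div 2)
    = of_nat (card A div 2) + of_nat (card B div 2) + (of_nat (card (A \<inter> B)) :: bit)"
proof -
  obtain a b where ab: "card A = 2 * a" "card B = 2 * b" using assms by (auto elim!: evenE)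
  have "card (sym_diff A B) = 2 * (a + b - card (A \<inter> B))" "card (A \<inter> B) \<le> a + b"
    using card_sym_diff[OF assms(1,2)] ab by linarith+
  \<comment> \<open>Adding twice the intersection to both sides removes the natural subtraction, and
    the even term disappears in \<open>bit\<close>.\<close>
  then have "card (sym_diff A B) div 2 + 2 * card (A \<inter> B) = a + b + card (A \<inter> B)" by simp
  then have "of_nat (card (sym_diff A B) div 2 + 2 * card (A \<inter> B))
    = (of_nat (a + b + card (A \<inter> B)) :: bit)" by (simp only:)
  then show ?thesis by (simp only: ab of_nat_add of_nat_mult) simp
qed

text \<open>A quarter of \<open>card_sym_diff\<close>, one level further: now the halved
  intersection is the polarization.\<close>

lemma bit_quarter_card_sym_diff:
  assumes "finite A" "finite B" and "4 dvd card A" "4 dvd card B" "even (card (A \<inter> B))"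
  shows "of_nat (card (sym_diff A B) div 4)
    = of_nat (card A div 4) + of_nat (card B div 4) + (of_nat (card (A \<inter> B) div 2) :: bit)"
proof -
  obtain a b c where abc: "card A = 4 * a" "card B = 4 * b" "card (A \<inter> B) = 2 * c"
    using assms by (auto elim!: evenE dvdE)
  have "card (sym_diff A B) = 4 * (a + b - c)" "c \<le> a + b"
    using card_sym_diff[OF assms(1,2)] abc by linarith+
  then have "card (sym_diff A B) div 4 + 2 * c = a + b + c" by simp
  then have "of_nat (card (sym_diff A B) div 4 + 2 * c) = (of_nat (a + b + c) :: bit)"
    by (simp only:)
  then show ?thesis by (simp only: abc of_nat_add of_nat_mult) simp
qed

text \<open>A finite set is the symmetric difference of its singletons. Applied to the difference of
  two forms with the same defect of additivity, this reduces their equality to single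
  indices.\<close>

lemma additive_zero:
  fixes g :: "'a set \<Rightarrow> bit"
  assumes "finite \<sigma>" "\<sigma> \<subseteq> I"
    and add: "\<And>\<sigma> \<mu>. finite \<sigma> \<Longrightarrow> finite \<mu> \<Longrightarrow> \<sigma> \<subseteq> I \<Longrightarrow> \<mu> \<subseteq> I \<Longrightarrow>
      g (sym_diff \<sigma> \<mu>) = g \<sigma> + g \<mu>"
    and single: "\<And>i. i \<in> I \<Longrightarrow> g {i} = 0"
  shows "g \<sigma> = 0"
  using assms(1,2)
proof induction
  case empty
  then show ?case using add[of "{}" "{}"] by simp
next
  case (insert i \<sigma>)
  then have "sym_diff \<sigma> {i} = insert i \<sigma>" by auto
  then show ?case using add[of \<sigma> "{i}"] single[of i] insert by simp
qed

section \<open>The factor set of a central functional and its polarizations\<close>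

locale central_functional =
  fixes I :: "nat set" and lam :: "central \<Rightarrow> bit"
  assumes lam_add: "a \<in> central_on I \<Longrightarrow> b \<in> central_on I \<Longrightarrow> lam (a + b) = lam a + lam b"
begin

definition f :: "nat set \<Rightarrow> nat set \<Rightarrow> bit" where "f \<sigma> \<mu> = lam (F_cocycle \<sigma> \<mu>)"

definition t :: "nat set \<Rightarrow> nat set \<Rightarrow> nat set \<Rightarrow> bit" where
  "t \<sigma> \<mu> \<rho> = lam (0, 0, trip \<sigma> \<mu> \<rho>)"

abbreviation dom :: "nat set \<Rightarrow> bool" where "dom \<sigma> \<equiv> finite \<sigma> \<and> \<sigma> \<subseteq> I"

lemma lam_zero [simp]: "lam 0 = 0" "lam (0, 0, 0) = 0"
  using lam_add[OF central_on_zero central_on_zero] by (simp_all add: zero_prod_def)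

lemma f_empty [simp]: "f {} \<mu> = 0" "f \<mu> {} = 0"
  by (simp_all add: f_def)

lemma f_associator:
  assumes "dom \<sigma>" "dom \<mu>" "dom \<rho>"
  shows "f (sym_diff \<sigma> \<mu>) \<rho> + f \<sigma> \<mu> = f \<sigma> (sym_diff \<mu> \<rho>) + f \<mu> \<rho> + t \<sigma> \<mu> \<rho>"
proof -
  have "sym_diff \<sigma> \<mu> \<subseteq> I" "sym_diff \<mu> \<rho> \<subseteq> I" using assms by auto
  then have mem: "F_cocycle (sym_diff \<sigma> \<mu>) \<rho> \<in> central_on I" "F_cocycle \<sigma> \<mu> \<in> central_on I"
    "F_cocycle \<sigma> (sym_diff \<mu> \<rho>) \<in> central_on I" "F_cocycle \<mu> \<rho> \<in> central_on I"
    "(0, 0, trip \<sigma> \<mu> \<rho>) \<in> central_on I"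
    using assms by (auto intro: F_cocycle_in_central_on trip_in_central_on)
  have "lam (F_cocycle (sym_diff \<sigma> \<mu>) \<rho> + F_cocycle \<sigma> \<mu>)
    = lam (F_cocycle \<sigma> (sym_diff \<mu> \<rho>) + F_cocycle \<mu> \<rho> + (0, 0, trip \<sigma> \<mu> \<rho>))"
    using assms by (simp only: F_cocycle_associator)
  then show ?thesis by (simp only: lam_add mem central_on_add f_def t_def)
qed

lemma t_sym_diff:
  assumes "dom \<sigma>" "dom \<tau>" "dom \<mu>" "dom \<rho>"
  shows "t (sym_diff \<sigma> \<tau>) \<mu> \<rho> = t \<sigma> \<mu> \<rho> + t \<tau> \<mu> \<rho>"
proof -
  have "(0, 0, trip (sym_diff \<sigma> \<tau>) \<mu> \<rho>) = (0, 0, trip \<sigma> \<mu> \<rho>) + ((0, 0, trip \<tau> \<mu> \<rho>) :: central)"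
    using assms by (simp add: trip_sym_diff)
  then show ?thesis unfolding t_def using assms
    by (metis lam_add trip_in_central_on)
qed

lemma t_commute: "t \<sigma> \<mu> \<rho> = t \<mu> \<sigma> \<rho>" "t \<sigma> \<mu> \<rho> = t \<sigma> \<rho> \<mu>"
  unfolding t_def using trip_commute by metis+

lemma t_same: "finite \<sigma> \<Longrightarrow> t \<mu> \<sigma> \<sigma> = 0"
  by (simp add: t_def)

text \<open>The associator identity is taken for the three orders \<sigma> \<mu> \<rho>, \<rho>
  \<sigma> \<mu> and \<sigma> \<rho> \<mu>. In the sum the symmetric form \<open>t\<close> occurs
  three times and survives once.\<close>

lemma f_commutator_sym_diff:
  assumes "dom \<sigma>" "dom \<mu>" "dom \<rho>"
  shows "f (sym_diff \<sigma> \<mu>) \<rho> + f \<rho> (sym_diff \<sigma> \<mu>)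
    = (f \<sigma> \<rho> + f \<rho> \<sigma>) + (f \<mu> \<rho> + f \<rho> \<mu>) + t \<sigma> \<mu> \<rho>"
proof -
  have trip_rot: "t \<rho> \<sigma> \<mu> = t \<sigma> \<mu> \<rho>" "t \<sigma> \<rho> \<mu> = t \<sigma> \<mu> \<rho>" by (metis t_commute)+
  have c: "sym_diff \<rho> \<sigma> = sym_diff \<sigma> \<rho>" "sym_diff \<rho> \<mu> = sym_diff \<mu> \<rho>" by auto
  have 1: "f (sym_diff \<sigma> \<mu>) \<rho> + f \<sigma> \<mu> = f \<sigma> (sym_diff \<mu> \<rho>) + f \<mu> \<rho> + t \<sigma> \<mu> \<rho>"
    by (rule f_associator) (use assms in auto)
  have 2: "f (sym_diff \<sigma> \<rho>) \<mu> + f \<rho> \<sigma> = f \<rho> (sym_diff \<sigma> \<mu>) + f \<sigma> \<mu> + t \<sigma> \<mu> \<rho>"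
    using f_associator[OF assms(3,1,2)] trip_rot(1) unfolding c by simp
  have 3: "f (sym_diff \<sigma> \<rho>) \<mu> + f \<sigma> \<rho> = f \<sigma> (sym_diff \<mu> \<rho>) + f \<rho> \<mu> + t \<sigma> \<mu> \<rho>"
    using f_associator[OF assms(1,3,2)] trip_rot(2) unfolding c by simp
  \<comment> \<open>An equation between sums of bits is an equality of parities, and
    \<open>even_add\<close> turns addition into logical equivalence; linear algebra over
    \<open>bit\<close> thus becomes propositional reasoning for \<open>argo\<close>.\<close>
  show ?thesis using 1 2 3 unfolding Z2.bit_eq_iff even_add by argo
qed

text \<open>The form \<open>t\<close> is alternating, so it vanishes on the linearly dependent
  triples \<sigma>, \<mu>, \<open>sym_diff \<sigma> \<mu>\<close> and \<mu>, \<mu>, \<sigma>. The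
  two resulting associativity equations share the term
  \<open>f \<mu> (sym_diff \<sigma> \<mu>)\<close>, which cancels in their sum.\<close>

lemma f_square_sym_diff:
  assumes "dom \<sigma>" "dom \<mu>"
  shows "f (sym_diff \<sigma> \<mu>) (sym_diff \<sigma> \<mu>) = f \<sigma> \<sigma> + f \<mu> \<mu> + (f \<sigma> \<mu> + f \<mu> \<sigma>)"
proof -
  let ?\<rho> = "sym_diff \<sigma> \<mu>"
  have c: "sym_diff \<mu> ?\<rho> = \<sigma>" "sym_diff \<mu> \<mu> = {}" "sym_diff \<mu> \<sigma> = ?\<rho>" by auto
  have d: "dom ?\<rho>" using assms by auto
  have "t \<sigma> \<mu> ?\<rho> = t ?\<rho> \<mu> \<sigma>" by (metis t_commute)
  also have "\<dots> = t \<sigma> \<mu> \<sigma> + t \<mu> \<mu> \<sigma>" by (rule t_sym_diff) (use assms in auto)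
  also have "t \<sigma> \<mu> \<sigma> = t \<mu> \<sigma> \<sigma>" by (rule t_commute)
  also have "t \<mu> \<mu> \<sigma> = t \<sigma> \<mu> \<mu>" by (metis t_commute)
  finally have t0: "t \<sigma> \<mu> ?\<rho> = 0" using assms by (simp add: t_same)
  have t1: "t \<mu> \<mu> \<sigma> = 0" using assms t_same[of \<mu> \<sigma>] by (metis t_commute)
  have 1: "f ?\<rho> ?\<rho> + f \<sigma> \<mu> = f \<sigma> \<sigma> + f \<mu> ?\<rho>"
    using f_associator[OF assms d] by (simp only: c t0 add_0_right)
  have 2: "f \<mu> \<mu> = f \<mu> ?\<rho> + f \<mu> \<sigma>"
    using f_associator[OF assms(2) assms(2) assms(1)]
    by (simp only: c t1 add_0_right add_0_left f_empty)
  show ?thesis using 1 2 unfolding Z2.bit_eq_iff even_add by argo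
qed

end

section \<open>Agreement with the invariants of a double even code\<close>

locale matching_code = central_functional +
  fixes s :: "nat set \<Rightarrow> nat set"
  assumes s_finite: "finite (s \<sigma>)"
    and s_sym_diff: "dom \<sigma> \<Longrightarrow> dom \<mu> \<Longrightarrow> s (sym_diff \<sigma> \<mu>) = sym_diff (s \<sigma>) (s \<mu>)"
    and s_weight: "dom \<sigma> \<Longrightarrow> 4 dvd card (s \<sigma>)"
    and s_inter: "dom \<sigma> \<Longrightarrow> dom \<mu> \<Longrightarrow> even (card (s \<sigma> \<inter> s \<mu>))"
    and lam_V: "i \<in> I \<Longrightarrow> lam (Poly_Mapping.single i 1, 0, 0) = of_nat (card (s {i}) div 4)"
    and lam_W: "i \<in> I \<Longrightarrow> j \<in> I \<Longrightarrow> i < j \<Longrightarrow>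
      lam (0, wedge2 i j, 0) = of_nat (card (s {i} \<inter> s {j}) div 2)"
    and lam_U: "i \<in> I \<Longrightarrow> j \<in> I \<Longrightarrow> k \<in> I \<Longrightarrow> i \<noteq> j \<Longrightarrow> j \<noteq> k \<Longrightarrow> i \<noteq> k \<Longrightarrow>
      lam (0, 0, wedge3 i j k) = of_nat (card (s {i} \<inter> s {j} \<inter> s {k}))"
begin

lemma s_Int_distrib:
  assumes "dom \<sigma>" "dom \<mu>"
  shows "s (sym_diff \<sigma> \<mu>) \<inter> X = sym_diff (s \<sigma> \<inter> X) (s \<mu> \<inter> X)"
  unfolding s_sym_diff[OF assms] by auto

lemma s_inter_bit: "dom \<sigma> \<Longrightarrow> dom \<mu> \<Longrightarrow> of_nat (card (s \<sigma> \<inter> s \<mu>)) = (0 :: bit)"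
  using s_inter by (simp add: bit_of_nat_simps)

definition T :: "nat set \<Rightarrow> nat set \<Rightarrow> nat set \<Rightarrow> bit" where
  "T \<sigma> \<mu> \<rho> = of_nat (card (s \<sigma> \<inter> s \<mu> \<inter> s \<rho>))"

lemma T_sym_diff:
  assumes "dom \<sigma>" "dom \<tau>"
  shows "T (sym_diff \<sigma> \<tau>) \<mu> \<rho> = T \<sigma> \<mu> \<rho> + T \<tau> \<mu> \<rho>"
  unfolding T_def Int_assoc unfolding s_Int_distrib[OF assms]
  by (rule bit_card_sym_diff) (use s_finite in auto)

lemma T_commute: "T \<sigma> \<mu> \<rho> = T \<mu> \<sigma> \<rho>" "T \<sigma> \<mu> \<rho> = T \<sigma> \<rho> \<mu>"
  by (simp_all add: T_def Int_ac)

lemma t_eq_single: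
  assumes "i \<in> I" "j \<in> I" "k \<in> I"
  shows "t {i} {j} {k} = T {i} {j} {k}"
proof (cases "i \<noteq> j \<and> j \<noteq> k \<and> i \<noteq> k")
  case True
  then show ?thesis using lam_U[OF assms] by (simp add: t_def T_def)
next
  case False
  then have "t {i} {j} {k} = 0" by (auto simp: t_def)
  \<comment> \<open>With a repeated index the triple intersection is an intersection of two supports
    and hence even.\<close>
  moreover have "T {i} {j} {k} = 0"
    using False s_inter_bit[of "{i}" "{j}"] s_inter_bit[of "{i}" "{k}"] s_inter_bit[of "{j}" "{k}"] assms
    by (auto simp: T_def Int_ac)
  ultimately show ?thesis by simp
qed

text \<open>Both forms are symmetric and additive in the first argument, so
  \<open>additive_zero\<close> frees one argument after the other from being a singleton.\<close>

lemma t_eq: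
  assumes "dom \<sigma>" "dom \<mu>" "dom \<rho>"
  shows "t \<sigma> \<mu> \<rho> = T \<sigma> \<mu> \<rho>"
proof -
  have 1: "t \<sigma> {j} {k} + T \<sigma> {j} {k} = 0" if "dom \<sigma>" "j \<in> I" "k \<in> I" for \<sigma> j k
    by (rule additive_zero[of \<sigma> I "\<lambda>\<sigma>. t \<sigma> {j} {k} + T \<sigma> {j} {k}"])
      (use that in \<open>simp_all add: t_sym_diff T_sym_diff t_eq_single add_ac\<close>)
  have 2: "t \<sigma> \<mu> {k} + T \<sigma> \<mu> {k} = 0" if "dom \<sigma>" "dom \<mu>" "k \<in> I" for \<sigma> \<mu> k
    unfolding t_commute(1)[of \<sigma> \<mu>] T_commute(1)[of \<sigma> \<mu>]
  proof (rule additive_zero[of \<mu> I "\<lambda>\<mu>. t \<mu> \<sigma> {k} + T \<mu> \<sigma> {k}"])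
    show "t {j} \<sigma> {k} + T {j} \<sigma> {k} = 0" if "j \<in> I" for j
      using 1[of \<sigma> j k] that \<open>dom \<sigma>\<close> \<open>k \<in> I\<close> by (metis t_commute(1) T_commute(1))
  qed (use that in \<open>simp_all add: t_sym_diff T_sym_diff add_ac\<close>)
  have 3: "t \<rho> \<sigma> \<mu> + T \<rho> \<sigma> \<mu> = 0"
  proof (rule additive_zero[of \<rho> I "\<lambda>\<rho>. t \<rho> \<sigma> \<mu> + T \<rho> \<sigma> \<mu>"])
    show "t {k} \<sigma> \<mu> + T {k} \<sigma> \<mu> = 0" if "k \<in> I" for k
      using 2[of \<sigma> \<mu> k] that assms by (metis t_commute T_commute)
  qed (use assms in \<open>simp_all add: t_sym_diff T_sym_diff add_ac\<close>)
  have "t \<rho> \<sigma> \<mu> = T \<rho> \<sigma> \<mu>" using 3 by (simp add: bit_add_eq_0_iff)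
  then show ?thesis by (metis t_commute T_commute)
qed

text \<open>The commutator and the halved intersection fail to be additive by \<open>t\<close> and
  \<open>T\<close> respectively. These agree by \<open>t_eq\<close>, so the difference
  \<open>D\<close> is additive.\<close>

lemma f_commutator:
  assumes "dom \<sigma>" "dom \<mu>"
  shows "f \<sigma> \<mu> + f \<mu> \<sigma> = of_nat (card (s \<sigma> \<inter> s \<mu>) div 2)"
proof -
  define D where "D \<sigma> \<mu> = f \<sigma> \<mu> + f \<mu> \<sigma> + of_nat (card (s \<sigma> \<inter> s \<mu>) div 2)" for \<sigma> \<mu>
  have comm: "D \<sigma> \<mu> = D \<mu> \<sigma>" for \<sigma> \<mu> by (simp add: D_def add_ac Int_commute)
  have add: "D (sym_diff \<sigma> \<tau>) \<mu> = D \<sigma> \<mu> + D \<tau> \<mu>" if "dom \<sigma>" "dom \<tau>" "dom \<mu>" for \<sigma> \<tau> \<mu>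
  proof -
    have "of_nat (card (s (sym_diff \<sigma> \<tau>) \<inter> s \<mu>) div 2)
      = of_nat (card (s \<sigma> \<inter> s \<mu>) div 2) + of_nat (card (s \<tau> \<inter> s \<mu>) div 2)
        + (of_nat (card ((s \<sigma> \<inter> s \<mu>) \<inter> (s \<tau> \<inter> s \<mu>))) :: bit)"
      unfolding s_Int_distrib[OF that(1,2)]
      by (rule bit_half_card_sym_diff) (use s_finite s_inter that in auto)
    moreover have "(s \<sigma> \<inter> s \<mu>) \<inter> (s \<tau> \<inter> s \<mu>) = s \<sigma> \<inter> s \<tau> \<inter> s \<mu>" by auto
    moreover have "t \<sigma> \<tau> \<mu> = of_nat (card (s \<sigma> \<inter> s \<tau> \<inter> s \<mu>))"
      using t_eq[OF that] by (simp add: T_def)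
    ultimately show ?thesis using f_commutator_sym_diff[OF that] unfolding D_def
      by (simp add: add_ac)
  qed
  have single: "D {i} {j} = 0" if "i \<in> I" "j \<in> I" for i j
  proof -
    have lt: "D {i} {j} = 0" if "i < j" "i \<in> I" "j \<in> I" for i j
    proof -
      have "F_cocycle {i} {j} = 0" "F_cocycle {j} {i} = (0, wedge2 i j, 0)"
        using that(1) by (auto simp: F_cocycle_eq zero_prod_def wedge2_commute)
      then show ?thesis using lam_W[OF that(2,3,1)] by (simp add: D_def f_def)
    qed
    \<comment> \<open>On the diagonal the commutator is zero; a weight divisible by 4 has an even
      half, so the code side is zero as well.\<close>
    have "even (card (s {i}) div 2)" using s_weight[of "{i}"] that by (auto elim!: dvdE)
    then have "D {i} {i} = 0" by (simp add: D_def bit_of_nat_simps)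
    then show ?thesis using lt[of i j] lt[of j i] that comm by (metis linorder_neqE_nat)
  qed
  have 1: "D \<sigma> {j} = 0" if "dom \<sigma>" "j \<in> I" for \<sigma> j
    by (rule additive_zero[of \<sigma> I "\<lambda>\<sigma>. D \<sigma> {j}"]) (use that add single in auto)
  have "D \<mu> \<sigma> = 0"
    by (rule additive_zero[of \<mu> I "\<lambda>\<mu>. D \<mu> \<sigma>"]) (use assms add 1 comm in auto)
  then show ?thesis by (simp add: D_def bit_add_eq_0_iff Int_commute add.commute)
qed

text \<open>The last level: the square map and the quartered weight fail to be additive by the two
  sides of \<open>f_commutator\<close>.\<close>

lemma f_square:
  assumes "dom \<sigma>"
  shows "f \<sigma> \<sigma> = of_nat (card (s \<sigma>) div 4)"
proof -
  define D where "D \<sigma> = f \<sigma> \<sigma> + of_nat (card (s \<sigma>) div 4)" for \<sigma>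
  have "D \<sigma> = 0"
  proof (rule additive_zero[of \<sigma> I D])
    show "D (sym_diff \<sigma> \<mu>) = D \<sigma> + D \<mu>" if "finite \<sigma>" "finite \<mu>" "\<sigma> \<subseteq> I" "\<mu> \<subseteq> I" for \<sigma> \<mu>
    proof -
      have d: "dom \<sigma>" "dom \<mu>" using that by auto
      have "of_nat (card (s (sym_diff \<sigma> \<mu>)) div 4) = of_nat (card (s \<sigma>) div 4)
        + of_nat (card (s \<mu>) div 4) + (of_nat (card (s \<sigma> \<inter> s \<mu>) div 2) :: bit)"
        unfolding s_sym_diff[OF d]
        by (rule bit_quarter_card_sym_diff) (use s_finite s_weight s_inter d in auto)
      then show ?thesis using f_square_sym_diff[OF d] f_commutator[OF d]
        unfolding D_def Z2.bit_eq_iff even_add by argo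
    qed
    show "D {i} = 0" if "i \<in> I" for i
      using lam_V[OF that] by (simp add: D_def f_def F_cocycle_eq)
  qed (use assms in auto)
  then show ?thesis by (simp add: D_def bit_add_eq_0_iff)
qed

end

section \<open>Subspaces of codimension 1 and quotients\<close>

text \<open>Closure and index 2 are what \<open>index2_functional\<close> needs to produce a
  functional with kernel \<open>T\<close>; exponent 2 is what rules out a single index in
  \<open>center_codim1_wide\<close>.\<close>

lemma center_codim1D:
  assumes "center_codim1 L T" and fin: "finite (loop_center L)"
  shows "\<And>x. x \<in> loop_center L \<Longrightarrow> x \<otimes>\<^bsub>L\<^esub> x = \<one>\<^bsub>L\<^esub>"
    and "T \<subseteq> loop_center L" and "\<one>\<^bsub>L\<^esub> \<in> T"
    and "\<And>x y. x \<in> T \<Longrightarrow> y \<in> T \<Longrightarrow> x \<otimes>\<^bsub>L\<^esub> y \<in> T"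
    and "card (loop_center L) = 2 * card T"
proof -
  let ?Z = "center_space L"
  have sub: "VectorSpace.subspace class_ring T ?Z"
    and dim: "vectorspace.dim class_ring ?Z = vectorspace.dim class_ring (?Z\<lparr>carrier := T\<rparr>) + 1"
    using assms(1) by (auto simp: center_codim1_def)
  have vs: "vectorspace class_ring ?Z" using sub by (simp add: VectorSpace.subspace_def)
  have vsT: "vectorspace class_ring (?Z\<lparr>carrier := T\<rparr>)" by (rule vectorspace.subspace_is_vs[OF vs sub])
  have sm: "submodule class_ring T ?Z" using sub by (simp add: VectorSpace.subspace_def)
  show "x \<otimes>\<^bsub>L\<^esub> x = \<one>\<^bsub>L\<^esub>" if "x \<in> loop_center L" for x
    using bit_vs_add_self[OF vs, of x] that by (simp add: center_space_def)
  show TZ: "T \<subseteq> loop_center L"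
    using submodule.subset[OF sm] by (simp add: center_space_def)
  show "\<one>\<^bsub>L\<^esub> \<in> T" using submodule.zero_closed[OF sm] by (simp add: center_space_def)
  show "\<And>x y. x \<in> T \<Longrightarrow> y \<in> T \<Longrightarrow> x \<otimes>\<^bsub>L\<^esub> y \<in> T"
    using submodule.m_closed[OF sm] by (simp add: center_space_def)
  have "finite T" by (rule finite_subset[OF TZ fin])
  then show "card (loop_center L) = 2 * card T"
    using bit_vs_card[OF vs] bit_vs_card[OF vsT] fin dim by (simp add: center_space_def)
qed

text \<open>With fewer than two indices \<open>\<F>\<close> is commutative, and with one index it is cyclic of order 4, so
  that its center is not a vector space.\<close>

locale wide =
  fixes I :: "nat set"
  assumes finite_I: "finite I" and wide: "\<exists>i\<in>I. \<exists>j\<in>I. i \<noteq> j"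
begin

lemma center: "loop_center (F_on I) = {{}} \<times> central_on I"
  using wide loop_center_F_on by blast

lemma center_vectorspace: "vectorspace class_ring (center_space (F_on I))"
proof -
  let ?Z = "center_space (F_on I)"
  have Z: "carrier ?Z = {{}} \<times> central_on I" "\<zero>\<^bsub>?Z\<^esub> = ({}, 0)"
    "x \<oplus>\<^bsub>?Z\<^esub> y = x \<otimes>\<^bsub>F_on I\<^esub> y" "c \<odot>\<^bsub>?Z\<^esub> x = (if c = 0 then ({}, 0) else x)" for x y c
    by (simp_all add: center_space_def center)
  have memZ: "x \<in> carrier ?Z \<longleftrightarrow> (\<exists>a \<in> central_on I. x = ({}, a))" for x by (cases x) (simp add: Z(1))
  have add: "({}, a) \<oplus>\<^bsub>?Z\<^esub> ({}, b) = ({}, a + b)" for a b by (simp add: Z(3))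
  have "abelian_group ?Z"
  proof (rule abelian_groupI)
    fix x y assume "x \<in> carrier ?Z" "y \<in> carrier ?Z"
    note xy = this
    obtain a where a: "a \<in> central_on I" "x = ({}, a)" using xy(1)[unfolded memZ] by (rule bexE)
    obtain b where b: "b \<in> central_on I" "y = ({}, b)" using xy(2)[unfolded memZ] by (rule bexE)
    note ab = a(1) b(1) a(2) b(2)
    show "x \<oplus>\<^bsub>?Z\<^esub> y \<in> carrier ?Z" unfolding ab(3,4) add Z(1) using ab(1,2) by simp
    show "x \<oplus>\<^bsub>?Z\<^esub> y = y \<oplus>\<^bsub>?Z\<^esub> x" unfolding ab(3,4) add by (simp add: add.commute)
    show "\<zero>\<^bsub>?Z\<^esub> \<oplus>\<^bsub>?Z\<^esub> x = x" unfolding Z(2) ab(3,4) add by simp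
    have "x \<oplus>\<^bsub>?Z\<^esub> x = \<zero>\<^bsub>?Z\<^esub>" unfolding Z(2) ab(3,4) add by simp
    then show "\<exists>y\<in>carrier ?Z. y \<oplus>\<^bsub>?Z\<^esub> x = \<zero>\<^bsub>?Z\<^esub>" by (rule bexI[OF _ xy(1)])
    fix z assume z: "z \<in> carrier ?Z"
    obtain c where c: "z = ({}, c)" using z[unfolded memZ] by (rule bexE)
    show "x \<oplus>\<^bsub>?Z\<^esub> y \<oplus>\<^bsub>?Z\<^esub> z = x \<oplus>\<^bsub>?Z\<^esub> (y \<oplus>\<^bsub>?Z\<^esub> z)"
      unfolding ab(3,4) c add by (simp add: add.assoc)
  qed (simp add: Z)
  moreover have "module_axioms (class_ring :: bit ring) ?Z"
  proof
    show "\<And>a x. x \<in> carrier ?Z \<Longrightarrow> a \<odot>\<^bsub>?Z\<^esub> x \<in> carrier ?Z" by (auto simp: Z)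
    show "(a \<oplus>\<^bsub>class_ring\<^esub> b) \<odot>\<^bsub>?Z\<^esub> x = a \<odot>\<^bsub>?Z\<^esub> x \<oplus>\<^bsub>?Z\<^esub> b \<odot>\<^bsub>?Z\<^esub> x" if "x \<in> carrier ?Z" for a b x
      using that unfolding memZ by (cases a; cases b) (auto simp: Z)
    show "a \<odot>\<^bsub>?Z\<^esub> (x \<oplus>\<^bsub>?Z\<^esub> y) = a \<odot>\<^bsub>?Z\<^esub> x \<oplus>\<^bsub>?Z\<^esub> a \<odot>\<^bsub>?Z\<^esub> y"
      if "x \<in> carrier ?Z" "y \<in> carrier ?Z" for a x y
      using that unfolding memZ by (cases a) (auto simp: Z)
    show "(a \<otimes>\<^bsub>class_ring\<^esub> b) \<odot>\<^bsub>?Z\<^esub> x = a \<odot>\<^bsub>?Z\<^esub> (b \<odot>\<^bsub>?Z\<^esub> x)" for a b x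
      by (simp add: Z)
    show "\<one>\<^bsub>class_ring\<^esub> \<odot>\<^bsub>?Z\<^esub> x = x" for x by (simp add: Z)
  qed
  moreover have "cring (class_ring :: bit ring)"
    using class_field field.axioms(1) domain.axioms(1) by blast
  ultimately have "Module.module class_ring ?Z" by (intro Module.module.intro)
  then show ?thesis unfolding vectorspace_def using class_field by blast
qed

text \<open>Both orders are powers of 2, so index 2 forces the exponents to differ by 1.\<close>

lemma center_codim1I:
  assumes T: "T0 \<subseteq> central_on I" "0 \<in> T0" "\<And>a b. a \<in> T0 \<Longrightarrow> b \<in> T0 \<Longrightarrow> a + b \<in> T0"
    and card: "card (central_on I) = 2 * card T0"
  shows "center_codim1 (F_on I) ({{}} \<times> T0)"
proof -
  let ?Z = "center_space (F_on I)" and ?T = "{{}} \<times> T0"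
  have vs: "vectorspace class_ring ?Z" by (rule center_vectorspace)
  have finZ: "finite (carrier ?Z)"
    using finite_central_on[OF finite_I] by (simp add: center_space_def center)
  have "submodule class_ring ?T ?Z"
    by (rule submodule.intro) (use T vs in \<open>auto simp: center_space_def center vectorspace_def\<close>)
  then have sub: "VectorSpace.subspace class_ring ?T ?Z" using vs by (simp add: VectorSpace.subspace_def)
  have finT: "finite T0" using T(1) finite_central_on[OF finite_I] by (rule finite_subset)
  have "2 ^ vectorspace.dim class_ring ?Z = card (central_on I)"
    by (subst bit_vs_card[OF vs finZ, symmetric])
      (simp add: center_space_def center card_cartesian_product)
  moreover have "2 ^ vectorspace.dim class_ring (?Z\<lparr>carrier := ?T\<rparr>) = card T0"
    by (subst bit_vs_card[OF vectorspace.subspace_is_vs[OF vs sub], symmetric])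
      (use finT in \<open>simp_all add: card_cartesian_product\<close>)
  ultimately have "2 ^ vectorspace.dim class_ring ?Z
      = (2::nat) ^ (vectorspace.dim class_ring (?Z\<lparr>carrier := ?T\<rparr>) + 1)"
    using card by simp
  then have "vectorspace.dim class_ring ?Z = vectorspace.dim class_ring (?Z\<lparr>carrier := ?T\<rparr>) + 1"
    by (rule power_inject_exp[THEN iffD1, rotated]) simp
  then show ?thesis
    unfolding center_codim1_def using sub bit_vs_finite_fin_dim[OF vs finZ] by blast
qed

end

lemma wide_atLeastAtMost:
  assumes "2 \<le> n" shows "wide {1..n}"
proof -
  have mem: "1 \<in> {1..n}" "2 \<in> {1..n}" using assms by auto
  show ?thesis by (rule wide.intro, simp, rule bexI[OF _ mem(1)], rule bexI[OF _ mem(2)]) simp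
qed

lemma central_on_empty: "central_on {} = {0}"
proof -
  have "z = 0" if "z \<in> central_on {}" for z
    using that by (induction rule: central_on_induct) auto
  then show ?thesis by auto
qed

lemma finite_F_on:
  assumes "finite I" shows "finite (carrier (F_on I))"
  by (rule finite_subset[of _ "Pow I \<times> central_on I"])
    (use assms finite_central_on in \<open>auto simp: carrier_F_on\<close>)

text \<open>Without indices the center is trivial and has no subset of half its size. With one index
  the generator itself is central, but its square is not the identity, against exponent 2.\<close>

lemma center_codim1_wide:
  assumes "center_codim1 (F_on {1..n}) T"
  shows "wide {1..n}"
proof -
  have fin: "finite (loop_center (F_on {1..n}))"
    by (rule finite_subset[OF _ finite_F_on[of "{1..n}"]]) (auto simp: loop_center_def)
  note T = center_codim1D[OF assms fin]
  have "n \<noteq> 0"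
  proof
    assume "n = 0"
    then have "loop_center (F_on {1..n}) \<subseteq> {({}, 0)}"
      by (auto simp: loop_center_def carrier_F_on central_on_empty)
    then have "card (loop_center (F_on {1..n})) \<le> 1"
      by (metis card_mono card.empty card.insert finite.intros One_nat_def empty_iff)
    moreover have "card T > 0" using T(2,3) fin by (metis card_gt_0_iff empty_iff finite_subset)
    ultimately show False using T(5) by simp
  qed
  moreover have "n \<noteq> 1"
  proof
    assume n: "n = 1"
    let ?F = "F_on {1..n}" and ?x = "({1}, 0) :: nat set \<times> central"
    interpret loop ?F by (rule loop_F_on)
    have fst: "fst x \<in> {{}, {1}}" if "x \<in> carrier ?F" for x
      using that n by (auto simp: carrier_F_on)
    have x: "?x \<in> carrier ?F" using n by simp
    have tr: "trip \<sigma> \<mu> \<rho> = 0" if "\<sigma> \<in> {{}, {1}}" "\<mu> \<in> {{}, {1}}" "\<rho> \<in> {{}, {1}}" for \<sigma> \<mu> \<rho>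
      using that by (elim insertE emptyE) simp_all
    have assoc: "(x \<otimes>\<^bsub>?F\<^esub> y) \<otimes>\<^bsub>?F\<^esub> z = x \<otimes>\<^bsub>?F\<^esub> (y \<otimes>\<^bsub>?F\<^esub> z)"
      if "x \<in> carrier ?F" "y \<in> carrier ?F" "z \<in> carrier ?F" for x y z
    proof -
      have "({}, (0, 0, trip (fst x) (fst y) (fst z))) = \<one>\<^bsub>?F\<^esub>"
        by (simp only: tr[OF fst fst fst, OF that] one_F_on zero_prod_def)
      then show ?thesis
        using mult_assoc_F_on[OF that] l_one[OF m_closed[OF that(1) m_closed[OF that(2,3)]]] by argo
    qed
    have comm: "?x \<otimes>\<^bsub>?F\<^esub> y = y \<otimes>\<^bsub>?F\<^esub> ?x" if "y \<in> carrier ?F" for y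
      using fst[OF that] by (cases y) auto
    have "?x \<in> loop_center ?F"
      unfolding loop_center_def using x comm assoc by blast
    from T(1)[OF this] have "Poly_Mapping.single 1 1 = (0 :: nat \<Rightarrow>\<^sub>0 bit)"
      by (simp add: F_cocycle_eq zero_prod_def)
    then show False by (metis lookup_single_eq lookup_zero one_neq_zero)
  qed
  ultimately show ?thesis by (intro wide_atLeastAtMost) simp
qed

text \<open>Division is pulled back along the bijection. Membership in \<open>iso\<close> neither
  closes the carrier of \<open>G\<close> under products nor fixes the identity, so both are supplied
  separately.\<close>

lemma loop_iso:
  assumes "loop H" and h: "h \<in> iso G H" and one: "\<one>\<^bsub>G\<^esub> \<in> carrier G" "h \<one>\<^bsub>G\<^esub> = \<one>\<^bsub>H\<^esub>"
    and closed: "\<And>x y. x \<in> carrier G \<Longrightarrow> y \<in> carrier G \<Longrightarrow> x \<otimes>\<^bsub>G\<^esub> y \<in> carrier G"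
  shows "loop G"
proof -
  interpret H: loop H by fact
  have hom: "h (x \<otimes>\<^bsub>G\<^esub> y) = h x \<otimes>\<^bsub>H\<^esub> h y" if "x \<in> carrier G" "y \<in> carrier G" for x y
    using h that by (auto simp: iso_def hom_def)
  have hH: "h x \<in> carrier H" if "x \<in> carrier G" for x using h that by (auto simp: iso_def hom_def)
  have inj: "h x = h y \<longleftrightarrow> x = y" if "x \<in> carrier G" "y \<in> carrier G" for x y
    using h that by (auto simp: iso_def bij_betw_def inj_on_def)
  have surj: "\<exists>x \<in> carrier G. h x = u" if "u \<in> carrier H" for u
  proof -
    have "u \<in> h ` carrier G" using h that by (simp add: iso_iff)
    then show ?thesis by blast
  qed
  show ?thesis
  proof
    show "\<one>\<^bsub>G\<^esub> \<otimes>\<^bsub>G\<^esub> x = x" if "x \<in> carrier G" for x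
      using that one closed H.l_one hH hom inj by metis
    show "x \<otimes>\<^bsub>G\<^esub> \<one>\<^bsub>G\<^esub> = x" if "x \<in> carrier G" for x
      using that one closed H.r_one hH hom inj by metis
    fix a b assume ab: "a \<in> carrier G" "b \<in> carrier G"
    obtain u where u: "u \<in> carrier H" "h a \<otimes>\<^bsub>H\<^esub> u = h b"
      and u1: "\<And>u'. u' \<in> carrier H \<Longrightarrow> h a \<otimes>\<^bsub>H\<^esub> u' = h b \<Longrightarrow> u' = u"
      using H.l_div[OF hH hH, OF ab] by blast
    obtain x where x: "x \<in> carrier G" "h x = u" using surj u by blast
    show "\<exists>!x. x \<in> carrier G \<and> a \<otimes>\<^bsub>G\<^esub> x = b"
    proof (rule ex1I[of _ x])
      show "x \<in> carrier G \<and> a \<otimes>\<^bsub>G\<^esub> x = b" using ab x u closed hom inj by metis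
      show "y = x" if "y \<in> carrier G \<and> a \<otimes>\<^bsub>G\<^esub> y = b" for y
        using that ab x u1[of "h y"] hom[of a y] hH inj by metis
    qed
    obtain w where w: "w \<in> carrier H" "w \<otimes>\<^bsub>H\<^esub> h a = h b"
      and w1: "\<And>w'. w' \<in> carrier H \<Longrightarrow> w' \<otimes>\<^bsub>H\<^esub> h a = h b \<Longrightarrow> w' = w"
      using H.r_div[OF hH hH, OF ab] by blast
    obtain y where y: "y \<in> carrier G" "h y = w" using surj w by blast
    show "\<exists>!y. y \<in> carrier G \<and> y \<otimes>\<^bsub>G\<^esub> a = b"
    proof (rule ex1I[of _ y])
      show "y \<in> carrier G \<and> y \<otimes>\<^bsub>G\<^esub> a = b" using ab y w closed hom inj by metis
      show "x = y" if "x \<in> carrier G \<and> x \<otimes>\<^bsub>G\<^esub> a = b" for x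
        using that ab y w1[of "h x"] hom[of x a] hH inj by metis
    qed
  qed (use one closed in auto)
qed

text \<open>The homomorphism theorem without associativity. The properties of cosets that normality
  would give in a group enter as hypotheses: \<open>T\<close> has the fibres of \<open>g\<close> as
  cosets, and cosets multiply to cosets.\<close>

lemma loop_Mod:
  assumes "loop G" "loop H" and g: "g \<in> hom G H" "g ` carrier G = carrier H" "g \<one>\<^bsub>G\<^esub> = \<one>\<^bsub>H\<^esub>"
    and coset: "\<And>x y. x \<in> carrier G \<Longrightarrow> y \<in> carrier G \<Longrightarrow> T #>\<^bsub>G\<^esub> x = T #>\<^bsub>G\<^esub> y \<longleftrightarrow> g x = g y"
    and mult: "\<And>x y. x \<in> carrier G \<Longrightarrow> y \<in> carrier G \<Longrightarrow>
      (T #>\<^bsub>G\<^esub> x) <#>\<^bsub>G\<^esub> (T #>\<^bsub>G\<^esub> y) = T #>\<^bsub>G\<^esub> (x \<otimes>\<^bsub>G\<^esub> y)"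
    and one: "T #>\<^bsub>G\<^esub> \<one>\<^bsub>G\<^esub> = T"
  shows "loop (G Mod T)" "G Mod T \<cong> H"
    "group (G Mod T) \<longleftrightarrow> (\<forall>x\<in>carrier G. \<forall>y\<in>carrier G. \<forall>z\<in>carrier G.
       g ((x \<otimes>\<^bsub>G\<^esub> y) \<otimes>\<^bsub>G\<^esub> z) = g (x \<otimes>\<^bsub>G\<^esub> (y \<otimes>\<^bsub>G\<^esub> z)))"
proof -
  interpret G: loop G by fact
  let ?Q = "G Mod T"
  have Q: "carrier ?Q = (\<lambda>x. T #>\<^bsub>G\<^esub> x) ` carrier G" "X \<otimes>\<^bsub>?Q\<^esub> Y = X <#>\<^bsub>G\<^esub> Y" "\<one>\<^bsub>?Q\<^esub> = T" for X Y
    by (auto simp: FactGroup_def RCOSETS_def)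
  \<comment> \<open>The induced map on cosets through a chosen representative; \<open>coset\<close>
    makes the choice immaterial.\<close>
  define h where "h X = g (SOME x. x \<in> carrier G \<and> X = T #>\<^bsub>G\<^esub> x)" for X
  have h: "h (T #>\<^bsub>G\<^esub> x) = g x" if "x \<in> carrier G" for x
    unfolding h_def by (rule someI2[of _ x]) (use that coset in auto)
  have closed: "X \<otimes>\<^bsub>?Q\<^esub> Y \<in> carrier ?Q" if "X \<in> carrier ?Q" "Y \<in> carrier ?Q" for X Y
    using that unfolding Q by (auto simp: mult intro!: imageI G.m_closed)
  have T1: "T \<in> carrier ?Q" unfolding Q using one G.one_closed by (metis imageI)
  have iso: "h \<in> iso ?Q H"
    unfolding iso_iff
  proof (intro conjI)
    show "h \<in> hom ?Q H"
      using g(1) unfolding hom_def Q by (auto simp: h mult G.m_closed)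
    show "h ` carrier ?Q = carrier H"
      unfolding Q g(2)[symmetric] image_image by (rule image_cong) (auto simp: h)
    show "inj_on h (carrier ?Q)"
    proof (rule inj_onI)
      fix X Y assume "X \<in> carrier ?Q" "Y \<in> carrier ?Q" and eq: "h X = h Y"
      then obtain x y where "x \<in> carrier G" "y \<in> carrier G" "X = T #>\<^bsub>G\<^esub> x" "Y = T #>\<^bsub>G\<^esub> y"
        unfolding Q by blast
      then show "X = Y" using eq h coset by metis
    qed
  qed
  then show "?Q \<cong> H" by (rule is_isoI)
  show loop: "loop ?Q"
    by (rule loop_iso[OF assms(2) iso])
      (use T1 closed h[OF G.one_closed] one g(3) in \<open>simp_all add: Q(3)\<close>)
  have assoc: "(X \<otimes>\<^bsub>?Q\<^esub> Y) \<otimes>\<^bsub>?Q\<^esub> Z = X \<otimes>\<^bsub>?Q\<^esub> (Y \<otimes>\<^bsub>?Q\<^esub> Z) \<longleftrightarrow>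
      g ((x \<otimes>\<^bsub>G\<^esub> y) \<otimes>\<^bsub>G\<^esub> z) = g (x \<otimes>\<^bsub>G\<^esub> (y \<otimes>\<^bsub>G\<^esub> z))"
    if "x \<in> carrier G" "y \<in> carrier G" "z \<in> carrier G"
      and "X = T #>\<^bsub>G\<^esub> x" "Y = T #>\<^bsub>G\<^esub> y" "Z = T #>\<^bsub>G\<^esub> z" for x y z X Y Z
    using that by (simp add: Q mult G.m_closed coset)
  show "group ?Q \<longleftrightarrow> (\<forall>x\<in>carrier G. \<forall>y\<in>carrier G. \<forall>z\<in>carrier G.
       g ((x \<otimes>\<^bsub>G\<^esub> y) \<otimes>\<^bsub>G\<^esub> z) = g (x \<otimes>\<^bsub>G\<^esub> (y \<otimes>\<^bsub>G\<^esub> z)))" (is "_ \<longleftrightarrow> ?A")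
  proof
    assume "group ?Q"
    then interpret group ?Q .
    show ?A
    proof (intro ballI)
      fix x y z assume xyz: "x \<in> carrier G" "y \<in> carrier G" "z \<in> carrier G"
      then have "T #>\<^bsub>G\<^esub> x \<in> carrier ?Q" "T #>\<^bsub>G\<^esub> y \<in> carrier ?Q" "T #>\<^bsub>G\<^esub> z \<in> carrier ?Q"
        unfolding Q by auto
      from m_assoc[OF this] show "g ((x \<otimes>\<^bsub>G\<^esub> y) \<otimes>\<^bsub>G\<^esub> z) = g (x \<otimes>\<^bsub>G\<^esub> (y \<otimes>\<^bsub>G\<^esub> z))"
        using assoc[OF xyz refl refl refl] by simp
    qed
  next
    assume A: ?A
    interpret loop ?Q by (rule loop)
    show "group ?Q"
    proof (rule groupI)
      have ex: "\<exists>x\<in>carrier G. X = T #>\<^bsub>G\<^esub> x" if "X \<in> carrier ?Q" for X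
        using that unfolding Q by blast
      fix X Y Z assume "X \<in> carrier ?Q" "Y \<in> carrier ?Q" "Z \<in> carrier ?Q"
      then obtain x y z where xyz: "x \<in> carrier G" "y \<in> carrier G" "z \<in> carrier G"
        and XYZ: "X = T #>\<^bsub>G\<^esub> x" "Y = T #>\<^bsub>G\<^esub> y" "Z = T #>\<^bsub>G\<^esub> z" using ex by meson
      show "(X \<otimes>\<^bsub>?Q\<^esub> Y) \<otimes>\<^bsub>?Q\<^esub> Z = X \<otimes>\<^bsub>?Q\<^esub> (Y \<otimes>\<^bsub>?Q\<^esub> Z)"
        unfolding assoc[OF xyz XYZ] using A xyz by simp
    next
      show "\<exists>Y\<in>carrier ?Q. Y \<otimes>\<^bsub>?Q\<^esub> X = \<one>\<^bsub>?Q\<^esub>" if "X \<in> carrier ?Q" for X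
        using r_div[OF that one_closed] by (elim ex1E conjE) (rule bexI)
    qed (erule (1) m_closed, rule one_closed, erule l_one)
  qed
qed

section \<open>Code loops as quotients\<close>

lemma double_even_codeD:
  assumes "double_even_code m E"
  shows "E \<subseteq> carrier_vec m" "0\<^sub>v m \<in> E" "\<And>v w. v \<in> E \<Longrightarrow> w \<in> E \<Longrightarrow> v + w \<in> E"
    "\<And>v. v \<in> E \<Longrightarrow> 4 dvd card (supp v)"
    "\<And>v w. v \<in> E \<Longrightarrow> w \<in> E \<Longrightarrow> even (card (supp v \<inter> supp w))"
proof -
  have "submodule class_ring E (module_vec TYPE(bit) m)"
    using assms by (simp add: double_even_code_def VectorSpace.subspace_def)
  then interpret submodule "class_ring :: bit ring" E "module_vec TYPE(bit) m" .
  show "E \<subseteq> carrier_vec m" "0\<^sub>v m \<in> E" "\<And>v w. v \<in> E \<Longrightarrow> w \<in> E \<Longrightarrow> v + w \<in> E"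
    using subset zero_closed m_closed by (simp_all add: module_vec_simps)
qed (use assms in \<open>auto simp: double_even_code_def\<close>)

lemma bit_vec_add_self:
  assumes "v \<in> carrier_vec m" shows "v + v = (0\<^sub>v m :: bit vec)"
  using assms by (intro eq_vecI) auto

lemma bit_vec_add_add_self:
  assumes "v \<in> carrier_vec m" "w \<in> carrier_vec m"
  shows "v + (v + w) = (w :: bit vec)"
  using assms by (intro eq_vecI) (auto simp: add.assoc[symmetric])

lemma supp_add:
  assumes "v \<in> carrier_vec m" "w \<in> carrier_vec m"
  shows "supp (v + w) = sym_diff (supp v) (supp w)"
proof -
  have "(a + b = 1) \<longleftrightarrow> ((a = 1) \<noteq> (b = 1))" for a b :: bit by (cases a; cases b) auto
  then show ?thesis using assms by (auto simp: supp_def)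
qed

lemma finite_supp: "finite (supp v)"
  by (simp add: supp_def)

lemma loop_code_loop_of:
  assumes E: "double_even_code m E" and \<phi>: "code_factor_set m E \<phi>"
  shows "loop (code_loop_of m E \<phi>)"
proof -
  note D = double_even_codeD(1-3)[OF E]
  let ?L = "code_loop_of m E \<phi>"
  have car: "x \<in> carrier ?L \<longleftrightarrow> (fst x = 1 \<or> fst x = -1) \<and> snd x \<in> E" for x
    by (cases x) (auto simp: code_loop_of_def)
  have mult: "x \<otimes>\<^bsub>?L\<^esub> y = (fst x * fst y * \<phi> (snd x) (snd y), snd x + snd y)" for x y
    by (cases x; cases y) (simp add: code_loop_of_def)
  have one: "\<one>\<^bsub>?L\<^esub> = (1, 0\<^sub>v m)" by (simp add: code_loop_of_def)
  have \<phi>1: "\<phi> v w = 1 \<or> \<phi> v w = -1" if "v \<in> E" "w \<in> E" for v w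
    using \<phi> that unfolding code_factor_set_def by blast
  have \<phi>0: "\<phi> (0\<^sub>v m) v = 1" "\<phi> v (0\<^sub>v m) = 1" if "v \<in> E" for v
    using \<phi> that unfolding code_factor_set_def by blast+
  have vec: "v \<in> carrier_vec m" if "v \<in> E" for v using D(1) that by blast
  have comm: "v + w = w + v" if "v \<in> E" "w \<in> E" for v w
    using vec that by (metis comm_add_vec)
  have solve: "v + u = w \<longleftrightarrow> u = v + w" if "v \<in> E" "w \<in> E" "u \<in> E" for u v w
    using that vec bit_vec_add_add_self by metis
  show ?thesis
  proof
    show "x \<otimes>\<^bsub>?L\<^esub> y \<in> carrier ?L" if "x \<in> carrier ?L" "y \<in> carrier ?L" for x y
      using that \<phi>1[of "snd x" "snd y"] D(3) unfolding car mult by auto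
    show "\<one>\<^bsub>?L\<^esub> \<in> carrier ?L" using D(2) by (simp add: car one)
    show "\<one>\<^bsub>?L\<^esub> \<otimes>\<^bsub>?L\<^esub> x = x" if "x \<in> carrier ?L" for x
      using that vec by (simp add: car one mult \<phi>0)
    show "x \<otimes>\<^bsub>?L\<^esub> \<one>\<^bsub>?L\<^esub> = x" if "x \<in> carrier ?L" for x
      using that vec by (simp add: car one mult \<phi>0)
    fix a b assume "a \<in> carrier ?L" "b \<in> carrier ?L"
    then have ab: "snd a \<in> E" "snd b \<in> E" "fst a = 1 \<or> fst a = -1" "fst b = 1 \<or> fst b = -1"
      by (simp_all add: car)
    let ?u = "snd a + snd b"
    have u: "?u \<in> E" using D(3) ab by blast
    have p: "\<phi> (snd a) ?u = 1 \<or> \<phi> (snd a) ?u = -1" "\<phi> ?u (snd a) = 1 \<or> \<phi> ?u (snd a) = -1"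
      using \<phi>1 ab u by blast+
    show "\<exists>!x. x \<in> carrier ?L \<and> a \<otimes>\<^bsub>?L\<^esub> x = b"
    \<comment> \<open>All factors are signs and hence their own inverses, so the unknown sign is the
      product of all the known ones.\<close>
    proof (rule ex1I[of _ "(fst a * fst b * \<phi> (snd a) ?u, ?u)"])
      show "(fst a * fst b * \<phi> (snd a) ?u, ?u) \<in> carrier ?L \<and>
          a \<otimes>\<^bsub>?L\<^esub> (fst a * fst b * \<phi> (snd a) ?u, ?u) = b"
        using ab u p solve[OF ab(1,2) u] by (auto simp: car mult prod_eq_iff)
      fix x assume x: "x \<in> carrier ?L \<and> a \<otimes>\<^bsub>?L\<^esub> x = b"
      then have "snd x = ?u" using solve[OF ab(1,2), of "snd x"] by (auto simp: car mult)
      moreover have "fst a * fst x * \<phi> (snd a) (snd x) = fst b" using x by (auto simp: mult)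
      ultimately show "x = (fst a * fst b * \<phi> (snd a) ?u, ?u)"
        using ab p x by (auto simp: prod_eq_iff)
    qed
    show "\<exists>!y. y \<in> carrier ?L \<and> y \<otimes>\<^bsub>?L\<^esub> a = b"
    proof (rule ex1I[of _ "(fst a * fst b * \<phi> ?u (snd a), ?u)"])
      show "(fst a * fst b * \<phi> ?u (snd a), ?u) \<in> carrier ?L \<and>
          (fst a * fst b * \<phi> ?u (snd a), ?u) \<otimes>\<^bsub>?L\<^esub> a = b"
        using ab u p solve[OF ab(1,2) u] comm[OF u ab(1)] by (auto simp: car mult prod_eq_iff)
      fix x assume x: "x \<in> carrier ?L \<and> x \<otimes>\<^bsub>?L\<^esub> a = b"
      then have "snd x = ?u"
        using solve[OF ab(1,2), of "snd x"] comm[of "snd x", OF _ ab(1)] by (auto simp: car mult)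
      moreover have "fst x * fst a * \<phi> (snd x) (snd a) = fst b" using x by (auto simp: mult)
      ultimately show "x = (fst a * fst b * \<phi> ?u (snd a), ?u)"
        using ab p x by (auto simp: prod_eq_iff)
    qed
  qed
qed

text \<open>A code with coordinates: \<open>v\<close> is the linear isomorphism from the subsets of
  \<open>I\<close> onto \<open>E\<close>, and the functional has the invariants of this
  code.\<close>

locale param_code = matching_code I lam "\<lambda>\<sigma>. supp (v \<sigma>)"
  for I lam and v :: "nat set \<Rightarrow> bit vec" +
  fixes m :: nat and E :: "bit vec set"
  assumes finite_I: "finite I"
    and v_bij: "bij_betw v (Pow I) E"
    and E_code: "double_even_code m E"
    and v_add: "\<sigma> \<subseteq> I \<Longrightarrow> \<mu> \<subseteq> I \<Longrightarrow> v (sym_diff \<sigma> \<mu>) = v \<sigma> + v \<mu>"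
begin

lemma v_in_E: "\<sigma> \<subseteq> I \<Longrightarrow> v \<sigma> \<in> E"
  using v_bij by (auto simp: bij_betw_def)

lemma v_eq_iff: "\<sigma> \<subseteq> I \<Longrightarrow> \<mu> \<subseteq> I \<Longrightarrow> v \<sigma> = v \<mu> \<longleftrightarrow> \<sigma> = \<mu>"
  using v_bij by (auto simp: bij_betw_def inj_on_def)

lemma E_eq: "E = v ` Pow I"
  using v_bij by (simp add: bij_betw_def)

lemma v_empty: "v {} = 0\<^sub>v m"
  using v_add[of "{}" "{}"] bit_vec_add_self[of "v {}" m] v_in_E[of "{}"]
    double_even_codeD(1)[OF E_code] by auto

lemma domI: "\<sigma> \<subseteq> I \<Longrightarrow> dom \<sigma>"
  using finite_I finite_subset by blast

end

text \<open>\<open>\<phi>_eq\<close> says that \<phi> and the factor set \<open>f\<close> differ by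
  the coboundary of \<open>eta\<close>; this is exactly what makes \<open>g\<close> below a
  homomorphism. A functional taking the value 1 lets \<open>g\<close> reach both signs and gives its
  kernel index 2 in the central part.\<close>

locale code_hom = param_code +
  fixes \<phi> :: "bit vec \<Rightarrow> bit vec \<Rightarrow> int" and eta :: "nat set \<Rightarrow> bit"
  assumes \<phi>_eq: "\<sigma> \<subseteq> I \<Longrightarrow> \<mu> \<subseteq> I \<Longrightarrow>
      \<phi> (v \<sigma>) (v \<mu>) = bit_sign (eta \<sigma> + eta \<mu> + f \<sigma> \<mu> + eta (sym_diff \<sigma> \<mu>))"
    and eta_empty: "eta {} = 0"
    and lam_nonzero: "\<exists>z \<in> central_on I. lam z = 1"
    and factor_set: "code_factor_set m E \<phi>"
begin

definition g :: "nat set \<times> central \<Rightarrow> int \<times> bit vec" where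
  "g x = (bit_sign (eta (fst x) + lam (snd x)), v (fst x))"

abbreviation ker :: "central set" where "ker \<equiv> {z \<in> central_on I. lam z = 0}"

lemma carrier_iff: "x \<in> carrier (F_on I) \<longleftrightarrow> fst x \<subseteq> I \<and> snd x \<in> central_on I"
  using domI by (cases x) auto

lemma g_hom: "g \<in> hom (F_on I) (code_loop_of m E \<phi>)"
proof -
  have "g (x \<otimes>\<^bsub>F_on I\<^esub> y) = g x \<otimes>\<^bsub>code_loop_of m E \<phi>\<^esub> g y"
    if "x \<in> carrier (F_on I)" "y \<in> carrier (F_on I)" for x y
  proof -
    obtain \<sigma> z \<mu> w where xy: "x = (\<sigma>, z)" "y = (\<mu>, w)" by (cases x; cases y)
    have mem: "\<sigma> \<subseteq> I" "\<mu> \<subseteq> I" "z \<in> central_on I" "w \<in> central_on I"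
      using that by (simp_all add: xy)
    have l: "lam (F_cocycle \<sigma> \<mu> + z + w) = f \<sigma> \<mu> + lam z + lam w"
      using mem by (simp add: lam_add F_cocycle_in_central_on f_def)
    have "eta (sym_diff \<sigma> \<mu>) + (f \<sigma> \<mu> + lam z + lam w)
      = (eta \<sigma> + lam z) + (eta \<mu> + lam w) + (eta \<sigma> + eta \<mu> + f \<sigma> \<mu> + eta (sym_diff \<sigma> \<mu>))"
      unfolding Z2.bit_eq_iff even_add by argo
    then show ?thesis
      by (simp add: xy g_def code_loop_of_def v_add \<phi>_eq mem l bit_sign_add[symmetric])
  qed
  moreover have "g x \<in> carrier (code_loop_of m E \<phi>)" if "x \<in> carrier (F_on I)" for x
    using that bit_sign_cases v_in_E by (simp add: g_def code_loop_of_def carrier_iff)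
  ultimately show ?thesis by (auto simp: hom_def)
qed

lemma g_surj: "g ` carrier (F_on I) = carrier (code_loop_of m E \<phi>)"
proof
  show "g ` carrier (F_on I) \<subseteq> carrier (code_loop_of m E \<phi>)"
    using g_hom by (auto simp: hom_def)
  show "carrier (code_loop_of m E \<phi>) \<subseteq> g ` carrier (F_on I)"
  proof
    fix x assume "x \<in> carrier (code_loop_of m E \<phi>)"
    then obtain e \<sigma> where x: "x = (e, v \<sigma>)" "e = 1 \<or> e = -1" "\<sigma> \<subseteq> I"
      by (auto simp: code_loop_of_def E_eq)
    obtain b where b: "e = bit_sign b" using x(2) bit_sign_simps(1,2) by metis
    obtain z1 where z1: "z1 \<in> central_on I" "lam z1 = 1" using lam_nonzero by blast
    have "\<exists>z \<in> central_on I. lam z = b + eta \<sigma>"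
      using z1 lam_zero(1) central_on_zero by (cases "b + eta \<sigma>") metis+
    then obtain z where "z \<in> central_on I" "lam z = b + eta \<sigma>" by blast
    moreover have "eta \<sigma> + (b + eta \<sigma>) = b" by (simp add: add.commute add.left_commute)
    ultimately have "x = g (\<sigma>, z)" "(\<sigma>, z) \<in> carrier (F_on I)"
      using x b domI by (simp_all add: g_def)
    then show "x \<in> g ` carrier (F_on I)" by blast
  qed
qed

lemma g_one: "g \<one>\<^bsub>F_on I\<^esub> = \<one>\<^bsub>code_loop_of m E \<phi>\<^esub>"
  by (simp add: g_def eta_empty v_empty code_loop_of_def)

lemma kernel_g: "kernel (F_on I) (code_loop_of m E \<phi>) g = {{}} \<times> ker"
proof -
  have "g x = \<one>\<^bsub>code_loop_of m E \<phi>\<^esub> \<longleftrightarrow> fst x = {} \<and> lam (snd x) = 0" if "fst x \<subseteq> I" for x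
    using v_eq_iff[OF that, of "{}"] v_empty eta_empty
    by (auto simp: g_def code_loop_of_def)
  then show ?thesis by (auto simp: kernel_def carrier_iff)
qed

lemma ker_add: "a \<in> ker \<Longrightarrow> b \<in> ker \<Longrightarrow> a + b \<in> ker"
  by (auto simp: lam_add)

text \<open>Translation by an element on which \<open>lam\<close> is 1 exchanges the kernel and its
  complement.\<close>

lemma card_ker: "card (central_on I) = 2 * card ker"
proof -
  obtain z1 where z1: "z1 \<in> central_on I" "lam z1 = 1" using lam_nonzero by blast
  have fin: "finite (central_on I)" by (rule finite_central_on[OF finite_I])
  have "central_on I - ker = (+) z1 ` ker"
  proof
    show "(+) z1 ` ker \<subseteq> central_on I - ker"
      using z1 by (auto simp del: split_paired_All simp: lam_add)
    show "central_on I - ker \<subseteq> (+) z1 ` ker"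
    proof
      fix z assume z: "z \<in> central_on I - ker"
      then have "z1 + z \<in> ker" using z1 by (simp add: lam_add)
      moreover have "z = z1 + (z1 + z)" by simp
      ultimately show "z \<in> (+) z1 ` ker" by (rule rev_image_eqI)
    qed
  qed
  moreover have "inj_on ((+) z1) ker" by (rule inj_onI) simp
  ultimately have "card (central_on I - ker) = card ker" by (simp only: card_image)
  moreover have "card (central_on I - ker) = card (central_on I) - card ker"
    by (rule card_Diff_subset) (use fin in auto)
  moreover have "card ker \<le> card (central_on I)" by (rule card_mono[OF fin]) auto
  ultimately show ?thesis by linarith
qed

text \<open>The kernel element carrying \<open>z\<close> to \<open>w\<close> is
  \<open>w + z\<close>, by exponent 2. In this coordinate form cosets can be compared and multiplied
  without the theory of normal subgroups.\<close>

lemma mem_coset: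
  assumes "z \<in> central_on I"
  shows "(\<mu>, w) \<in> ({{}} \<times> ker) #>\<^bsub>F_on I\<^esub> (\<sigma>, z) \<longleftrightarrow> \<mu> = \<sigma> \<and> w \<in> central_on I \<and> lam w = lam z"
proof
  assume "(\<mu>, w) \<in> ({{}} \<times> ker) #>\<^bsub>F_on I\<^esub> (\<sigma>, z)"
  then show "\<mu> = \<sigma> \<and> w \<in> central_on I \<and> lam w = lam z"
    using assms by (auto simp: r_coset_def lam_add)
next
  assume w: "\<mu> = \<sigma> \<and> w \<in> central_on I \<and> lam w = lam z"
  have "(\<mu>, w) \<in> {({}, w + z) \<otimes>\<^bsub>F_on I\<^esub> (\<sigma>, z)}" using w by (simp add: add.assoc)
  moreover have "({}, w + z) \<in> {{}} \<times> ker" using w assms by (simp add: lam_add)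
  ultimately show "(\<mu>, w) \<in> ({{}} \<times> ker) #>\<^bsub>F_on I\<^esub> (\<sigma>, z)"
    unfolding r_coset_def by (intro UN_I)
qed

lemma coset_eq_iff:
  assumes "x \<in> carrier (F_on I)" "y \<in> carrier (F_on I)"
  shows "({{}} \<times> ker) #>\<^bsub>F_on I\<^esub> x = ({{}} \<times> ker) #>\<^bsub>F_on I\<^esub> y \<longleftrightarrow> g x = g y"
proof -
  obtain \<sigma> z \<mu> w where xy: "x = (\<sigma>, z)" "y = (\<mu>, w)" by (cases x; cases y)
  have mem: "\<sigma> \<subseteq> I" "\<mu> \<subseteq> I" "z \<in> central_on I" "w \<in> central_on I"
    using assms by (simp_all add: xy)
  have "g x = g y \<longleftrightarrow> \<sigma> = \<mu> \<and> lam z = lam w"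
    using v_eq_iff[OF mem(1,2)] by (auto simp: g_def xy)
  moreover have "({{}} \<times> ker) #>\<^bsub>F_on I\<^esub> x = ({{}} \<times> ker) #>\<^bsub>F_on I\<^esub> y \<longleftrightarrow> \<sigma> = \<mu> \<and> lam z = lam w"
    (is "?X = ?Y \<longleftrightarrow> _")
  proof
    assume "?X = ?Y"
    moreover have "(\<sigma>, z) \<in> ?X" unfolding xy mem_coset[OF mem(3)] using mem(3) by simp
    ultimately have "(\<sigma>, z) \<in> ?Y" by simp
    then show "\<sigma> = \<mu> \<and> lam z = lam w" unfolding xy mem_coset[OF mem(4)] by simp
  next
    assume eq: "\<sigma> = \<mu> \<and> lam z = lam w"
    have "p \<in> ?X \<longleftrightarrow> p \<in> ?Y" for p
      using eq by (cases p) (simp only: xy mem_coset[OF mem(3)] mem_coset[OF mem(4)])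
    then show "?X = ?Y" by blast
  qed
  ultimately show ?thesis by simp
qed

lemma coset_mult:
  assumes "x \<in> carrier (F_on I)" "y \<in> carrier (F_on I)"
  shows "(({{}} \<times> ker) #>\<^bsub>F_on I\<^esub> x) <#>\<^bsub>F_on I\<^esub> (({{}} \<times> ker) #>\<^bsub>F_on I\<^esub> y)
    = ({{}} \<times> ker) #>\<^bsub>F_on I\<^esub> (x \<otimes>\<^bsub>F_on I\<^esub> y)" (is "?X <#>\<^bsub>_\<^esub> ?Y = ?XY")
proof -
  obtain \<sigma> z \<mu> w where xy: "x = (\<sigma>, z)" "y = (\<mu>, w)" by (cases x; cases y)
  have mem: "\<sigma> \<subseteq> I" "\<mu> \<subseteq> I" "z \<in> central_on I" "w \<in> central_on I"
    using assms by (simp_all add: xy)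
  let ?F = "F_cocycle \<sigma> \<mu>"
  have F: "?F \<in> central_on I" using mem by (simp add: F_cocycle_in_central_on)
  have XY: "(\<nu>, c) \<in> ?XY \<longleftrightarrow> \<nu> = sym_diff \<sigma> \<mu> \<and> c \<in> central_on I \<and> lam c = lam (?F + z + w)" for \<nu> c
    unfolding xy mult_F_on by (rule mem_coset) (use F mem in simp)
  have X: "(\<nu>, c) \<in> ?X \<longleftrightarrow> \<nu> = \<sigma> \<and> c \<in> central_on I \<and> lam c = lam z" for \<nu> c
    unfolding xy by (rule mem_coset[OF mem(3)])
  have Y: "(\<nu>, c) \<in> ?Y \<longleftrightarrow> \<nu> = \<mu> \<and> c \<in> central_on I \<and> lam c = lam w" for \<nu> c
    unfolding xy by (rule mem_coset[OF mem(4)])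
  have "p \<in> ?X <#>\<^bsub>F_on I\<^esub> ?Y \<longleftrightarrow> p \<in> ?XY" for p
  proof
    assume "p \<in> ?X <#>\<^bsub>F_on I\<^esub> ?Y"
    then obtain a b where ab: "a \<in> ?X" "b \<in> ?Y" "p = a \<otimes>\<^bsub>F_on I\<^esub> b"
      unfolding set_mult_def by (elim UN_E singletonE)
    obtain \<alpha> c \<beta> d where cd: "a = (\<alpha>, c)" "b = (\<beta>, d)" by (cases a; cases b)
    show "p \<in> ?XY"
      using ab(1,2) F mem unfolding ab(3) cd X Y mult_F_on XY by (simp add: lam_add)
  next
    assume p: "p \<in> ?XY"
    obtain \<nu> c where \<nu>: "p = (\<nu>, c)" by (cases p)
    have c: "\<nu> = sym_diff \<sigma> \<mu>" "c \<in> central_on I" "lam c = lam (?F + z + w)"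
      using p unfolding \<nu> XY by auto
    \<comment> \<open>The first factor is the given representative; the whole central correction
      goes into the second, where \<open>lam\<close> takes the value required by
      \<open>Y\<close>.\<close>
    have "(\<sigma>, z) \<in> ?X" unfolding X using mem by simp
    moreover have "(\<mu>, ?F + z + c) \<in> ?Y" unfolding Y using mem F c by (simp add: lam_add ac_simps)
    moreover have "p = (\<sigma>, z) \<otimes>\<^bsub>F_on I\<^esub> (\<mu>, ?F + z + c)"
      by (simp only: \<nu> c(1) mult_F_on central_add_self_left)
    ultimately show "p \<in> ?X <#>\<^bsub>F_on I\<^esub> ?Y"
      unfolding set_mult_def by (intro UN_I) (simp_all only: singleton_iff)
  qed
  then show ?thesis by blast
qed

lemma coset_one: "({{}} \<times> ker) #>\<^bsub>F_on I\<^esub> \<one>\<^bsub>F_on I\<^esub> = {{}} \<times> ker"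
proof -
  have "p \<in> ({{}} \<times> ker) #>\<^bsub>F_on I\<^esub> \<one>\<^bsub>F_on I\<^esub> \<longleftrightarrow> p \<in> {{}} \<times> ker" for p
    by (cases p) (simp only: one_F_on mem_coset[OF central_on_zero] lam_zero mem_Times_iff
        fst_conv snd_conv mem_Collect_eq singleton_iff)
  then show ?thesis by blast
qed

lemma quotient:
  "loop (F_on I Mod ({{}} \<times> ker))" "F_on I Mod ({{}} \<times> ker) \<cong> code_loop_of m E \<phi>"
  "group (F_on I Mod ({{}} \<times> ker)) \<longleftrightarrow>
    (\<forall>x\<in>carrier (F_on I). \<forall>y\<in>carrier (F_on I). \<forall>z\<in>carrier (F_on I).
      g ((x \<otimes>\<^bsub>F_on I\<^esub> y) \<otimes>\<^bsub>F_on I\<^esub> z) = g (x \<otimes>\<^bsub>F_on I\<^esub> (y \<otimes>\<^bsub>F_on I\<^esub> z)))"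
proof -
  note * = loop_Mod[OF loop_F_on loop_code_loop_of[OF E_code factor_set] g_hom g_surj g_one
      _ _ coset_one]
  show "loop (F_on I Mod ({{}} \<times> ker))"
    by (rule *(1)) (erule (1) coset_eq_iff, erule (1) coset_mult)
  show "F_on I Mod ({{}} \<times> ker) \<cong> code_loop_of m E \<phi>"
    by (rule *(2)) (erule (1) coset_eq_iff, erule (1) coset_mult)
  show "group (F_on I Mod ({{}} \<times> ker)) \<longleftrightarrow>
    (\<forall>x\<in>carrier (F_on I). \<forall>y\<in>carrier (F_on I). \<forall>z\<in>carrier (F_on I).
      g ((x \<otimes>\<^bsub>F_on I\<^esub> y) \<otimes>\<^bsub>F_on I\<^esub> z) = g (x \<otimes>\<^bsub>F_on I\<^esub> (y \<otimes>\<^bsub>F_on I\<^esub> z)))"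
    by (rule *(3)) (erule (1) coset_eq_iff, erule (1) coset_mult)
qed

lemma code_loop_quotient: "code_loop (F_on I Mod ({{}} \<times> ker))"
  unfolding code_loop_def code_loop_of_rank_def
  using quotient(1,2) E_code factor_set by blast

text \<open>By \<open>mult_assoc_F_on\<close> two bracketings differ by a central element of the
  U-part, which \<open>g\<close> ignores exactly if \<open>lam\<close> vanishes on it. On triples of
  generators these elements run through the basis of the U-part.\<close>

lemma group_quotient_iff:
  "group (F_on I Mod ({{}} \<times> ker)) \<longleftrightarrow> associator_subloop (F_on I) \<subseteq> {{}} \<times> ker"
proof -
  interpret loop "F_on I" by (rule loop_F_on)
  let ?A = "\<forall>x\<in>carrier (F_on I). \<forall>y\<in>carrier (F_on I). \<forall>z\<in>carrier (F_on I).
    lam (0, 0, trip (fst x) (fst y) (fst z)) = 0"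
  have trip_mem: "(0, 0, trip (fst x) (fst y) (fst z)) \<in> central_on I"
    if "x \<in> carrier (F_on I)" "y \<in> carrier (F_on I)" "z \<in> carrier (F_on I)" for x y z
    using that by (simp add: carrier_iff trip_in_central_on)
  have g: "g (({}, c) \<otimes>\<^bsub>F_on I\<^esub> x) = g x \<longleftrightarrow> lam c = 0"
    if "c \<in> central_on I" "x \<in> carrier (F_on I)" for c x
  proof -
    have "eta (fst x) + (lam c + lam (snd x)) = eta (fst x) + lam (snd x) \<longleftrightarrow> lam c = 0"
      by (cases "lam c"; cases "eta (fst x)"; cases "lam (snd x)") simp_all
    then show ?thesis using that by (cases x) (simp add: g_def lam_add)
  qed
  have "group (F_on I Mod ({{}} \<times> ker)) \<longleftrightarrow> ?A"
    unfolding quotient(3)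
    by (intro ball_cong refl) (simp only: mult_assoc_F_on g trip_mem m_closed)
  also have "\<dots> \<longleftrightarrow> associator_subloop (F_on I) \<subseteq> {{}} \<times> ker"
  proof
    assume A: ?A
    have "lam (0, 0, snd (snd c)) = 0" if "c \<in> central_on I" for c
      using that
    proof (induction rule: central_on_induct)
      case (add a b)
      have "(0, 0, snd (snd a)) \<in> central_on I" "(0, 0, snd (snd b)) \<in> central_on I"
        using add(1,2) by (cases a; cases b; simp add: central_on_iff)+
      from lam_add[OF this] show ?case using add.IH by simp
    next
      case (U i j k)
      have "({i}, 0) \<in> carrier (F_on I)" "({j}, 0) \<in> carrier (F_on I)" "({k}, 0) \<in> carrier (F_on I)"
        using U by simp_all
      then have "lam (0, 0, trip (fst ({i}, 0 :: central)) (fst ({j}, 0 :: central)) (fst ({k}, 0 :: central))) = 0"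
        using A by blast
      then show ?case by simp
    qed simp_all
    from this[of "(0, 0, u)" for u] show "associator_subloop (F_on I) \<subseteq> {{}} \<times> ker"
      unfolding associator_subloop_F_on by auto
  next
    assume sub: "associator_subloop (F_on I) \<subseteq> {{}} \<times> ker"
    show ?A
    proof (intro ballI)
      fix x y z assume "x \<in> carrier (F_on I)" "y \<in> carrier (F_on I)" "z \<in> carrier (F_on I)"
      from trip_mem[OF this] have "({}, (0, 0, trip (fst x) (fst y) (fst z))) \<in> associator_subloop (F_on I)"
        unfolding associator_subloop_F_on by simp
      with sub show "lam (0, 0, trip (fst x) (fst y) (fst z)) = 0" by auto
    qed
  qed
  finally show ?thesis .
qed

end

section \<open>Existence of functionals, codes and coboundaries\<close>

lemma keys_add_bit: "Poly_Mapping.keys (f + g) = sym_diff (Poly_Mapping.keys f) (Poly_Mapping.keys (g :: 'a \<Rightarrow>\<^sub>0 bit))"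
proof -
  have "x + y \<noteq> 0 \<longleftrightarrow> (x \<noteq> 0) \<noteq> (y \<noteq> 0)" for x y :: bit by (cases x; cases y) auto
  then show ?thesis by (auto simp: in_keys_iff lookup_add)
qed

text \<open>The functional adds the prescribed values over the supports; supports add by symmetric
  difference, which makes it additive.\<close>

lemma functional_exists:
  fixes a :: "nat \<Rightarrow> bit" and b c :: "nat set \<Rightarrow> bit"
  obtains lam :: "central \<Rightarrow> bit" where "\<And>x y. lam (x + y) = lam x + lam y"
    "\<And>i. lam (Poly_Mapping.single i 1, 0, 0) = a i"
    "\<And>i j. i \<noteq> j \<Longrightarrow> lam (0, wedge2 i j, 0) = b {i, j}"
    "\<And>i j k. i \<noteq> j \<Longrightarrow> j \<noteq> k \<Longrightarrow> i \<noteq> k \<Longrightarrow> lam (0, 0, wedge3 i j k) = c {i, j, k}"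
proof -
  define lam :: "central \<Rightarrow> bit" where "lam z = sum a (Poly_Mapping.keys (fst z))
    + sum b (Poly_Mapping.keys (fst (snd z))) + sum c (Poly_Mapping.keys (snd (snd z)))" for z
  show thesis
  proof (rule that[of lam])
    show "lam (x + y) = lam x + lam y" for x y
      by (simp only: lam_def fst_add snd_add keys_add_bit sum_sym_diff finite_keys bit_add_self add_ac)
  qed (simp_all add: lam_def wedge2_def wedge3_def)
qed

text \<open>The vector \<open>v\<^sub>i\<close> will have \<open>m S\<close> coordinates of type \<open>S\<close> for each \<open>S\<close> containing \<open>i\<close>, so the
  sums below are the sizes of intersections. They are prescribed modulo 8, 4 and 2 by choosing
  \<open>m S\<close> by descending cardinality: the contribution of the larger sets is cancelled by adding
  it 7 or 3 further times.\<close>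

lemma multiplicities_exist:
  fixes a :: "nat \<Rightarrow> nat" and b c :: "nat set \<Rightarrow> nat"
  assumes "finite I"
  obtains m :: "nat set \<Rightarrow> nat" where "\<And>i. i \<in> I \<Longrightarrow> m {i} > 0"
    "\<And>i. i \<in> I \<Longrightarrow> \<exists>k. (\<Sum>S | S \<subseteq> I \<and> {i} \<subseteq> S. m S) = 4 * a i + 8 * k"
    "\<And>R. R \<subseteq> I \<Longrightarrow> card R = 2 \<Longrightarrow> \<exists>k. (\<Sum>S | S \<subseteq> I \<and> R \<subseteq> S. m S) = 2 * b R + 4 * k"
    "\<And>R. R \<subseteq> I \<Longrightarrow> card R = 3 \<Longrightarrow> (\<Sum>S | S \<subseteq> I \<and> R \<subseteq> S. m S) = c R"
proof -
  define m3 where "m3 R = (if card R = 3 then c R else 0)" for R :: "nat set"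
  define K3 where "K3 R = (\<Sum>S | S \<subseteq> I \<and> R \<subset> S. m3 S)" for R
  define m2 where "m2 R = (if card R = 2 then 2 * b R + 3 * K3 R else m3 R)" for R
  define K2 where "K2 R = (\<Sum>S | S \<subseteq> I \<and> R \<subset> S. m2 S)" for R
  \<comment> \<open>The summand 8 does not change the residue modulo 8 and makes
    \<open>m {i}\<close> positive; the resulting coordinate of type \<open>{i}\<close> separates the
    codewords in \<open>code_exists\<close>.\<close>
  define m where "m R = (if card R = 1 then 4 * a (the_elem R) + 8 + 7 * K2 R else m2 R)" for R
  have fin: "finite {S. S \<subseteq> I \<and> P S}" for P by (rule finite_subset[of _ "Pow I"]) (use assms in auto)
  have split: "(\<Sum>S | S \<subseteq> I \<and> R \<subseteq> S. m S) = m R + (\<Sum>S | S \<subseteq> I \<and> R \<subset> S. m S)" if "R \<subseteq> I" for R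
  proof -
    have "{S. S \<subseteq> I \<and> R \<subseteq> S} = insert R {S. S \<subseteq> I \<and> R \<subset> S}" using that by auto
    then show ?thesis using fin by (simp add: sum.insert)
  qed
  have card: "card R < card S" if "S \<subseteq> I" "R \<subset> S" for R S
    using that assms by (meson finite_subset psubset_card_mono)
  show thesis
  proof (rule that[of m])
    fix i assume i: "i \<in> I"
    show "m {i} > 0" by (simp add: m_def)
    have "(\<Sum>S | S \<subseteq> I \<and> {i} \<subset> S. m S) = K2 {i}"
      unfolding K2_def
    proof (rule sum.cong[OF refl])
      fix S assume "S \<in> {S. S \<subseteq> I \<and> {i} \<subset> S}"
      then have "card {i} < card S" using card by blast
      then show "m S = m2 S" by (simp add: m_def)
    qed
    then have "(\<Sum>S | S \<subseteq> I \<and> {i} \<subseteq> S. m S) = 4 * a i + 8 * (1 + K2 {i})"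
      using i by (subst split) (auto simp: m_def)
    then show "\<exists>k. (\<Sum>S | S \<subseteq> I \<and> {i} \<subseteq> S. m S) = 4 * a i + 8 * k" by blast
  next
    fix R assume R: "R \<subseteq> I" "card R = 2"
    have "(\<Sum>S | S \<subseteq> I \<and> R \<subset> S. m S) = K3 R"
      unfolding K3_def
    proof (rule sum.cong[OF refl])
      fix S assume "S \<in> {S. S \<subseteq> I \<and> R \<subset> S}"
      then have "card R < card S" using card by blast
      then show "m S = m3 S" using R by (simp add: m_def m2_def)
    qed
    then have "(\<Sum>S | S \<subseteq> I \<and> R \<subseteq> S. m S) = 2 * b R + 4 * K3 R"
      using R by (subst split) (auto simp: m_def m2_def)
    then show "\<exists>k. (\<Sum>S | S \<subseteq> I \<and> R \<subseteq> S. m S) = 2 * b R + 4 * k" by blast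
  next
    fix R assume R: "R \<subseteq> I" "card R = 3"
    have "(\<Sum>S | S \<subseteq> I \<and> R \<subset> S. m S) = 0"
    proof (rule sum.neutral, rule ballI)
      fix S assume "S \<in> {S. S \<subseteq> I \<and> R \<subset> S}"
      then have "card R < card S" using card by blast
      then show "m S = 0" using R by (simp add: m_def m2_def m3_def)
    qed
    then show "(\<Sum>S | S \<subseteq> I \<and> R \<subseteq> S. m S) = c R"
      using R by (subst split) (auto simp: m_def m2_def m3_def)
  qed
qed

text \<open>The parity of intersections is bilinear, so it can be checked on generators, where the
  diagonal is covered by the weights. Then weights follow by induction, since twice an even
  intersection is divisible by 4.\<close>

lemma double_even_generated:
  fixes s :: "nat set \<Rightarrow> nat set"
  assumes "finite I" and fin: "\<And>\<sigma>. finite (s \<sigma>)"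
    and add: "\<And>\<sigma> \<mu>. \<sigma> \<subseteq> I \<Longrightarrow> \<mu> \<subseteq> I \<Longrightarrow> s (sym_diff \<sigma> \<mu>) = sym_diff (s \<sigma>) (s \<mu>)"
    and weight: "\<And>i. i \<in> I \<Longrightarrow> 4 dvd card (s {i})"
    and inter: "\<And>i j. i \<in> I \<Longrightarrow> j \<in> I \<Longrightarrow> i \<noteq> j \<Longrightarrow> even (card (s {i} \<inter> s {j}))"
  shows "\<sigma> \<subseteq> I \<Longrightarrow> \<mu> \<subseteq> I \<Longrightarrow> even (card (s \<sigma> \<inter> s \<mu>))" "\<sigma> \<subseteq> I \<Longrightarrow> 4 dvd card (s \<sigma>)"
proof -
  define B where "B \<sigma> \<mu> = (of_nat (card (s \<sigma> \<inter> s \<mu>)) :: bit)" for \<sigma> \<mu>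
  have B: "B \<sigma> \<mu> = 0 \<longleftrightarrow> even (card (s \<sigma> \<inter> s \<mu>))" for \<sigma> \<mu>
    unfolding B_def by (cases "even (card (s \<sigma> \<inter> s \<mu>))") (simp_all add: bit_of_nat_simps)
  have comm: "B \<sigma> \<mu> = B \<mu> \<sigma>" for \<sigma> \<mu> by (simp add: B_def Int_commute)
  have B_add: "B (sym_diff \<sigma> \<tau>) \<mu> = B \<sigma> \<mu> + B \<tau> \<mu>" if "\<sigma> \<subseteq> I" "\<tau> \<subseteq> I" for \<sigma> \<tau> \<mu>
  proof -
    have "s (sym_diff \<sigma> \<tau>) \<inter> s \<mu> = sym_diff (s \<sigma> \<inter> s \<mu>) (s \<tau> \<inter> s \<mu>)"
      unfolding add[OF that] by auto
    then show ?thesis unfolding B_def by (simp only: bit_card_sym_diff fin finite_Int simp_thms)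
  qed
  have B_single: "B {i} {j} = 0" if "i \<in> I" "j \<in> I" for i j
  proof (cases "i = j")
    case True
    have "even (card (s {i}))" using weight[OF that(1)] by (auto elim!: dvdE)
    then show ?thesis using True by (simp add: B)
  qed (use that inter B in auto)
  have 1: "B \<sigma> {j} = 0" if "\<sigma> \<subseteq> I" "j \<in> I" for \<sigma> j
    by (rule additive_zero[of \<sigma> I "\<lambda>\<sigma>. B \<sigma> {j}"])
      (use that B_add B_single finite_subset[OF _ assms(1)] in auto)
  have 2: "B \<mu> \<sigma> = 0" if "\<sigma> \<subseteq> I" "\<mu> \<subseteq> I" for \<sigma> \<mu>
    by (rule additive_zero[of \<mu> I "\<lambda>\<mu>. B \<mu> \<sigma>"])
      (use that B_add 1 comm finite_subset[OF _ assms(1)] in auto)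
  then show even: "even (card (s \<sigma> \<inter> s \<mu>))" if "\<sigma> \<subseteq> I" "\<mu> \<subseteq> I" for \<sigma> \<mu>
    using that B by blast
  show "4 dvd card (s \<sigma>)" if "\<sigma> \<subseteq> I" for \<sigma>
    using finite_subset[OF that assms(1)] that
  proof induction
    case empty
    have "s {} = {}" using add[of "{}" "{}"] by auto
    then show ?case by simp
  next
    case (insert i \<sigma>)
    have eq: "sym_diff \<sigma> {i} = insert i \<sigma>" using insert.hyps by auto
    have mem: "\<sigma> \<subseteq> I" "{i} \<subseteq> I" using insert.prems by auto
    have "card (s (insert i \<sigma>)) + 2 * card (s \<sigma> \<inter> s {i}) = card (s \<sigma>) + card (s {i})"
      using card_sym_diff[OF fin fin, of \<sigma> "{i}"] add[OF mem] by (simp only: eq)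
    moreover have "4 dvd card (s \<sigma>) + card (s {i})"
      using insert.IH[OF mem(1)] weight mem(2) by (auto intro: dvd_add)
    moreover have "4 dvd 2 * card (s \<sigma> \<inter> s {i})"
      using even[OF mem] by (auto elim!: evenE)
    ultimately show ?case by (metis dvd_add_left_iff)
  qed
qed

text \<open>A symmetric cocycle vanishing on the diagonal defines an elementary abelian extension, which
  splits; the section is extended one basis vector at a time.\<close>

lemma coboundary:
  fixes th :: "'a set \<Rightarrow> 'a set \<Rightarrow> bit"
  assumes "finite I"
    and "\<And>\<sigma> \<mu>. \<sigma> \<subseteq> I \<Longrightarrow> \<mu> \<subseteq> I \<Longrightarrow> th \<sigma> \<mu> = th \<mu> \<sigma>"
    and "\<And>\<sigma>. \<sigma> \<subseteq> I \<Longrightarrow> th \<sigma> \<sigma> = 0"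
    and "\<And>\<sigma> \<mu> \<rho>. \<sigma> \<subseteq> I \<Longrightarrow> \<mu> \<subseteq> I \<Longrightarrow> \<rho> \<subseteq> I \<Longrightarrow>
      th (sym_diff \<sigma> \<mu>) \<rho> + th \<sigma> \<mu> = th \<sigma> (sym_diff \<mu> \<rho>) + th \<mu> \<rho>"
  shows "\<exists>eta. eta {} = 0 \<and>
    (\<forall>\<sigma> \<mu>. \<sigma> \<subseteq> I \<longrightarrow> \<mu> \<subseteq> I \<longrightarrow> th \<sigma> \<mu> = eta \<sigma> + eta \<mu> + eta (sym_diff \<sigma> \<mu>))"
  using assms
proof (induction I rule: finite_induct)
  case empty
  then show ?case by (intro exI[of _ "\<lambda>_. 0"]) auto
next
  case (insert i I)
  note sym = insert.prems(1) and sq = insert.prems(2) and cocycle = insert.prems(3)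
  obtain eta where eta0: "eta {} = 0"
    and eta: "\<And>\<sigma> \<mu>. \<sigma> \<subseteq> I \<Longrightarrow> \<mu> \<subseteq> I \<Longrightarrow> th \<sigma> \<mu> = eta \<sigma> + eta \<mu> + eta (sym_diff \<sigma> \<mu>)"
  proof -
    have "\<exists>eta. eta {} = 0 \<and>
      (\<forall>\<sigma> \<mu>. \<sigma> \<subseteq> I \<longrightarrow> \<mu> \<subseteq> I \<longrightarrow> th \<sigma> \<mu> = eta \<sigma> + eta \<mu> + eta (sym_diff \<sigma> \<mu>))"
      by (rule insert.IH) (use sym sq cocycle in \<open>auto simp: subset_insertI2\<close>)
    then show thesis using that by blast
  qed
  \<comment> \<open>The value at \<open>insert i \<alpha>\<close> is forced by the desired formula
    at the pair \<alpha>, \<open>{i}\<close> once \<open>{i}\<close> itself receives the value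
    0.\<close>
  define eta' where "eta' \<sigma> = (if i \<in> \<sigma> then eta (\<sigma> - {i}) + th (\<sigma> - {i}) {i} else eta \<sigma>)" for \<sigma>
  have e: "eta' \<alpha> = eta \<alpha>" "eta' (insert i \<alpha>) = eta \<alpha> + th \<alpha> {i}" if "\<alpha> \<subseteq> I" for \<alpha>
  proof -
    have "i \<notin> \<alpha>" using that insert.hyps by auto
    then show "eta' \<alpha> = eta \<alpha>" "eta' (insert i \<alpha>) = eta \<alpha> + th \<alpha> {i}" by (simp_all add: eta'_def)
  qed
  have th0: "th \<sigma> {} = 0" if "\<sigma> \<subseteq> insert i I" for \<sigma>
    using cocycle[of \<sigma> "{}" "{}"] sq[of "{}"] that by simp
  have mixed: "th \<alpha> (insert i \<beta>) = eta' \<alpha> + eta' (insert i \<beta>) + eta' (sym_diff \<alpha> (insert i \<beta>))"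
    if "\<alpha> \<subseteq> I" "\<beta> \<subseteq> I" for \<alpha> \<beta>
  proof -
    have ni: "i \<notin> \<alpha>" "i \<notin> \<beta>" using that insert.hyps by auto
    have d: "sym_diff \<beta> {i} = insert i \<beta>" "sym_diff \<alpha> (insert i \<beta>) = insert i (sym_diff \<alpha> \<beta>)"
      using ni by auto
    have sd: "sym_diff \<alpha> \<beta> \<subseteq> I" using that by auto
    have "th (sym_diff \<alpha> \<beta>) {i} + th \<alpha> \<beta> = th \<alpha> (insert i \<beta>) + th \<beta> {i}"
      using cocycle[of \<alpha> \<beta> "{i}"] that unfolding d by (simp add: subset_insertI2)
    then show ?thesis
      unfolding d e(1)[OF that(1)] e(2)[OF that(2)] e(2)[OF sd] eta[OF that]
      unfolding Z2.bit_eq_iff even_add by argo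
  qed
  have both: "th (insert i \<alpha>) (insert i \<beta>)
      = eta' (insert i \<alpha>) + eta' (insert i \<beta>) + eta' (sym_diff (insert i \<alpha>) (insert i \<beta>))"
    if "\<alpha> \<subseteq> I" "\<beta> \<subseteq> I" for \<alpha> \<beta>
  proof -
    have ni: "i \<notin> \<alpha>" "i \<notin> \<beta>" using that insert.hyps by auto
    have d: "sym_diff (insert i \<alpha>) {i} = \<alpha>" "sym_diff {i} \<beta> = insert i \<beta>"
      "sym_diff \<alpha> {i} = insert i \<alpha>" "sym_diff {i} {i} = {}"
      "sym_diff (insert i \<alpha>) (insert i \<beta>) = sym_diff \<alpha> \<beta>"
      using ni by auto
    have sd: "sym_diff \<alpha> \<beta> \<subseteq> I" using that by auto
    have m: "insert i \<alpha> \<subseteq> insert i I" "\<alpha> \<subseteq> insert i I" "\<beta> \<subseteq> insert i I" "{i} \<subseteq> insert i I"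
      using that by auto
    have 1: "th \<alpha> \<beta> + th (insert i \<alpha>) {i} = th (insert i \<alpha>) (insert i \<beta>) + th {i} \<beta>"
      using cocycle[OF m(1,4,3)] unfolding d .
    \<comment> \<open>The cocycle identity for \<alpha>, \<open>{i}\<close>, \<open>{i}\<close>; the
      vanishing of \<open>th\<close> on the diagonal removes the square of
      \<open>{i}\<close>.\<close>
    have 2: "th (insert i \<alpha>) {i} + th \<alpha> {i} = 0"
      using cocycle[OF m(2,4,4)] unfolding d by (simp add: th0[OF m(2)] sq[OF m(4)])
    have 3: "th {i} \<beta> = th \<beta> {i}" by (rule sym[OF m(4,3)])
    show ?thesis
      using 1 2 unfolding d e(2)[OF that(1)] e(2)[OF that(2)] e(1)[OF sd] eta[OF that] 3 bit_add_eq_0_iff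
      unfolding Z2.bit_eq_iff even_add by argo
  qed
  have "th \<sigma> \<mu> = eta' \<sigma> + eta' \<mu> + eta' (sym_diff \<sigma> \<mu>)"
    if \<sigma>: "\<sigma> \<subseteq> insert i I" and \<mu>: "\<mu> \<subseteq> insert i I" for \<sigma> \<mu>
  proof -
    have cases: "\<sigma> \<subseteq> I \<or> (\<exists>\<alpha>. \<alpha> \<subseteq> I \<and> \<sigma> = insert i \<alpha>)" if "\<sigma> \<subseteq> insert i I" for \<sigma>
      using that by (metis subset_insert subset_insert_iff insert_Diff)
    have comm: "sym_diff \<sigma> \<mu> = sym_diff \<mu> \<sigma>" by auto
    consider "\<sigma> \<subseteq> I" "\<mu> \<subseteq> I" | \<beta> where "\<sigma> \<subseteq> I" "\<beta> \<subseteq> I" "\<mu> = insert i \<beta>"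
      | \<alpha> where "\<alpha> \<subseteq> I" "\<sigma> = insert i \<alpha>" "\<mu> \<subseteq> I"
      | \<alpha> \<beta> where "\<alpha> \<subseteq> I" "\<beta> \<subseteq> I" "\<sigma> = insert i \<alpha>" "\<mu> = insert i \<beta>"
      using cases[OF \<sigma>] cases[OF \<mu>] by metis
    then show ?thesis
    proof cases
      case 1
      moreover have "sym_diff \<sigma> \<mu> \<subseteq> I" using 1 by auto
      ultimately show ?thesis by (simp only: e(1) eta)
    next
      case 2
      then show ?thesis using mixed by simp
    next
      case 3
      then show ?thesis using mixed[OF 3(3,1)] sym[OF \<sigma> \<mu>] unfolding comm by (simp add: add_ac)
    next
      case 4
      then show ?thesis using both by simp
    qed
  qed
  moreover have "eta' {} = 0" using e(1)[of "{}"] eta0 by simp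
  ultimately show ?case by blast
qed

lemma code_exists:
  assumes lam: "central_functional I lam" and "finite I"
  obtains v m where "param_code I lam v m (v ` Pow I)"
proof -
  interpret central_functional I lam by fact
  define a where "a i = (if lam (Poly_Mapping.single i 1, 0, 0) = 1 then 1 else 0 :: nat)" for i
  define b where "b p = (if lam (0, Poly_Mapping.single p 1, 0) = 1 then 1 else 0 :: nat)" for p
  define c where "c t = (if lam (0, 0, Poly_Mapping.single t 1) = 1 then 1 else 0 :: nat)" for t
  obtain mu :: "nat set \<Rightarrow> nat" where mu0: "\<And>i. i \<in> I \<Longrightarrow> mu {i} > 0"
    and mu1: "\<And>i. i \<in> I \<Longrightarrow> \<exists>k. (\<Sum>S | S \<subseteq> I \<and> {i} \<subseteq> S. mu S) = 4 * a i + 8 * k"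
    and mu2: "\<And>R. R \<subseteq> I \<Longrightarrow> card R = 2 \<Longrightarrow> \<exists>k. (\<Sum>S | S \<subseteq> I \<and> R \<subseteq> S. mu S) = 2 * b R + 4 * k"
    and mu3: "\<And>R. R \<subseteq> I \<Longrightarrow> card R = 3 \<Longrightarrow> (\<Sum>S | S \<subseteq> I \<and> R \<subseteq> S. mu S) = c R"
    by (rule multiplicities_exist[OF \<open>finite I\<close>, of a b c]) (rule that)
  define X where "X = Sigma (Pow I) (\<lambda>S. {..<mu S})"
  have finX: "finite X" using \<open>finite I\<close> by (simp add: X_def)
  obtain e where e: "bij_betw e X {0..<card X}" using ex_bij_betw_finite_nat[OF finX] by blast
  \<comment> \<open>A coordinate of type \<open>S\<close> is 1 in the vector of each index in
    \<open>S\<close>; in the sum of the vectors over \<sigma> it is 1 when \<sigma> meets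
    \<open>S\<close> in an odd number of indices.\<close>
  define s where "s \<sigma> = {x \<in> X. odd (card (\<sigma> \<inter> fst x))}" for \<sigma>
  have s_X: "s \<sigma> \<subseteq> X" for \<sigma> by (auto simp: s_def)
  have inj: "inj_on e X" and e_img: "e ` X = {0..<card X}" using e by (auto simp: bij_betw_def)
  define v where "v \<sigma> = vec (card X) (\<lambda>k. if k \<in> e ` s \<sigma> then 1 else 0 :: bit)" for \<sigma>
  have supp_v: "supp (v \<sigma>) = e ` s \<sigma>" for \<sigma>
  proof -
    have "supp (vec N (\<lambda>k. if k \<in> A then 1 else 0)) = A" if "A \<subseteq> {0..<N}" for A N
      using that by (auto simp: supp_def split: if_splits)
    moreover have "e ` s \<sigma> \<subseteq> {0..<card X}" using image_mono[OF s_X, of e] e_img by blast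
    ultimately show ?thesis unfolding v_def by blast
  qed
  have e_Int: "e ` A \<inter> e ` B = e ` (A \<inter> B)" if "A \<subseteq> X" "B \<subseteq> X" for A B
    using inj_on_image_Int[OF inj that] by simp
  have e_card: "card (e ` A) = card A" if "A \<subseteq> X" for A
    using card_image inj_on_subset[OF inj that] by blast
  have s_add: "s (sym_diff \<sigma> \<mu>) = sym_diff (s \<sigma>) (s \<mu>)" if "\<sigma> \<subseteq> I" "\<mu> \<subseteq> I" for \<sigma> \<mu>
  proof -
    have "odd (card (sym_diff \<sigma> \<mu> \<inter> S)) \<longleftrightarrow> odd (card (\<sigma> \<inter> S)) \<noteq> odd (card (\<mu> \<inter> S))" for S
    proof -
      have "finite (\<sigma> \<inter> S)" "finite (\<mu> \<inter> S)" using that \<open>finite I\<close> finite_subset by blast+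
      from card_sym_diff[OF this] have "even (card (sym_diff (\<sigma> \<inter> S) (\<mu> \<inter> S)) + 2 * card ((\<sigma> \<inter> S) \<inter> (\<mu> \<inter> S)))
        = even (card (\<sigma> \<inter> S) + card (\<mu> \<inter> S))" by (simp only:)
      moreover have "sym_diff \<sigma> \<mu> \<inter> S = sym_diff (\<sigma> \<inter> S) (\<mu> \<inter> S)" by auto
      ultimately show ?thesis by simp
    qed
    then show ?thesis by (auto simp: s_def)
  qed
  have v_carrier: "v \<sigma> \<in> carrier_vec (card X)" for \<sigma> by (simp add: v_def)
  have v_add: "v (sym_diff \<sigma> \<mu>) = v \<sigma> + v \<mu>" if "\<sigma> \<subseteq> I" "\<mu> \<subseteq> I" for \<sigma> \<mu>
  proof (rule eq_vecI)
    fix k assume "k < dim_vec (v \<sigma> + v \<mu>)"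
    then have k: "k < card X" by (simp add: v_def)
    then obtain x where x: "x \<in> X" "k = e x" using e_img by (metis atLeastLessThan_iff imageE le0)
    have mem: "k \<in> e ` s \<tau> \<longleftrightarrow> x \<in> s \<tau>" for \<tau>
      unfolding x(2) using inj_on_image_mem_iff[OF inj x(1) s_X] .
    show "v (sym_diff \<sigma> \<mu>) $ k = (v \<sigma> + v \<mu>) $ k"
      using k mem[of "sym_diff \<sigma> \<mu>"] unfolding v_def s_add[OF that] by (simp add: mem)
  qed (simp add: v_def)
  \<comment> \<open>The indices may coincide, so that the counts for pairs and for single indices
    are special cases of the one for triples.\<close>
  have inter: "s {i} \<inter> s {j} \<inter> s {k} = Sigma {S. S \<subseteq> I \<and> {i, j, k} \<subseteq> S} (\<lambda>S. {..<mu S})" for i j k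
  proof -
    have "odd (card ({l} \<inter> S)) \<longleftrightarrow> l \<in> S" for l :: nat and S by (cases "l \<in> S") auto
    then show ?thesis by (auto simp: s_def X_def)
  qed
  have card3: "card (supp (v {i}) \<inter> supp (v {j}) \<inter> supp (v {k})) = (\<Sum>S | S \<subseteq> I \<and> {i, j, k} \<subseteq> S. mu S)" for i j k
  proof -
    have "supp (v {i}) \<inter> supp (v {j}) \<inter> supp (v {k}) = e ` (s {i} \<inter> s {j} \<inter> s {k})"
      unfolding supp_v using s_X by (simp add: e_Int le_infI1)
    then have "card (supp (v {i}) \<inter> supp (v {j}) \<inter> supp (v {k})) = card (s {i} \<inter> s {j} \<inter> s {k})"
      using e_card[of "s {i} \<inter> s {j} \<inter> s {k}"] s_X by (simp add: le_infI1)
    also have "\<dots> = (\<Sum>S | S \<subseteq> I \<and> {i, j, k} \<subseteq> S. mu S)"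
      unfolding inter by (subst card_SigmaI) (use \<open>finite I\<close> in auto)
    finally show ?thesis .
  qed
  have card2: "card (supp (v {i}) \<inter> supp (v {j})) = (\<Sum>S | S \<subseteq> I \<and> {i, j} \<subseteq> S. mu S)" for i j
    using card3[of i j j] by (simp add: Int_assoc)
  have card1: "card (supp (v {i})) = (\<Sum>S | S \<subseteq> I \<and> {i} \<subseteq> S. mu S)" for i
    using card2[of i i] by simp
  have c1: "\<exists>k. card (supp (v {i})) = 4 * a i + 8 * k" if "i \<in> I" for i
    using mu1[OF that] by (simp only: card1)
  have c2: "\<exists>k. card (supp (v {i}) \<inter> supp (v {j})) = 2 * b {i, j} + 4 * k"
    if "i \<in> I" "j \<in> I" "i \<noteq> j" for i j
    using mu2[of "{i, j}"] that by (simp only: card2) simp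
  have c3: "card (supp (v {i}) \<inter> supp (v {j}) \<inter> supp (v {k})) = c {i, j, k}"
    if "i \<in> I" "j \<in> I" "k \<in> I" "i \<noteq> j" "j \<noteq> k" "i \<noteq> k" for i j k
    using mu3[of "{i, j, k}"] that by (simp only: card3) simp
  have supp_add: "supp (v (sym_diff \<sigma> \<mu>)) = sym_diff (supp (v \<sigma>)) (supp (v \<mu>))"
    if "\<sigma> \<subseteq> I" "\<mu> \<subseteq> I" for \<sigma> \<mu>
    unfolding v_add[OF that] by (rule supp_add[OF v_carrier v_carrier])
  have w: "4 dvd card (supp (v {i}))" if "i \<in> I" for i using c1[OF that] by auto
  have w2: "even (card (supp (v {i}) \<inter> supp (v {j})))" if "i \<in> I" "j \<in> I" "i \<noteq> j" for i j
    using c2[OF that] by auto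
  note gen = double_even_generated[of I "\<lambda>\<sigma>. supp (v \<sigma>)", OF \<open>finite I\<close> finite_supp supp_add w w2]
  have v_empty: "v {} = 0\<^sub>v (card X)" by (intro eq_vecI) (auto simp: v_def s_def)
  have v_inj: "inj_on v (Pow I)"
  proof (rule inj_onI)
    \<comment> \<open>The coordinate of type \<open>{i}\<close> reads off membership of
      \<open>i\<close> in \<sigma>, so a codeword determines its set of indices.\<close>
    have in_v: "i \<in> \<sigma> \<longleftrightarrow> e ({i}, 0) \<in> supp (v \<sigma>)" if "i \<in> I" for i \<sigma>
    proof -
      have "({i}, 0) \<in> X" using that mu0[OF that] by (simp add: X_def)
      then have "e ({i}, 0) \<in> supp (v \<sigma>) \<longleftrightarrow> ({i}, 0) \<in> s \<sigma>"
        unfolding supp_v using inj_on_image_mem_iff[OF inj _ s_X] by blast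
      also have "\<dots> \<longleftrightarrow> i \<in> \<sigma>" using \<open>({i}, 0) \<in> X\<close> by (cases "i \<in> \<sigma>") (simp_all add: s_def)
      finally show ?thesis by simp
    qed
    fix \<sigma> \<mu> assume "\<sigma> \<in> Pow I" "\<mu> \<in> Pow I" "v \<sigma> = v \<mu>"
    then show "\<sigma> = \<mu>" using in_v by (metis Pow_iff subsetD subsetI subset_antisym)
  qed
  have smult: "x \<cdot>\<^sub>v v \<sigma> = (if x = 0 then v {} else v \<sigma>)" for x :: bit and \<sigma>
    unfolding v_empty by (cases x) (auto simp: v_def)
  have "submodule class_ring (v ` Pow I) (module_vec TYPE(bit) (card X))"
  proof (rule submodule.intro)
    show "Module.module class_ring (module_vec TYPE(bit) (card X))" by (rule vec_module)
    show "v ` Pow I \<subseteq> carrier (module_vec TYPE(bit) (card X))"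
      using v_carrier by (auto simp: module_vec_simps)
    show "\<zero>\<^bsub>module_vec TYPE(bit) (card X)\<^esub> \<in> v ` Pow I"
      unfolding module_vec_simps v_empty[symmetric] by blast
    show "x \<oplus>\<^bsub>module_vec TYPE(bit) (card X)\<^esub> y \<in> v ` Pow I"
      if xy: "x \<in> v ` Pow I" "y \<in> v ` Pow I" for x y
    proof -
      obtain \<sigma> \<mu> where "\<sigma> \<subseteq> I" "\<mu> \<subseteq> I" "x = v \<sigma>" "y = v \<mu>" using xy by auto
      then have "x + y = v (sym_diff \<sigma> \<mu>)" "sym_diff \<sigma> \<mu> \<in> Pow I" by (auto simp: v_add)
      then show ?thesis unfolding module_vec_simps by blast
    qed
    show "r \<odot>\<^bsub>module_vec TYPE(bit) (card X)\<^esub> x \<in> v ` Pow I" if "x \<in> v ` Pow I" for r x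
      using that unfolding module_vec_simps by (auto simp: smult)
  qed
  then have "VectorSpace.subspace class_ring (v ` Pow I) (module_vec TYPE(bit) (card X))"
    using vec_vs by (simp add: VectorSpace.subspace_def)
  then have code: "double_even_code (card X) (v ` Pow I)"
    using gen by (auto simp: double_even_code_def)
  have ab: "of_nat (a i) = lam (Poly_Mapping.single i 1, 0, 0)"
    "of_nat (b p) = lam (0, Poly_Mapping.single p 1, 0)"
    "of_nat (c t) = lam (0, 0, Poly_Mapping.single t 1)" for i p t
    by (auto simp: a_def b_def c_def)
  have "param_code I lam v (card X) (v ` Pow I)"
  proof
    show "lam (Poly_Mapping.single i 1, 0, 0) = of_nat (card (supp (v {i})) div 4)" if i: "i \<in> I" for i
    proof -
      obtain k where "card (supp (v {i})) = 4 * a i + 8 * k" using c1[OF i] by blast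
      then have "card (supp (v {i})) div 4 = a i + 2 * k" by simp
      then show ?thesis by (simp only: of_nat_add of_nat_mult ab) simp
    qed
    show "lam (0, wedge2 i j, 0) = of_nat (card (supp (v {i}) \<inter> supp (v {j})) div 2)"
      if ij: "i \<in> I" "j \<in> I" "i < j" for i j
    proof -
      obtain k where "card (supp (v {i}) \<inter> supp (v {j})) = 2 * b {i, j} + 4 * k"
        using c2[OF ij(1,2)] ij(3) by blast
      then have "card (supp (v {i}) \<inter> supp (v {j})) div 2 = b {i, j} + 2 * k" by simp
      then show ?thesis using ij(3) by (simp only: of_nat_add of_nat_mult ab) (simp add: wedge2_def)
    qed
    show "lam (0, 0, wedge3 i j k) = of_nat (card (supp (v {i}) \<inter> supp (v {j}) \<inter> supp (v {k})))"
      if "i \<in> I" "j \<in> I" "k \<in> I" "i \<noteq> j" "j \<noteq> k" "i \<noteq> k" for i j k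
      unfolding c3[OF that] ab using that by (simp add: wedge3_def)
    show "bij_betw v (Pow I) (v ` Pow I)" using v_inj by (rule inj_on_imp_bij_betw)
  qed (use gen supp_add finite_supp \<open>finite I\<close> code v_add in auto)
  then show thesis by (rule that)
qed

section \<open>The correspondence\<close>

text \<open>Since the invariants agree, the conditions on \<phi> become conditions on its exponent
  \<open>p\<close> that mention only \<open>f\<close> and \<open>t\<close>. From right to left this
  makes \<open>f\<close> itself a factor set of the code; from left to right it gives every factor
  set the invariants of \<open>f\<close>.\<close>

lemma (in param_code) factor_set_iff:
  assumes "\<forall>\<sigma> \<mu>. \<sigma> \<subseteq> I \<longrightarrow> \<mu> \<subseteq> I \<longrightarrow> \<phi> (v \<sigma>) (v \<mu>) = bit_sign (p \<sigma> \<mu>)"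
  shows "code_factor_set m E \<phi> \<longleftrightarrow>
    (\<forall>\<sigma>. \<sigma> \<subseteq> I \<longrightarrow> p \<sigma> \<sigma> = f \<sigma> \<sigma>) \<and>
    (\<forall>\<sigma>. \<sigma> \<subseteq> I \<longrightarrow> (\<forall>\<mu>. \<mu> \<subseteq> I \<longrightarrow> p \<sigma> \<mu> = (f \<sigma> \<mu> + f \<mu> \<sigma>) + p \<mu> \<sigma>)) \<and>
    (\<forall>\<sigma>. \<sigma> \<subseteq> I \<longrightarrow> p {} \<sigma> = 0 \<and> p \<sigma> {} = 0) \<and>
    (\<forall>\<sigma>. \<sigma> \<subseteq> I \<longrightarrow> (\<forall>\<mu>. \<mu> \<subseteq> I \<longrightarrow> (\<forall>\<rho>. \<rho> \<subseteq> I \<longrightarrow>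
      p (sym_diff \<sigma> \<mu>) \<rho> = p \<sigma> (sym_diff \<mu> \<rho>) + p \<sigma> \<mu> + p \<mu> \<rho> + t \<sigma> \<mu> \<rho>)))"
proof -
  note \<phi> = assms[rule_format]
  have ball: "(\<forall>x\<in>E. P x) \<longleftrightarrow> (\<forall>\<sigma>. \<sigma> \<subseteq> I \<longrightarrow> P (v \<sigma>))" for P unfolding E_eq by auto
  have sd: "sym_diff \<sigma> \<mu> \<subseteq> I" if "\<sigma> \<subseteq> I" "\<mu> \<subseteq> I" for \<sigma> \<mu> using that by auto
  have eqs: "(-1) ^ (card (supp (v \<sigma>)) div 4) = bit_sign (f \<sigma> \<sigma>)"
    "(-1) ^ (card (supp (v \<sigma>) \<inter> supp (v \<mu>)) div 2) = bit_sign (f \<sigma> \<mu> + f \<mu> \<sigma>)"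
    "(-1) ^ card (supp (v \<sigma>) \<inter> supp (v \<mu>) \<inter> supp (v \<rho>)) = bit_sign (t \<sigma> \<mu> \<rho>)"
    if "\<sigma> \<subseteq> I" "\<mu> \<subseteq> I" "\<rho> \<subseteq> I" for \<sigma> \<mu> \<rho>
    using that domI by (simp_all add: bit_sign_of_nat[symmetric] f_square f_commutator t_eq T_def)
  have 1: "\<forall>x\<in>E. \<forall>y\<in>E. \<phi> x y \<in> {1, -1}" unfolding ball using \<phi> bit_sign_cases by simp
  have 2: "(\<forall>x\<in>E. \<phi> x x = (-1) ^ (card (supp x) div 4)) \<longleftrightarrow>
      (\<forall>\<sigma>. \<sigma> \<subseteq> I \<longrightarrow> p \<sigma> \<sigma> = f \<sigma> \<sigma>)"
    unfolding ball by (simp add: \<phi> eqs)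
  have 3: "(\<forall>x\<in>E. \<forall>y\<in>E. \<phi> x y = (-1) ^ (card (supp x \<inter> supp y) div 2) * \<phi> y x) \<longleftrightarrow>
      (\<forall>\<sigma>. \<sigma> \<subseteq> I \<longrightarrow> (\<forall>\<mu>. \<mu> \<subseteq> I \<longrightarrow> p \<sigma> \<mu> = (f \<sigma> \<mu> + f \<mu> \<sigma>) + p \<mu> \<sigma>))"
    unfolding ball by (simp only: \<phi> eqs bit_sign_add[symmetric] bit_sign_simps cong: imp_cong)
  have 4: "(\<forall>x\<in>E. \<phi> (0\<^sub>v m) x = 1 \<and> \<phi> x (0\<^sub>v m) = 1) \<longleftrightarrow>
      (\<forall>\<sigma>. \<sigma> \<subseteq> I \<longrightarrow> p {} \<sigma> = 0 \<and> p \<sigma> {} = 0)"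
    unfolding ball v_empty[symmetric] by (simp only: \<phi> empty_subsetI bit_sign_simps cong: imp_cong)
  have 5: "(\<forall>x\<in>E. \<forall>y\<in>E. \<forall>z\<in>E. \<phi> (x + y) z =
      \<phi> x (y + z) * \<phi> x y * \<phi> y z * (-1) ^ card (supp x \<inter> supp y \<inter> supp z)) \<longleftrightarrow>
      (\<forall>\<sigma>. \<sigma> \<subseteq> I \<longrightarrow> (\<forall>\<mu>. \<mu> \<subseteq> I \<longrightarrow> (\<forall>\<rho>. \<rho> \<subseteq> I \<longrightarrow>
        p (sym_diff \<sigma> \<mu>) \<rho> = p \<sigma> (sym_diff \<mu> \<rho>) + p \<sigma> \<mu> + p \<mu> \<rho> + t \<sigma> \<mu> \<rho>)))"
    unfolding ball by (simp only: v_add[symmetric] sd \<phi> eqs bit_sign_add[symmetric] bit_sign_simps cong: imp_cong)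
  have eq: "(A \<and> B) = B" if A for A B using that by simp
  show ?thesis unfolding code_factor_set_def 2 3 4 5 by (rule eq[OF 1])
qed

text \<open>The factor set of the functional, transported to codewords by their coordinates, is
  admissible itself, so no coboundary correction occurs.\<close>

lemma (in param_code) code_hom_standard:
  assumes "\<exists>z \<in> central_on I. lam z = 1"
  shows "code_hom I lam v m E
    (\<lambda>x y. bit_sign (f (inv_into (Pow I) v x) (inv_into (Pow I) v y))) (\<lambda>_. 0)"
proof
  have inv: "inv_into (Pow I) v (v \<sigma>) = \<sigma>" if "\<sigma> \<subseteq> I" for \<sigma>
    using v_bij that by (simp add: bij_betw_def inv_into_f_f)
  show "bit_sign (f (inv_into (Pow I) v (v \<sigma>)) (inv_into (Pow I) v (v \<mu>)))
      = bit_sign (0 + 0 + f \<sigma> \<mu> + 0)" if "\<sigma> \<subseteq> I" "\<mu> \<subseteq> I" for \<sigma> \<mu>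
    using that by (simp add: inv)
  have "p (sym_diff \<sigma> \<mu>) \<rho> = p \<sigma> (sym_diff \<mu> \<rho>) + p \<sigma> \<mu> + p \<mu> \<rho> + t \<sigma> \<mu> \<rho>"
    if "p = f" "\<sigma> \<subseteq> I" "\<mu> \<subseteq> I" "\<rho> \<subseteq> I" for \<sigma> \<mu> \<rho> p
    using f_associator[OF domI domI domI, OF that(2-4)] unfolding that(1) Z2.bit_eq_iff even_add by argo
  moreover have "f \<sigma> \<mu> = (f \<sigma> \<mu> + f \<mu> \<sigma>) + f \<mu> \<sigma>" for \<sigma> \<mu> by (simp add: add.assoc)
  ultimately show "code_factor_set m E
      (\<lambda>x y. bit_sign (f (inv_into (Pow I) v x) (inv_into (Pow I) v y)))"
    by (subst factor_set_iff[where p = f]) (simp_all add: inv)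
qed (use assms in auto)

text \<open>The functional is the indicator of the complement of \<open>T\<close>. Translation by an
  element \<open>a\<close> outside maps \<open>T\<close> injectively into the complement, which has
  the same size and is thus the single coset \<open>a + T\<close>; this settles additivity for two
  elements outside \<open>T\<close>.\<close>

lemma index2_functional:
  assumes "finite I" and T: "T \<subseteq> central_on I" "0 \<in> T" "\<And>a b. a \<in> T \<Longrightarrow> b \<in> T \<Longrightarrow> a + b \<in> T"
    and card: "card (central_on I) = 2 * card T"
  obtains lam where "central_functional I lam" "T = {z \<in> central_on I. lam z = 0}"
    "\<exists>z \<in> central_on I. lam z = 1"
proof -
  let ?C = "central_on I"
  define lam :: "central \<Rightarrow> bit" where "lam z = (if z \<in> T then 0 else 1)" for z
  have fin: "finite ?C" "finite T" using finite_central_on[OF \<open>finite I\<close>] T(1) finite_subset by auto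
  have diff: "card (?C - T) = card T" using card_Diff_subset[OF fin(2) T(1)] card by simp
  have mixed: "a + b \<notin> T" if "a \<notin> T" "b \<in> T" for a b
  proof
    assume "a + b \<in> T"
    then have "(a + b) + b \<in> T" using T(3) that(2) by blast
    then show False using that(1) by (simp add: add.assoc)
  qed
  have both: "a + b \<in> T" if a: "a \<in> ?C" "a \<notin> T" and b: "b \<in> ?C" "b \<notin> T" for a b
  proof -
    have "(+) a ` T \<subseteq> ?C - T" using mixed[OF a(2)] a(1) T(1) central_on_add by blast
    moreover have "inj_on ((+) a) T" by (rule inj_onI) simp
    then have "card ((+) a ` T) = card (?C - T)" using diff by (simp add: card_image)
    ultimately have "(+) a ` T = ?C - T" using fin(1) by (intro card_subset_eq) simp_all
    then obtain c where "c \<in> T" "b = a + c" using b by blast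
    then show ?thesis by simp
  qed
  show thesis
  proof (rule that[of lam])
    show "central_functional I lam"
    proof
      fix a b assume "a \<in> ?C" "b \<in> ?C"
      then show "lam (a + b) = lam a + lam b"
        using both[of a b] mixed[of a b] mixed[of b a] T(3)[of a b]
        by (cases "a \<in> T"; cases "b \<in> T") (simp_all add: lam_def add.commute)
    qed
    show "T = {z \<in> ?C. lam z = 0}" using T(1) by (auto simp: lam_def)
    have "card (?C - T) > 0" using diff fin(2) T(2) by (metis card_gt_0_iff empty_iff)
    then obtain z where "z \<in> ?C - T" by (metis card_gt_0_iff ex_in_conv)
    then show "\<exists>z \<in> ?C. lam z = 1" by (auto simp: lam_def)
  qed
qed

text \<open>The common ground of the claims about quotients: \<open>T\<close> is the kernel of a
  functional that is realized by a code.\<close>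

lemma center_codim1_code_hom:
  assumes "center_codim1 (F_on {1..n}) T"
  obtains lam v m E \<phi> eta where "code_hom {1..n} lam v m E \<phi> eta"
    "T = {{}} \<times> {z \<in> central_on {1..n}. lam z = 0}"
proof -
  interpret wide "{1..n}" by (rule center_codim1_wide[OF assms])
  have fin: "finite (loop_center (F_on {1..n}))" unfolding center
    by (intro finite_cartesian_product finite_central_on[OF finite_I]) simp
  note D = center_codim1D[OF assms fin, unfolded center one_F_on]
  define T0 where "T0 = snd ` T"
  have T: "T = {{}} \<times> T0" using D(2) by (force simp: T0_def)
  have "T0 \<subseteq> central_on {1..n}" "0 \<in> T0" using D(2,3) by (auto simp: T)
  moreover have "a + b \<in> T0" if "a \<in> T0" "b \<in> T0" for a b
    using D(4)[of "({}, a)" "({}, b)"] that by (simp add: T)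
  moreover have "card (central_on {1..n}) = 2 * card T0"
    using D(5) by (simp add: T card_cartesian_product)
  ultimately obtain lam where lam: "central_functional {1..n} lam"
    and T0: "T0 = {z \<in> central_on {1..n}. lam z = 0}" and nz: "\<exists>z \<in> central_on {1..n}. lam z = 1"
    by (rule index2_functional[OF finite_I]) (assumption, assumption, rule that)
  obtain v m where "param_code {1..n} lam v m (v ` Pow {1..n})" using code_exists[OF lam finite_I] .
  from param_code.code_hom_standard[OF this nz] show thesis using that T T0 by blast
qed

lemma code_coordinates:
  assumes "double_even_code m E"
  obtains v where "bij_betw v (Pow {1..code_dim m E}) E"
    "\<And>\<sigma> \<mu>. \<sigma> \<subseteq> {1..code_dim m E} \<Longrightarrow> \<mu> \<subseteq> {1..code_dim m E} \<Longrightarrow> v (sym_diff \<sigma> \<mu>) = v \<sigma> + v \<mu>"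
proof -
  have "inj_on supp (carrier_vec m)"
  proof (rule inj_onI)
    fix x y :: "bit vec" assume xy: "x \<in> carrier_vec m" "y \<in> carrier_vec m" "supp x = supp y"
    show "x = y"
    proof (rule eq_vecI)
      fix i assume i: "i < dim_vec y"
      then have "x $ i = 1 \<longleftrightarrow> y $ i = 1" using xy by (auto simp: supp_def set_eq_iff)
      then show "x $ i = y $ i" by (cases "x $ i"; cases "y $ i") simp_all
    qed (use xy in auto)
  qed
  moreover have "supp ` carrier_vec m \<subseteq> Pow {..<m}" by (auto simp: supp_def)
  ultimately have "finite (carrier_vec m :: bit vec set)"
    by (meson finite_Pow_iff finite_imageD finite_lessThan finite_subset)
  then have fin: "finite E" using double_even_codeD(1)[OF assms] finite_subset by blast
  have "VectorSpace.subspace class_ring E (module_vec TYPE(bit) m)"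
    using assms by (simp add: double_even_code_def)
  then have vs: "vectorspace class_ring (module_vec TYPE(bit) m\<lparr>carrier := E\<rparr>)"
    by (rule vectorspace.subspace_is_vs[OF vec_vs])
  obtain v where "bij_betw v (Pow {1..code_dim m E}) E"
    "\<And>\<sigma> \<mu>. \<sigma> \<subseteq> {1..code_dim m E} \<Longrightarrow> \<mu> \<subseteq> {1..code_dim m E} \<Longrightarrow> v (sym_diff \<sigma> \<mu>) = v \<sigma> + v \<mu>"
    by (rule bit_vs_coordinates[OF vs]) (simp_all add: fin code_dim_def module_vec_simps)
  then show thesis by (rule that)
qed

text \<open>Counterpart of \<open>code_exists\<close>: here the code is given and the functional is
  fitted to it. Basis elements of W and U are indexed by sets, so their values are cardinalities of
  intersections over the index set.\<close>

lemma code_param: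
  assumes E: "double_even_code m E"
  obtains lam v where "param_code {1..code_dim m E} lam v m E"
proof -
  let ?I = "{1..code_dim m E}"
  obtain v where v: "bij_betw v (Pow ?I) E"
    and v_add: "\<And>\<sigma> \<mu>. \<sigma> \<subseteq> ?I \<Longrightarrow> \<mu> \<subseteq> ?I \<Longrightarrow> v (sym_diff \<sigma> \<mu>) = v \<sigma> + v \<mu>"
    by (rule code_coordinates[OF E]) (rule that)
  have vE: "v \<sigma> \<in> E" if "\<sigma> \<subseteq> ?I" for \<sigma> using v that by (auto simp: bij_betw_def)
  obtain lam :: "central \<Rightarrow> bit" where lam: "\<And>x y. lam (x + y) = lam x + lam y"
    "\<And>i. lam (Poly_Mapping.single i 1, 0, 0) = of_nat (card (supp (v {i})) div 4)"
    "\<And>i j. i \<noteq> j \<Longrightarrow> lam (0, wedge2 i j, 0) = of_nat (card (\<Inter>l\<in>{i, j}. supp (v {l})) div 2)"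
    "\<And>i j k. i \<noteq> j \<Longrightarrow> j \<noteq> k \<Longrightarrow> i \<noteq> k \<Longrightarrow>
      lam (0, 0, wedge3 i j k) = of_nat (card (\<Inter>l\<in>{i, j, k}. supp (v {l})))"
    by (rule functional_exists[of "\<lambda>i. of_nat (card (supp (v {i})) div 4)"
          "\<lambda>p. of_nat (card (\<Inter>l\<in>p. supp (v {l})) div 2)" "\<lambda>t. of_nat (card (\<Inter>l\<in>t. supp (v {l})))"])
      (rule that)
  note D = double_even_codeD[OF E]
  have "param_code ?I lam v m E"
  proof
    show "supp (v (sym_diff \<sigma> \<mu>)) = sym_diff (supp (v \<sigma>)) (supp (v \<mu>))"
      if "finite \<sigma> \<and> \<sigma> \<subseteq> ?I" "finite \<mu> \<and> \<mu> \<subseteq> ?I" for \<sigma> \<mu>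
      using that vE D(1) v_add supp_add by (metis subsetD)
    show "4 dvd card (supp (v \<sigma>))" if "finite \<sigma> \<and> \<sigma> \<subseteq> ?I" for \<sigma>
      using D(4) vE that by blast
    show "even (card (supp (v \<sigma>) \<inter> supp (v \<mu>)))"
      if "finite \<sigma> \<and> \<sigma> \<subseteq> ?I" "finite \<mu> \<and> \<mu> \<subseteq> ?I" for \<sigma> \<mu>
      using D(5) vE that by blast
    show "lam (0, wedge2 i j, 0) = of_nat (card (supp (v {i}) \<inter> supp (v {j})) div 2)"
      if "i < j" for i j
      using lam(3)[of i j] that by simp
    show "lam (0, 0, wedge3 i j k) = of_nat (card (supp (v {i}) \<inter> supp (v {j}) \<inter> supp (v {k})))"
      if "i \<noteq> j" "j \<noteq> k" "i \<noteq> k" for i j k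
      using lam(4)[OF that] by (simp add: Int_assoc)
  qed (rule lam finite_supp finite_atLeastAtMost v E v_add; assumption)+
  then show thesis by (rule that)
qed

lemma (in param_code) factor_set_coboundary:
  assumes \<phi>: "code_factor_set m E \<phi>"
  obtains eta where "eta {} = 0" "\<And>\<sigma> \<mu>. \<sigma> \<subseteq> I \<Longrightarrow> \<mu> \<subseteq> I \<Longrightarrow>
      \<phi> (v \<sigma>) (v \<mu>) = bit_sign (eta \<sigma> + eta \<mu> + f \<sigma> \<mu> + eta (sym_diff \<sigma> \<mu>))"
proof -
  define p where "p \<sigma> \<mu> = (if \<phi> (v \<sigma>) (v \<mu>) = 1 then 0 else 1 :: bit)" for \<sigma> \<mu>
  have p: "\<phi> (v \<sigma>) (v \<mu>) = bit_sign (p \<sigma> \<mu>)" if "\<sigma> \<subseteq> I" "\<mu> \<subseteq> I" for \<sigma> \<mu>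
  proof -
    have "\<forall>x\<in>E. \<forall>y\<in>E. \<phi> x y \<in> {1, -1}"
      using \<phi> unfolding code_factor_set_def by (rule conjunct1)
    then have "\<phi> (v \<sigma>) (v \<mu>) \<in> {1, -1}" using v_in_E that by blast
    then show ?thesis by (auto simp: p_def)
  qed
  then have "\<forall>\<sigma> \<mu>. \<sigma> \<subseteq> I \<longrightarrow> \<mu> \<subseteq> I \<longrightarrow> \<phi> (v \<sigma>) (v \<mu>) = bit_sign (p \<sigma> \<mu>)" by blast
  note C = factor_set_iff[OF this, THEN iffD1, OF \<phi>]
  note p2 = C[THEN conjunct1, rule_format]
    and p3 = C[THEN conjunct2, THEN conjunct1, rule_format]
    and p5 = C[THEN conjunct2, THEN conjunct2, THEN conjunct2, rule_format]
  \<comment> \<open>Over \<open>bit\<close> a sum is also a difference, so \<open>th\<close> is the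
    exponent of the quotient of the two factor sets.\<close>
  define th where "th \<sigma> \<mu> = p \<sigma> \<mu> + f \<sigma> \<mu>" for \<sigma> \<mu>
  have "\<exists>eta. eta {} = 0 \<and>
    (\<forall>\<sigma> \<mu>. \<sigma> \<subseteq> I \<longrightarrow> \<mu> \<subseteq> I \<longrightarrow> th \<sigma> \<mu> = eta \<sigma> + eta \<mu> + eta (sym_diff \<sigma> \<mu>))"
  proof (rule coboundary[OF finite_I])
    show "th \<sigma> \<mu> = th \<mu> \<sigma>" if "\<sigma> \<subseteq> I" "\<mu> \<subseteq> I" for \<sigma> \<mu>
      using p3[OF that] unfolding th_def Z2.bit_eq_iff even_add by argo
    show "th \<sigma> \<sigma> = 0" if "\<sigma> \<subseteq> I" for \<sigma>
      using p2[OF that] by (simp add: th_def)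
    show "th (sym_diff \<sigma> \<mu>) \<rho> + th \<sigma> \<mu> = th \<sigma> (sym_diff \<mu> \<rho>) + th \<mu> \<rho>"
      if "\<sigma> \<subseteq> I" "\<mu> \<subseteq> I" "\<rho> \<subseteq> I" for \<sigma> \<mu> \<rho>
      using p5[OF that] f_associator[OF domI domI domI, OF that]
      unfolding th_def Z2.bit_eq_iff even_add by argo
  qed
  then obtain eta where eta0: "eta {} = 0"
    and eta: "\<And>\<sigma> \<mu>. \<sigma> \<subseteq> I \<Longrightarrow> \<mu> \<subseteq> I \<Longrightarrow> th \<sigma> \<mu> = eta \<sigma> + eta \<mu> + eta (sym_diff \<sigma> \<mu>)" by blast
  show thesis
  proof (rule that[of eta, OF eta0])
    fix \<sigma> \<mu> assume m: "\<sigma> \<subseteq> I" "\<mu> \<subseteq> I"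
    have "p \<sigma> \<mu> = eta \<sigma> + eta \<mu> + f \<sigma> \<mu> + eta (sym_diff \<sigma> \<mu>)"
      using eta[OF m] unfolding th_def Z2.bit_eq_iff even_add by argo
    then show "\<phi> (v \<sigma>) (v \<mu>) = bit_sign (eta \<sigma> + eta \<mu> + f \<sigma> \<mu> + eta (sym_diff \<sigma> \<mu>))"
      by (simp add: p[OF m])
  qed
qed

text \<open>If the functional vanishes on the central part, so does \<open>f\<close>, and \<phi> is
  a coboundary. Correcting each sign by \<open>eta\<close> then turns the loop into the direct
  product of the signs and the code.\<close>

lemma (in param_code) code_loop_elementary_abelian:
  assumes \<phi>: "code_factor_set m E \<phi>" and zero: "\<And>z. z \<in> central_on I \<Longrightarrow> lam z = 0"
  defines "C \<equiv> code_loop_of m E \<phi>"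
  assumes "x \<in> carrier C" "y \<in> carrier C" "z \<in> carrier C"
  shows "x \<otimes>\<^bsub>C\<^esub> y = y \<otimes>\<^bsub>C\<^esub> x" "(x \<otimes>\<^bsub>C\<^esub> y) \<otimes>\<^bsub>C\<^esub> z = x \<otimes>\<^bsub>C\<^esub> (y \<otimes>\<^bsub>C\<^esub> z)"
    "x \<otimes>\<^bsub>C\<^esub> x = \<one>\<^bsub>C\<^esub>"
proof -
  obtain eta where eta: "eta {} = 0" "\<And>\<sigma> \<mu>. \<sigma> \<subseteq> I \<Longrightarrow> \<mu> \<subseteq> I \<Longrightarrow>
      \<phi> (v \<sigma>) (v \<mu>) = bit_sign (eta \<sigma> + eta \<mu> + f \<sigma> \<mu> + eta (sym_diff \<sigma> \<mu>))"
    using factor_set_coboundary[OF \<phi>] by blast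
  have f0: "f \<sigma> \<mu> = 0" if "\<sigma> \<subseteq> I" "\<mu> \<subseteq> I" for \<sigma> \<mu>
    unfolding f_def by (rule zero, rule F_cocycle_in_central_on[OF that])
  have \<phi>_eq: "\<phi> (v \<sigma>) (v \<mu>) = bit_sign (eta \<sigma> + eta \<mu> + eta (sym_diff \<sigma> \<mu>))" if "\<sigma> \<subseteq> I" "\<mu> \<subseteq> I" for \<sigma> \<mu>
    using eta(2)[OF that] f0[OF that] by simp
  have ex: "\<exists>b \<sigma>. \<sigma> \<subseteq> I \<and> x = (bit_sign (b + eta \<sigma>), v \<sigma>)" if x: "x \<in> carrier C" for x
  proof -
    obtain e \<sigma> where e: "x = (e, v \<sigma>)" "e = 1 \<or> e = -1" "\<sigma> \<subseteq> I"
      using x by (auto simp: C_def code_loop_of_def E_eq)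
    obtain b where "e = bit_sign b" using e(2) bit_sign_simps(1,2) by metis
    then have "x = (bit_sign ((b + eta \<sigma>) + eta \<sigma>), v \<sigma>)" by (simp add: e(1) add.assoc)
    then show ?thesis using e(3) by blast
  qed
  have mult: "(bit_sign (b + eta \<sigma>), v \<sigma>) \<otimes>\<^bsub>C\<^esub> (bit_sign (c + eta \<mu>), v \<mu>)
      = (bit_sign ((b + c) + eta (sym_diff \<sigma> \<mu>)), v (sym_diff \<sigma> \<mu>))" if "\<sigma> \<subseteq> I" "\<mu> \<subseteq> I" for b c \<sigma> \<mu>
  proof -
    have "(b + eta \<sigma>) + (c + eta \<mu>) + (eta \<sigma> + eta \<mu> + eta (sym_diff \<sigma> \<mu>))
        = (b + c) + eta (sym_diff \<sigma> \<mu>)" unfolding Z2.bit_eq_iff even_add by argo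
    then show ?thesis
      by (simp only: C_def code_loop_of_def monoid.simps prod.case \<phi>_eq[OF that] v_add[OF that]
          bit_sign_add[symmetric])
  qed
  obtain b \<sigma> where x: "\<sigma> \<subseteq> I" "x = (bit_sign (b + eta \<sigma>), v \<sigma>)" using ex[OF assms(4)] by blast
  obtain c \<mu> where y: "\<mu> \<subseteq> I" "y = (bit_sign (c + eta \<mu>), v \<mu>)" using ex[OF assms(5)] by blast
  obtain d \<rho> where z: "\<rho> \<subseteq> I" "z = (bit_sign (d + eta \<rho>), v \<rho>)" using ex[OF assms(6)] by blast
  have sd: "sym_diff \<sigma> \<mu> \<subseteq> I" "sym_diff \<mu> \<rho> \<subseteq> I" using x y z by auto
  have "sym_diff \<sigma> \<mu> = sym_diff \<mu> \<sigma>" by auto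
  then show "x \<otimes>\<^bsub>C\<^esub> y = y \<otimes>\<^bsub>C\<^esub> x"
    unfolding x(2) y(2) mult[OF x(1) y(1)] mult[OF y(1) x(1)] by (simp add: add.commute)
  have "sym_diff (sym_diff \<sigma> \<mu>) \<rho> = sym_diff \<sigma> (sym_diff \<mu> \<rho>)" by auto
  then show "(x \<otimes>\<^bsub>C\<^esub> y) \<otimes>\<^bsub>C\<^esub> z = x \<otimes>\<^bsub>C\<^esub> (y \<otimes>\<^bsub>C\<^esub> z)"
    unfolding x(2) y(2) z(2) mult[OF x(1) y(1)] mult[OF y(1) z(1)] mult[OF sd(1) z(1)]
      mult[OF x(1) sd(2)] by (simp only: add.assoc)
  show "x \<otimes>\<^bsub>C\<^esub> x = \<one>\<^bsub>C\<^esub>"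
    unfolding x(2) mult[OF x(1) x(1)] by (simp add: eta(1) v_empty C_def code_loop_of_def)
qed

lemma elementary_abelian_2I:
  assumes "loop L" and comm: "\<And>x y. x \<in> carrier L \<Longrightarrow> y \<in> carrier L \<Longrightarrow> x \<otimes>\<^bsub>L\<^esub> y = y \<otimes>\<^bsub>L\<^esub> x"
    and assoc: "\<And>x y z. x \<in> carrier L \<Longrightarrow> y \<in> carrier L \<Longrightarrow> z \<in> carrier L \<Longrightarrow>
      (x \<otimes>\<^bsub>L\<^esub> y) \<otimes>\<^bsub>L\<^esub> z = x \<otimes>\<^bsub>L\<^esub> (y \<otimes>\<^bsub>L\<^esub> z)"
    and sq: "\<And>x. x \<in> carrier L \<Longrightarrow> x \<otimes>\<^bsub>L\<^esub> x = \<one>\<^bsub>L\<^esub>"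
  shows "elementary_abelian_2 L"
proof -
  interpret loop L by fact
  have "comm_group L"
    by (rule comm_groupI) (use m_closed one_closed l_one comm assoc sq in blast)+
  then show ?thesis using sq by (simp add: elementary_abelian_2_def)
qed

lemma code_loop_rank_covering:
  assumes L: "code_loop_of_rank n L" and n: "n \<ge> 2" and na: "\<not> elementary_abelian_2 L"
  shows "\<exists>\<psi> \<in> hom (F_on {1..n}) L. \<psi> ` carrier (F_on {1..n}) = carrier L \<and>
    center_codim1 (F_on {1..n}) (kernel (F_on {1..n}) L \<psi>)"
proof -
  obtain m E \<phi> h where loop: "loop L" and E: "double_even_code m E" and dim: "code_dim m E = n"
    and \<phi>: "code_factor_set m E \<phi>" and h: "h \<in> iso L (code_loop_of m E \<phi>)"
    using L by (auto simp: code_loop_of_rank_def is_iso_def)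
  let ?I = "{1..n}" and ?C = "code_loop_of m E \<phi>"
  interpret L: loop L by (rule loop)
  interpret C: loop ?C by (rule loop_code_loop_of[OF E \<phi>])
  have hom: "h (x \<otimes>\<^bsub>L\<^esub> y) = h x \<otimes>\<^bsub>?C\<^esub> h y" if "x \<in> carrier L" "y \<in> carrier L" for x y
    using h that by (auto simp: iso_def hom_def)
  have hC: "h x \<in> carrier ?C" if "x \<in> carrier L" for x using h that by (auto simp: iso_def hom_def)
  have inj: "h x = h y \<longleftrightarrow> x = y" if "x \<in> carrier L" "y \<in> carrier L" for x y
    using h that by (auto simp: iso_def bij_betw_def inj_on_def)
  have img: "h ` carrier L = carrier ?C" using h by (simp add: iso_iff)
  \<comment> \<open>An isomorphism of records need not respect the field \<open>one\<close>, but the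
    image of the identity is idempotent, and unique division leaves the identity as the only
    idempotent.\<close>
  have h_one: "h \<one>\<^bsub>L\<^esub> = \<one>\<^bsub>?C\<^esub>"
  proof -
    note 1 = hC[OF L.one_closed]
    have "h \<one>\<^bsub>L\<^esub> \<otimes>\<^bsub>?C\<^esub> h \<one>\<^bsub>L\<^esub> = h \<one>\<^bsub>L\<^esub>"
      using hom[OF L.one_closed L.one_closed] by (simp only: L.l_one[OF L.one_closed])
    moreover have "h \<one>\<^bsub>L\<^esub> \<otimes>\<^bsub>?C\<^esub> \<one>\<^bsub>?C\<^esub> = h \<one>\<^bsub>L\<^esub>" by (rule C.r_one[OF 1])
    ultimately show ?thesis using C.l_div[OF 1 1] 1 C.one_closed by metis
  qed
  obtain lam v where "param_code ?I lam v m E" by (rule code_param[OF E, unfolded dim])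
  then interpret param_code ?I lam v m E .
  obtain eta where eta: "eta {} = 0" "\<And>\<sigma> \<mu>. \<sigma> \<subseteq> ?I \<Longrightarrow> \<mu> \<subseteq> ?I \<Longrightarrow>
      \<phi> (v \<sigma>) (v \<mu>) = bit_sign (eta \<sigma> + eta \<mu> + f \<sigma> \<mu> + eta (sym_diff \<sigma> \<mu>))"
    using factor_set_coboundary[OF \<phi>] by blast
  \<comment> \<open>The hypothesis that \<open>L\<close> is not elementary abelian is what excludes
    the zero functional.\<close>
  have nonzero: "\<exists>z \<in> central_on ?I. lam z = 1"
  proof (rule ccontr)
    assume "\<not> ?thesis"
    then have zero: "lam z = 0" if "z \<in> central_on ?I" for z using that by (cases "lam z") auto
    note ab = code_loop_elementary_abelian[OF \<phi> zero]
    have "elementary_abelian_2 L"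
    proof (rule elementary_abelian_2I[OF loop])
      fix x y assume xy: "x \<in> carrier L" "y \<in> carrier L"
      show "x \<otimes>\<^bsub>L\<^esub> y = y \<otimes>\<^bsub>L\<^esub> x"
        using ab(1)[OF _ hC hC hC, OF _ xy xy(1)] hom[OF xy] hom[OF xy(2,1)]
          inj[OF L.m_closed L.m_closed, OF xy xy(2,1)] by metis
      fix z assume z: "z \<in> carrier L"
      show "(x \<otimes>\<^bsub>L\<^esub> y) \<otimes>\<^bsub>L\<^esub> z = x \<otimes>\<^bsub>L\<^esub> (y \<otimes>\<^bsub>L\<^esub> z)"
        using ab(2)[OF _ hC hC hC, OF _ xy z] hom xy z inj L.m_closed by metis
    next
      fix x assume x: "x \<in> carrier L"
      show "x \<otimes>\<^bsub>L\<^esub> x = \<one>\<^bsub>L\<^esub>"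
        using ab(3)[OF _ hC hC hC, OF _ x x x] hom[OF x x] h_one inj[OF L.m_closed L.one_closed, OF x x] by metis
    qed
    with na show False ..
  qed
  interpret code_hom ?I lam v m E \<phi> eta
    by unfold_locales (use eta nonzero \<phi> in auto)
  \<comment> \<open>The map \<open>g\<close> followed by the inverse of the isomorphism
    \<open>h\<close>; as \<open>h\<close> is injective and preserves the identity, the kernel stays
    that of \<open>g\<close>.\<close>
  define \<psi> where "\<psi> x = inv_into (carrier L) h (g x)" for x
  have gC: "g x \<in> carrier ?C" if "x \<in> carrier (F_on ?I)" for x using g_hom that by (auto simp: hom_def)
  have \<psi>: "\<psi> x \<in> carrier L" "h (\<psi> x) = g x" if "x \<in> carrier (F_on ?I)" for x
    using gC[OF that] unfolding \<psi>_def img[symmetric] by (rule inv_into_into, rule f_inv_into_f)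
  interpret F: loop "F_on ?I" by (rule loop_F_on)
  have \<psi>_hom: "\<psi> \<in> hom (F_on ?I) L"
  proof (rule homI)
    fix x y assume xy: "x \<in> carrier (F_on ?I)" "y \<in> carrier (F_on ?I)"
    have "h (\<psi> (x \<otimes>\<^bsub>F_on ?I\<^esub> y)) = g x \<otimes>\<^bsub>?C\<^esub> g y"
      unfolding \<psi>(2)[OF F.m_closed[OF xy]] using g_hom xy by (simp add: hom_def)
    also have "\<dots> = h (\<psi> x \<otimes>\<^bsub>L\<^esub> \<psi> y)" by (simp only: hom \<psi> xy)
    finally show "\<psi> (x \<otimes>\<^bsub>F_on ?I\<^esub> y) = \<psi> x \<otimes>\<^bsub>L\<^esub> \<psi> y"
      by (simp only: inj \<psi>(1) xy F.m_closed L.m_closed)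
  qed (rule \<psi>(1))
  have \<psi>_surj: "\<psi> ` carrier (F_on ?I) = carrier L"
  proof
    show "\<psi> ` carrier (F_on ?I) \<subseteq> carrier L" using \<psi>(1) by blast
    show "carrier L \<subseteq> \<psi> ` carrier (F_on ?I)"
    proof
      fix y assume y: "y \<in> carrier L"
      then have "h y \<in> g ` carrier (F_on ?I)" using hC g_surj by blast
      then obtain x where x: "x \<in> carrier (F_on ?I)" "h y = g x" by blast
      then have "y = \<psi> x" using \<psi>[OF x(1)] inj[OF y \<psi>(1)[OF x(1)]] by simp
      then show "y \<in> \<psi> ` carrier (F_on ?I)" using x(1) by blast
    qed
  qed
  have kernel_\<psi>: "kernel (F_on ?I) L \<psi> = {{}} \<times> ker"
  proof -
    have "\<psi> x = \<one>\<^bsub>L\<^esub> \<longleftrightarrow> g x = \<one>\<^bsub>?C\<^esub>" if "x \<in> carrier (F_on ?I)" for x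
      using inj[OF \<psi>(1)[OF that] L.one_closed] \<psi>(2)[OF that] h_one by simp
    then show ?thesis unfolding kernel_g[symmetric] by (auto simp: kernel_def)
  qed
  have "center_codim1 (F_on ?I) ({{}} \<times> ker)"
  proof -
    show ?thesis
      by (rule wide.center_codim1I[OF wide_atLeastAtMost[OF n]]) (use ker_add card_ker in auto)
  qed
  then show ?thesis
    by (intro bexI[OF _ \<psi>_hom] conjI \<psi>_surj) (simp only: kernel_\<psi>)
qed

lemma U_in_F_Int: "carrier (F_on I) \<inter> U_in_F = carrier (F_on I) \<inter> {({}, (0, 0, u)) | u. True}"
  if "I \<subseteq> {1..}"
proof -
  have "u \<in> U_carrier" if "(0, 0, u) \<in> central_on I" for u
    using that \<open>I \<subseteq> {1..}\<close> by (auto simp: central_on_def U_carrier_def)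
  then show ?thesis by (auto simp: U_in_F_def)
qed

theorem corollary1:
  fixes n :: nat
  shows
    "(\<forall>L :: 'a monoid.
        code_loop_of_rank n L \<and> n \<ge> 2 \<and> \<not> elementary_abelian_2 L \<longrightarrow>
          (\<exists>\<phi> \<in> hom (Fn_loop n) L.
             \<phi> ` carrier (Fn_loop n) = carrier L \<and>
             center_codim1 (Fn_loop n) (kernel (Fn_loop n) L \<phi>)))
     \<and> (\<forall>T. center_codim1 (Fn_loop n) T \<longrightarrow> code_loop (Fn_loop n Mod T))
     \<and> (\<forall>T. center_codim1 (Fn_loop n) T \<longrightarrow>
          (group (Fn_loop n Mod T) \<longleftrightarrow> associator_subloop (Fn_loop n) \<subseteq> T))
     \<and> associator_subloop (Fn_loop n) = carrier (Fn_loop n) \<inter> U_in_F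
     \<and> U_in_F = associator_subloop F_loop"
  unfolding Fn_loop_eq
proof (intro conjI allI impI)
  fix L :: "'a monoid"
  assume "code_loop_of_rank n L \<and> n \<ge> 2 \<and> \<not> elementary_abelian_2 L"
  then show "\<exists>\<phi> \<in> hom (F_on {1..n}) L. \<phi> ` carrier (F_on {1..n}) = carrier L \<and>
      center_codim1 (F_on {1..n}) (kernel (F_on {1..n}) L \<phi>)"
    using code_loop_rank_covering by blast
next
  fix T assume "center_codim1 (F_on {1..n}) T"
  then obtain lam v m E \<phi> eta where "code_hom {1..n} lam v m E \<phi> eta"
    and T: "T = {{}} \<times> {z \<in> central_on {1..n}. lam z = 0}"
    by (rule center_codim1_code_hom)
  then interpret code_hom "{1..n}" lam v m E \<phi> eta by simp
  show "code_loop (F_on {1..n} Mod T)" unfolding T by (rule code_loop_quotient)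
  show "group (F_on {1..n} Mod T) \<longleftrightarrow> associator_subloop (F_on {1..n}) \<subseteq> T"
    unfolding T by (rule group_quotient_iff)
next
  show "associator_subloop (F_on {1..n}) = carrier (F_on {1..n}) \<inter> U_in_F"
    unfolding associator_subloop_F_on by (rule U_in_F_Int[symmetric]) auto
  have "U_in_F \<subseteq> carrier (F_on {1..})"
    by (auto simp: U_in_F_def U_carrier_def central_on_def)
  then show "U_in_F = associator_subloop F_loop"
    unfolding F_loop_eq associator_subloop_F_on using U_in_F_Int[of "{1..}"] by blast
qed

end
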